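(* Let $S_k$, $k\ge0$, $S_0=0$, be a centered random walk with i.i.d. increments $\{Y_k\}_{k\ge1}$ such that $x\mapsto\mathbb P(Y_1\le -x)$ is regularly varying at infinity with index $-\alpha<-1$ and $x\mapsto\mathbb P(Y_1\ge x)$ is regularly varying at infinity with index $-\beta<-1$. Let $\bar S_n(t)=S_{\lfloor nt\rfloor}/n$, $t\in[0,1]$. Let $A\subseteq\mathbb D$ be a Borel measurable set such that the minimization problem $$\min\{(\alpha-1)l_-+(\beta-1)l_+:(l_-,l_+)\in\mathbb Z_+^2,\ \mathbb D_{l_-;l_+}\cap A\ne\emptyset\}$$ has a unique minimizer $(l_-^*,l_+^* )$, such that $A$ is bounded away from $\mathbb D_{<l_-^*;l_+^*}$, and such that $C_{l_-^*;l_+^*}(A^\circ)>0$. Fix $w\in(0,1)$. Set $A_n=\{\bar S_n\in A\}$ and, for $\gamma=(\gamma_-,\gamma_+)\in(0,\infty)^2$, $B_n^\gamma=\{\bar S_n\in B^\gamma\}$. Then there exist $\gamma_->0$ and $\gamma_+>0$ such that the estimator $$Z_n=\frac{\mathbf 1_{A_n}}{w+\frac{1-w}{\mathbb P(B_n^\gamma)}\mathbf 1_{B_n^\gamma}},$$ sampled under $\mathbb Q_{\gamma,w}(\cdot)=w\,\mathbb P(\cdot)+(1-w)\,\mathbb P(\cdot\mid B_n^\gamma)$, is strongly efficient for estimating $\mathbb P(A_n)$, i.e. $\mathbb E^{\mathbb Q_{\gamma,w}}[Z_n^2]=\mathcal O(\mathbb P(A_n)^2)$ as $n\to\infty$.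
   Context: $\mathbb D$ is the space of real-valued càdlàg functions on $[0,1]$ with the Skorokhod $J_1$ metric $d(x,y)=\inf_{\lambda}\|\lambda-\mathrm{id}\|_\infty\vee\|x\circ\lambda-y\|_\infty$ (infimum over increasing continuous bijections $\lambda$ of $[0,1]$). $A$ is bounded away from $S$ if $\inf_{x\in A,y\in S}d(x,y)>0$ (with $\inf\emptyset=\infty$). $A^\circ$ is the interior of $A$. $\mathbb Z_+=\{0,1,2,\dots\}$. $\mathbb D_{l_-;l_+}$: the set of step functions in $\mathbb D$ vanishing at the origin with exactly $l_-$ downward jumps and $l_+$ upward jumps. $$I_{<l_-^*;l_+^*}=\{(l_-,l_+)\in\mathbb Z_+^2\setminus\{(l_-^*,l_+^* )\}:(\alpha-1)l_-+(\beta-1)l_+\le(\alpha-1)l_-^*+(\beta-1)l_+^*\},\qquad \mathbb D_{<l_-^*;l_+^*}=\bigcup_{(l_-,l_+)\in I_{<l_-^*;l_+^*}}\mathbb D_{l_-;l_+}.$$ Let $\mathbb D_{<l}$ be the set of non-decreasing step functions in $\mathbb D$ vanishing at $0$ with at most $l-1$ jumps ($\mathbb D_{<0}=\emptyset$), let $\mathbb C_{(l,m)}=(\mathbb D_{<l}\times\mathbb D)\cup(\mathbb D\times\mathbb D_{<m})$, and write $(l,m)\prec(l',m')$ iff $\mathbb C_{(l,m)}\subsetneq\mathbb C_{(l',m')}$. Let $$J_{l_-^*;l_+^*}=\{(l_-,l_+)\in\mathbb Z_+^2\setminus I_{<l_-^*;l_+^*}:(m_-,m_+)\prec(l_-,l_+)\Rightarrow(m_-,m_+)\in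 I_{<l_-^*;l_+^*}\},$$ and $B^\gamma=\bigcup_{(l_-,l_+)\in J_{l_-^*;l_+^*}}B^{\gamma;l_-;l_+}$, where $$B^{\gamma;l_-;l_+}=\{\xi\in\mathbb D:\#\{t:\xi(t^-)-\xi(t)>\gamma_-\}\ge l_-,\ \#\{t:\xi(t)-\xi(t^-)>\gamma_+\}\ge l_+\}.$$ With $\nu_\alpha(x,\infty)=x^{-\alpha}$ and $\nu_\beta(x,\infty)=x^{-\beta}$, let $\nu_\alpha^m$, $\nu_\beta^l$ be the restrictions of the $m$-fold, $l$-fold product measures to the sets of vectors with non-increasing coordinates. $C_{0;0}$ is the Dirac measure at the zero function, and for $(l_-,l_+)\ne(0,0)$, $$C_{l_-;l_+}(\cdot)=\mathbb E\Big[\nu_\alpha^{l_-}\times\nu_\beta^{l_+}\Big\{(x,y)\in(0,\infty)^{l_-}\times(0,\infty)^{l_+}:\sum_{i=1}^{l_+}y_i\mathbf 1_{[V_i,1]}-\sum_{i=1}^{l_-}x_i\mathbf 1_{[U_i,1]}\in\cdot\Big\}\Big],$$ with $U_i,V_i$ i.i.d. uniform on $[0,1]$. *)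

theory Defs
  imports "HOL-Probability.Probability" "HOL-Library.Landau_Symbols"
begin

section \<open>The Skorokhod space\<close>

definition is_cadlag :: "(real \<Rightarrow> real) \<Rightarrow> bool" where
  "is_cadlag f \<longleftrightarrow>
     (\<forall>t\<in>{0..<1}. (f \<longlongrightarrow> f t) (at_right t)) \<and>
     (\<forall>t\<in>{0<..1}. \<exists>l. (f \<longlongrightarrow> l) (at_left t))"

lemma is_cadlagI:
  assumes "\<And>t. 0 \<le> t \<Longrightarrow> t < 1 \<Longrightarrow> (f \<longlongrightarrow> f t) (at_right t)"
    and "\<And>t. 0 < t \<Longrightarrow> t \<le> 1 \<Longrightarrow> \<exists>l. (f \<longlongrightarrow> l) (at_left t)"
  shows "is_cadlag f"
  using assms by (auto simp: is_cadlag_def)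

lemma is_cadlag_cong:
  assumes fg: "\<And>t. 0 \<le> t \<Longrightarrow> t \<le> 1 \<Longrightarrow> f t = g t" and f: "is_cadlag f"
  shows "is_cadlag g"
proof (rule is_cadlagI)
  fix t :: real assume t: "0 \<le> t" "t < 1"
  have "\<forall>\<^sub>F s in at_right t. f s = g s"
    using eventually_at_right_less[of t] eventually_at_right[of t 1] t
    by (subst eventually_at_right[of t 1]) (auto intro!: exI[of _ 1] fg)
  moreover have "(f \<longlongrightarrow> f t) (at_right t)" using f t by (auto simp: is_cadlag_def)
  ultimately show "(g \<longlongrightarrow> g t) (at_right t)"
    using fg[of t] t by (auto simp: tendsto_cong)
next
  fix t :: real assume t: "0 < t" "t \<le> 1"
  have "\<forall>\<^sub>F s in at_left t. f s = g s"
    using t by (subst eventually_at_left[of 0 t]) (auto intro!: exI[of _ 0] fg)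
  moreover obtain l where "(f \<longlongrightarrow> l) (at_left t)" using f t unfolding is_cadlag_def by (metis greaterThanAtMost_iff)
  ultimately show "\<exists>l. (g \<longlongrightarrow> l) (at_left t)"
    by (auto simp: tendsto_cong)
qed

text \<open>
  Elements are normalised outside \<open>[0,1]\<close> (by extensionality), so that equality of elements
  is equality of functions on \<open>[0,1]\<close>.
\<close>

typedef cadlag = "{f :: real \<Rightarrow> real. f \<in> extensional {0..1} \<and> is_cadlag f}"
  morphisms path_of Abs_cadlag
proof -
  have "is_cadlag (\<lambda>_. 0)" by (auto simp: is_cadlag_def)
  hence "is_cadlag (restrict (\<lambda>_. 0) {0..1})" by (rule is_cadlag_cong[rotated]) auto
  thus ?thesis by (intro exI[of _ "restrict (\<lambda>_. 0) {0..1}"]) auto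
qed

definition to_cadlag :: "(real \<Rightarrow> real) \<Rightarrow> cadlag" where
  "to_cadlag f = Abs_cadlag (restrict f {0..1})"

lemma path_to_cadlag:
  assumes "is_cadlag f" "0 \<le> t" "t \<le> 1"
  shows "path_of (to_cadlag f) t = f t"
proof -
  have "is_cadlag (restrict f {0..1})" by (rule is_cadlag_cong[OF _ assms(1)]) auto
  thus ?thesis using assms unfolding to_cadlag_def by (subst Abs_cadlag_inverse) auto
qed

lemma is_cadlag_path_of: "is_cadlag (path_of x)"
  using path_of[of x] by auto

lemma cadlag_eqI:
  assumes "\<And>t. 0 \<le> t \<Longrightarrow> t \<le> 1 \<Longrightarrow> path_of x t = path_of y t"
  shows "x = y"
proof -
  have "path_of x = path_of y"
    by (rule extensionalityI[of _ "{0..1}"]) (use path_of[of x] path_of[of y] assms in auto)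
  thus ?thesis by (simp add: path_of_inject)
qed

lemma path_bounded: "\<exists>B. \<forall>t\<in>{0..1}. \<bar>path_of x t\<bar> \<le> B"
proof -
  let ?P = "\<lambda>a b. \<exists>B. \<forall>t\<in>{a..b} \<inter> {0..1}. \<bar>path_of x t\<bar> \<le> B"
  have "?P 0 1"
  proof (rule Bolzano[of 0 1 ?P])
    fix a b c :: real assume "?P a b" "?P b c" "a \<le> b" "b \<le> c"
    then obtain B C where BC: "\<forall>t\<in>{a..b} \<inter> {0..1}. \<bar>path_of x t\<bar> \<le> B" "\<forall>t\<in>{b..c} \<inter> {0..1}. \<bar>path_of x t\<bar> \<le> C"
      by auto
    show "?P a c"
    proof (intro exI[of _ "max B C"] ballI)
      fix t assume "t \<in> {a..c} \<inter> {0..1}"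
      hence "t \<in> {a..b} \<inter> {0..1} \<or> t \<in> {b..c} \<inter> {0..1}" by auto
      thus "\<bar>path_of x t\<bar> \<le> max B C" using BC by (meson le_max_iff_disj)
    qed
  next
    fix p :: real assume p: "0 \<le> p" "p \<le> 1"
    have "\<exists>d>0. \<exists>B. \<forall>t\<in>{p<..<p+d} \<inter> {0..1}. \<bar>path_of x t\<bar> \<le> B"
    proof (cases "p = 1")
      case True
      thus ?thesis by (intro exI[of _ 1]) auto
    next
      case False
      hence "(path_of x \<longlongrightarrow> path_of x p) (at_right p)"
        using is_cadlag_path_of[of x] p by (auto simp: is_cadlag_def)
      hence "\<forall>\<^sub>F t in at_right p. dist (path_of x t) (path_of x p) < 1" by (rule tendstoD) auto
      then obtain b where b: "b > p" "\<And>t. p < t \<Longrightarrow> t < b \<Longrightarrow> dist (path_of x t) (path_of x p) < 1"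
        by (subst (asm) eventually_at_right[of p "p+1"]) auto
      have "\<bar>path_of x t\<bar> \<le> \<bar>path_of x p\<bar> + 1" if "p < t" "t < b" for t
        using b(2)[OF that] unfolding dist_real_def by linarith
      thus ?thesis
        using b(1) by (intro exI[of _ "b - p"] conjI exI[of _ "\<bar>path_of x p\<bar> + 1"]) auto
    qed
    then obtain d B where d: "d > 0" "\<forall>t\<in>{p<..<p+d} \<inter> {0..1}. \<bar>path_of x t\<bar> \<le> B" by blast
    have "\<exists>d>0. \<exists>B. \<forall>t\<in>{p-d<..<p} \<inter> {0..1}. \<bar>path_of x t\<bar> \<le> B"
    proof (cases "p = 0")
      case True
      thus ?thesis by (intro exI[of _ 1]) auto
    next
      case False
      then obtain l where "(path_of x \<longlongrightarrow> l) (at_left p)"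
        using is_cadlag_path_of[of x] p unfolding is_cadlag_def by (metis greaterThanAtMost_iff less_eq_real_def)
      hence "\<forall>\<^sub>F t in at_left p. dist (path_of x t) l < 1" by (rule tendstoD) auto
      then obtain b where b: "b < p" "\<And>t. b < t \<Longrightarrow> t < p \<Longrightarrow> dist (path_of x t) l < 1"
        by (subst (asm) eventually_at_left[of "p - 1" p]) auto
      have "\<bar>path_of x t\<bar> \<le> \<bar>l\<bar> + 1" if "b < t" "t < p" for t
        using b(2)[OF that] unfolding dist_real_def by linarith
      thus ?thesis
        using b(1) by (intro exI[of _ "p - b"] conjI exI[of _ "\<bar>l\<bar> + 1"]) auto
    qed
    then obtain e C where e: "e > 0" "\<forall>t\<in>{p-e<..<p} \<inter> {0..1}. \<bar>path_of x t\<bar> \<le> C" by blast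
    have "?P a b" if "a \<le> p \<and> p \<le> b \<and> b - a < min d e" for a b
    proof (intro exI[of _ "max (max B C) \<bar>path_of x p\<bar>"] ballI)
      fix t assume t: "t \<in> {a..b} \<inter> {0..1}"
      consider "t = p" | "t < p" | "t > p" by linarith
      thus "\<bar>path_of x t\<bar> \<le> max (max B C) \<bar>path_of x p\<bar>"
        by cases (use d(2)[rule_format, of t] e(2)[rule_format, of t] t that in auto)
    qed
    thus "\<exists>d>0. \<forall>a b. a \<le> p \<and> p \<le> b \<and> b - a < d \<longrightarrow> ?P a b"
      using d(1) e(1) by (intro exI[of _ "min d e"]) auto
  qed auto
  thus ?thesis by auto
qed

definition time_changes :: "(real \<Rightarrow> real) set" where
  "time_changes = {\<tau>. strict_mono_on {0..1} \<tau> \<and> continuous_on {0..1} \<tau> \<and> bij_betw \<tau> {0..1} {0..1}}"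

definition skorokhod_dist :: "cadlag \<Rightarrow> cadlag \<Rightarrow> real" where
  "skorokhod_dist x y =
     (INF \<tau>\<in>time_changes. max (SUP t\<in>{0..1}. \<bar>\<tau> t - t\<bar>) (SUP t\<in>{0..1}. \<bar>path_of x (\<tau> t) - path_of y t\<bar>))"

lemma id_time_change: "(\<lambda>t. t) \<in> time_changes"
  by (auto simp: time_changes_def strict_mono_on_def bij_betw_def inj_on_def)

lemma time_change_range:
  assumes "\<tau> \<in> time_changes" "0 \<le> t" "t \<le> 1"
  shows "0 \<le> \<tau> t" "\<tau> t \<le> 1"
  using assms by (auto simp: time_changes_def bij_betw_def)

lemma time_change_bdd:
  assumes "\<tau> \<in> time_changes"
  shows "bdd_above ((\<lambda>t. \<bar>\<tau> t - t\<bar>) ` {0..1})"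
  using time_change_range[OF assms] by (intro bdd_aboveI[of _ 1]) fastforce

lemma path_diff_bdd:
  assumes "\<tau> \<in> time_changes"
  shows "bdd_above ((\<lambda>t. \<bar>path_of x (\<tau> t) - path_of y t\<bar>) ` {0..1})"
proof -
  obtain B C where B: "\<forall>t\<in>{0..1}. \<bar>path_of x t\<bar> \<le> B" and C: "\<forall>t\<in>{0..1}. \<bar>path_of y t\<bar> \<le> C"
    using path_bounded by blast
  have "\<bar>path_of x (\<tau> t) - path_of y t\<bar> \<le> B + C" if "t \<in> {0..1}" for t
  proof -
    have "\<tau> t \<in> {0..1}" using time_change_range[OF assms] that by auto
    thus ?thesis using B C that by (smt (verit))
  qed
  thus ?thesis by (intro bdd_aboveI[of _ "B + C"]) auto
qed

lemma skorokhod_dist_less_iff: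
  "skorokhod_dist x y < e \<longleftrightarrow>
     (\<exists>\<tau>\<in>time_changes. \<exists>e'<e. \<forall>t\<in>{0..1}. \<bar>\<tau> t - t\<bar> \<le> e' \<and> \<bar>path_of x (\<tau> t) - path_of y t\<bar> \<le> e')"
proof -
  let ?m = "\<lambda>l. max (SUP t\<in>{0..1}. \<bar>l t - t\<bar>) (SUP t\<in>{0..1}. \<bar>path_of x (l t) - path_of y t\<bar>)"
  have nonneg: "0 \<le> ?m l" if "l \<in> time_changes" for l
  proof -
    have "\<bar>l 0 - 0\<bar> \<le> (SUP t\<in>{0..1}. \<bar>l t - t\<bar>)"
      by (rule cSUP_upper[OF _ time_change_bdd[OF that], of 0]) auto
    thus ?thesis by auto
  qed
  have "skorokhod_dist x y < e \<longleftrightarrow> (\<exists>l\<in>time_changes. ?m l < e)"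
    unfolding skorokhod_dist_def
    by (rule cINF_less_iff) (use id_time_change nonneg in \<open>auto intro!: bdd_belowI[of _ 0]\<close>)
  also have "\<dots> \<longleftrightarrow> (\<exists>\<tau>\<in>time_changes. \<exists>e'<e. \<forall>t\<in>{0..1}. \<bar>\<tau> t - t\<bar> \<le> e' \<and> \<bar>path_of x (\<tau> t) - path_of y t\<bar> \<le> e')"
  proof (intro bex_cong refl)
    fix l assume l: "l \<in> time_changes"
    have "?m l \<le> e' \<longleftrightarrow> (\<forall>t\<in>{0..1}. \<bar>l t - t\<bar> \<le> e' \<and> \<bar>path_of x (l t) - path_of y t\<bar> \<le> e')" for e'
      using cSUP_le_iff[OF _ time_change_bdd[OF l], of e'] cSUP_le_iff[OF _ path_diff_bdd[OF l], of x y e']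
      by auto
    hence "(\<exists>e'<e. \<forall>t\<in>{0..1}. \<bar>l t - t\<bar> \<le> e' \<and> \<bar>path_of x (l t) - path_of y t\<bar> \<le> e') \<longleftrightarrow> (\<exists>e'<e. ?m l \<le> e')"
      by presburger
    also have "\<dots> \<longleftrightarrow> ?m l < e"
      using le_less_trans[of "?m l" _ e] order.refl[of "?m l"] by blast
    finally show "(?m l < e) = (\<exists>e'<e. \<forall>t\<in>{0..1}. \<bar>l t - t\<bar> \<le> e' \<and> \<bar>path_of x (l t) - path_of y t\<bar> \<le> e')" ..
  qed
  finally show ?thesis .
qed

lemma skorokhod_dist_nonneg: "0 \<le> skorokhod_dist x y"
proof (rule ccontr)
  assume "\<not> 0 \<le> skorokhod_dist x y"
  hence "skorokhod_dist x y < 0" by auto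
  then obtain l e' where "e' < 0" "\<forall>t\<in>{0..1::real}. \<bar>l t - t\<bar> \<le> e'"
    unfolding skorokhod_dist_less_iff by blast
  from this(1) this(2)[rule_format, of 0] show False by auto
qed

lemma skorokhod_dist_refl: "skorokhod_dist x x = 0"
proof -
  have "skorokhod_dist x x \<le> 0"
  proof (rule field_le_epsilon)
    fix e :: real assume "e > 0"
    hence "skorokhod_dist x x < e"
      unfolding skorokhod_dist_less_iff by (intro bexI[OF _ id_time_change] exI[of _ 0]) auto
    thus "skorokhod_dist x x \<le> 0 + e" by auto
  qed
  thus ?thesis using skorokhod_dist_nonneg[of x x] by auto
qed

lemma skorokhod_dist_triangle: "skorokhod_dist x y \<le> skorokhod_dist x z + skorokhod_dist y z"
proof (rule field_le_epsilon)
  fix e :: real assume e: "e > 0"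
  have "skorokhod_dist x z < skorokhod_dist x z + e/2" using e by auto
  then obtain l1 a where l1: "l1 \<in> time_changes" "a < skorokhod_dist x z + e/2"
    and a: "\<And>t. t\<in>{0..1} \<Longrightarrow> \<bar>l1 t - t\<bar> \<le> a \<and> \<bar>path_of x (l1 t) - path_of z t\<bar> \<le> a"
    unfolding skorokhod_dist_less_iff by blast
  have "skorokhod_dist y z < skorokhod_dist y z + e/2" using e by auto
  then obtain l2 b where l2: "l2 \<in> time_changes" "b < skorokhod_dist y z + e/2"
    and b: "\<And>t. t\<in>{0..1} \<Longrightarrow> \<bar>l2 t - t\<bar> \<le> b \<and> \<bar>path_of y (l2 t) - path_of z t\<bar> \<le> b"
    unfolding skorokhod_dist_less_iff by blast
  define k where "k = inv_into {0..1} l2"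
  have bij2: "bij_betw l2 {0..1} {0..1}" and mono2: "strict_mono_on {0..1} l2" and cont2: "continuous_on {0..1} l2"
    using l2 by (auto simp: time_changes_def)
  have bij1: "bij_betw l1 {0..1} {0..1}" and mono1: "strict_mono_on {0..1} l1" and cont1: "continuous_on {0..1} l1"
    using l1 by (auto simp: time_changes_def)
  have bijk: "bij_betw k {0..1} {0..1}" unfolding k_def by (rule bij_betw_inv_into[OF bij2])
  have l2k: "l2 (k s) = s" if "s \<in> {0..1}" for s
    unfolding k_def using bij_betw_inv_into_right[OF bij2 that] .
  have kr: "k s \<in> {0..1}" if "s \<in> {0..1}" for s using bijk that by (auto simp: bij_betw_def)
  have k_eq: "the_inv_into {0..1} l2 s = k s" if "s \<in> {0..1}" for s
    using the_inv_into_f_eq[of l2 "{0..1}" "k s" s] bij2 l2k[OF that] kr[OF that] by (auto simp: bij_betw_def)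
  have contk: "continuous_on {0..1} k"
  proof -
    have "continuous_on {0..1} (the_inv_into {0..1} l2)"
      using continuous_on_inv_into[OF cont2] bij2 by (auto simp: bij_betw_def)
    thus ?thesis using k_eq continuous_on_cong[OF refl, of "{0..1}" "the_inv_into {0..1} l2" k] by blast
  qed
  have monok: "strict_mono_on {0..1} k"
  proof (rule strict_mono_onI)
    fix r s :: real assume rs: "r \<in> {0..1}" "s \<in> {0..1}" "r < s"
    show "k r < k s"
    proof (rule ccontr)
      assume "\<not> k r < k s"
      hence "l2 (k s) \<le> l2 (k r)"
        using strict_mono_onD[OF mono2, of "k s" "k r"] kr rs by (cases "k s = k r") auto
      thus False using l2k rs by auto
    qed
  qed
  have tc: "(\<lambda>s. l1 (k s)) \<in> time_changes"
    unfolding time_changes_def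
  proof (intro CollectI conjI)
    show "strict_mono_on {0..1} (\<lambda>s. l1 (k s))"
      using monok mono1 kr unfolding strict_mono_on_def by blast
    show "continuous_on {0..1} (\<lambda>s. l1 (k s))"
      by (rule continuous_on_compose2[OF cont1 contk]) (use kr in auto)
    show "bij_betw (\<lambda>s. l1 (k s)) {0..1} {0..1}"
      using bij_betw_trans[OF bijk bij1] by (simp add: o_def)
  qed
  have "skorokhod_dist x y < skorokhod_dist x z + skorokhod_dist y z + e"
    unfolding skorokhod_dist_less_iff
  proof (intro bexI[OF _ tc] exI[of _ "a + b"] conjI ballI)
    show "a + b < skorokhod_dist x z + skorokhod_dist y z + e" using l1 l2 by auto
    fix s :: real assume s: "s \<in> {0..1}"
    show "\<bar>l1 (k s) - s\<bar> \<le> a + b" "\<bar>path_of x (l1 (k s)) - path_of y s\<bar> \<le> a + b"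
      using a[OF kr[OF s]] b[OF kr[OF s]] l2k[OF s] by auto
  qed
  thus "skorokhod_dist x y \<le> skorokhod_dist x z + skorokhod_dist y z + e" by auto
qed

lemma skorokhod_dist_eq_0D:
  assumes "skorokhod_dist x y = 0"
  shows "x = y"
proof -
  have appr: "\<exists>s\<in>{0..1}. \<bar>s - t\<bar> < e \<and> \<bar>path_of x s - path_of y t\<bar> < e" if te: "t \<in> {0..1}" "e > 0" for t e
  proof -
    obtain l e' where "l \<in> time_changes" "e' < e" "\<forall>t\<in>{0..1}. \<bar>l t - t\<bar> \<le> e' \<and> \<bar>path_of x (l t) - path_of y t\<bar> \<le> e'"
      using assms te(2) skorokhod_dist_less_iff[of x y e] by auto
    thus ?thesis using te time_change_range[of l t] by (intro bexI[of _ "l t"]) force+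
  qed
  have one: "path_of x 1 = path_of y 1"
  proof -
    have "\<bar>path_of x 1 - path_of y 1\<bar> \<le> 0 + e" if "e > 0" for e
    proof -
      obtain l e' where l: "l \<in> time_changes" "e' < e" "\<forall>t\<in>{0..1}. \<bar>l t - t\<bar> \<le> e' \<and> \<bar>path_of x (l t) - path_of y t\<bar> \<le> e'"
        using assms \<open>e > 0\<close> skorokhod_dist_less_iff[of x y e] by auto
      have "1 \<in> l ` {0..1}" using l by (auto simp: time_changes_def bij_betw_def)
      then obtain u where u: "u \<in> {0..1}" "l u = 1" by auto
      have "u = 1"
      proof (rule ccontr)
        assume "u \<noteq> 1"
        hence "u < 1" using u by auto
        moreover have "strict_mono_on {0..1} l" using l by (auto simp: time_changes_def)
        ultimately have "l u < l 1" using u strict_mono_onD[of "{0..1}" l u 1] by auto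
        thus False using u time_change_range(2)[OF l(1), of 1] by auto
      qed
      have "\<bar>path_of x (l u) - path_of y u\<bar> \<le> e'" using l(3) u(1) by blast
      thus ?thesis using l(2) \<open>u = 1\<close> u(2) by auto
    qed
    from field_le_epsilon[OF this] show ?thesis by auto
  qed
  have "path_of x t = path_of y t" if t: "0 \<le> t" "t < 1" for t
  proof -
    have xt: "(path_of x \<longlongrightarrow> path_of x t) (at_right t)" and yt: "(path_of y \<longlongrightarrow> path_of y t) (at_right t)"
      using is_cadlag_path_of t by (auto simp: is_cadlag_def)
    have "(path_of y \<longlongrightarrow> path_of x t) (at_right t)"
    proof (rule tendstoI)
      fix e :: real assume e: "e > 0"
      have "\<forall>\<^sub>F s in at_right t. dist (path_of x s) (path_of x t) < e/2"
        using tendstoD[OF xt, of "e/2"] e by auto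
      then obtain b where b: "b > t" "\<And>s. t < s \<Longrightarrow> s < b \<Longrightarrow> dist (path_of x s) (path_of x t) < e/2"
        using t by (subst (asm) eventually_at_right[of t 1]) auto
      have "dist (path_of y s) (path_of x t) < e" if s: "t < s" "s < min b 1" for s
      proof -
        define d where "d = min (e/2) (min (s - t) (b - s))"
        have d: "d > 0" "d \<le> e/2" "d \<le> s - t" "d \<le> b - s" using e s unfolding d_def by linarith+
        obtain r where r: "\<bar>r - s\<bar> < d" "\<bar>path_of x r - path_of y s\<bar> < d"
          using appr[of s d] d t s by auto
        have "dist (path_of x r) (path_of x t) < e/2" using r d by (intro b) auto
        thus ?thesis using r d unfolding dist_real_def by linarith
      qed
      thus "\<forall>\<^sub>F s in at_right t. dist (path_of y s) (path_of x t) < e"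
        using t b by (subst eventually_at_right[of t 1]) (auto intro!: exI[of _ "min b 1"])
    qed
    from tendsto_unique[OF _ this yt] show ?thesis by auto
  qed
  with one show ?thesis by (intro cadlag_eqI) (metis less_eq_real_def)
qed

instantiation cadlag :: metric_space
begin

definition dist_cadlag :: "cadlag \<Rightarrow> cadlag \<Rightarrow> real" where
  "dist_cadlag = skorokhod_dist"

definition uniformity_cadlag :: "(cadlag \<times> cadlag) filter" where
  "uniformity_cadlag = (INF e\<in>{0<..}. principal {(x, y). dist x y < e})"

definition open_cadlag :: "cadlag set \<Rightarrow> bool" where
  "open_cadlag U \<longleftrightarrow> (\<forall>x\<in>U. \<forall>\<^sub>F (x', y) in uniformity. x' = x \<longrightarrow> y \<in> U)"

instance
proof
  fix x y z :: cadlag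
  show "dist x y = 0 \<longleftrightarrow> x = y"
    using skorokhod_dist_eq_0D skorokhod_dist_refl by (auto simp: dist_cadlag_def)
  show "dist x y \<le> dist x z + dist y z"
    using skorokhod_dist_triangle by (auto simp: dist_cadlag_def)
qed (auto simp: uniformity_cadlag_def open_cadlag_def)

end

text \<open>The infimum is taken in \<^typ>\<open>ereal\<close>, where the infimum of the empty set is \<open>\<infinity>\<close>.\<close>

definition bounded_away :: "'a::metric_space set \<Rightarrow> 'a set \<Rightarrow> bool" where
  "bounded_away A S \<longleftrightarrow> (INF (x, y)\<in>A \<times> S. ereal (dist x y)) > 0"


section \<open>Step functions and the sets indexed by numbers of jumps\<close>

definition left_limit :: "cadlag \<Rightarrow> real \<Rightarrow> real" where
  "left_limit x t = Lim (at_left t) (path_of x)"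

lemma tendsto_left_limit:
  assumes "0 < t" "t \<le> 1"
  shows "(path_of x \<longlongrightarrow> left_limit x t) (at_left t)"
proof -
  obtain l where "(path_of x \<longlongrightarrow> l) (at_left t)"
    using is_cadlag_path_of[of x] assms unfolding is_cadlag_def by (metis greaterThanAtMost_iff)
  thus ?thesis unfolding left_limit_def using tendsto_Lim[of "at_left t"] by auto
qed

text \<open>The time \<open>0\<close> is not a jump time (convention \<open>x(0-) = x(0)\<close>).\<close>

definition down_jumps :: "real \<Rightarrow> cadlag \<Rightarrow> real set" where
  "down_jumps g x = {t\<in>{0<..1}. left_limit x t - path_of x t > g}"

definition up_jumps :: "real \<Rightarrow> cadlag \<Rightarrow> real set" where
  "up_jumps g x = {t\<in>{0<..1}. path_of x t - left_limit x t > g}"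

text \<open>Piecewise constant with finitely many pieces: \<open>P\<close> is a finite set of breakpoints.\<close>

definition step_function :: "cadlag \<Rightarrow> bool" where
  "step_function x \<longleftrightarrow>
     (\<exists>P. finite P \<and> (\<forall>s t. 0 \<le> s \<longrightarrow> s < t \<longrightarrow> t \<le> 1 \<longrightarrow> {s<..t} \<inter> P = {} \<longrightarrow> path_of x s = path_of x t))"

lemma finite_step_jumps:
  assumes "step_function x"
  shows "finite {t\<in>{0<..1}. path_of x t \<noteq> left_limit x t}"
proof -
  obtain P where P: "finite P"
    "\<And>s t. 0 \<le> s \<Longrightarrow> s < t \<Longrightarrow> t \<le> 1 \<Longrightarrow> {s<..t} \<inter> P = {} \<Longrightarrow> path_of x s = path_of x t"
    using assms unfolding step_function_def by blast
  have "path_of x t = left_limit x t" if t: "0 < t" "t \<le> 1" "t \<notin> P" for t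
  proof -
    define a where "a = Max (insert 0 (P \<inter> {..<t}))"
    have a: "0 \<le> a" "a < t" "\<And>p. p \<in> P \<Longrightarrow> p < t \<Longrightarrow> p \<le> a"
      using P(1) t unfolding a_def by (auto intro: Max_ge)
    have "path_of x s = path_of x t" if "a < s" "s < t" for s
    proof (rule P(2))
      show "{s<..t} \<inter> P = {}"
      proof (rule ccontr)
        assume "{s<..t} \<inter> P \<noteq> {}"
        then obtain p where "p \<in> P" "s < p" "p \<le> t" by auto
        thus False using a(3)[of p] t that by (cases "p = t") auto
      qed
    qed (use a that t in auto)
    hence "\<forall>\<^sub>F s in at_left t. path_of x s = path_of x t"
      using a by (subst eventually_at_left[of a t]) auto
    from tendsto_unique[OF _ tendsto_eventually[OF this] tendsto_left_limit[of t x]] t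
    show ?thesis by auto
  qed
  hence "{t\<in>{0<..1}. path_of x t \<noteq> left_limit x t} \<subseteq> P" by auto
  thus ?thesis using P(1) finite_subset by blast
qed

text \<open>Throughout, pairs of jump numbers are ordered as (downward, upward).\<close>

definition D_jumps :: "nat \<Rightarrow> nat \<Rightarrow> cadlag set" where
  "D_jumps lm lp = {x. step_function x \<and> path_of x 0 = 0 \<and>
     card (down_jumps 0 x) = lm \<and> card (up_jumps 0 x) = lp}"

definition jump_cost :: "real \<Rightarrow> real \<Rightarrow> nat \<times> nat \<Rightarrow> real" where
  "jump_cost \<alpha> \<beta> = (\<lambda>(lm, lp). (\<alpha> - 1) * real lm + (\<beta> - 1) * real lp)"

definition I_less :: "real \<Rightarrow> real \<Rightarrow> nat \<times> nat \<Rightarrow> (nat \<times> nat) set" where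
  "I_less \<alpha> \<beta> ls = {l. l \<noteq> ls \<and> jump_cost \<alpha> \<beta> l \<le> jump_cost \<alpha> \<beta> ls}"

definition D_less :: "real \<Rightarrow> real \<Rightarrow> nat \<times> nat \<Rightarrow> cadlag set" where
  "D_less \<alpha> \<beta> ls = (\<Union>(lm, lp)\<in>I_less \<alpha> \<beta> ls. D_jumps lm lp)"

text \<open>Fewer than \<open>l\<close> jumps is at most \<open>l - 1\<close> jumps, and is impossible for \<open>l = 0\<close>.\<close>

definition D_mono_less :: "nat \<Rightarrow> cadlag set" where
  "D_mono_less l = {x. step_function x \<and> path_of x 0 = 0 \<and> mono_on {0..1} (path_of x) \<and>
     card {t\<in>{0<..1}. path_of x t \<noteq> left_limit x t} < l}"

definition C_pair :: "nat \<times> nat \<Rightarrow> (cadlag \<times> cadlag) set" where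
  "C_pair = (\<lambda>(l, m). (D_mono_less l \<times> UNIV) \<union> (UNIV \<times> D_mono_less m))"

definition J_set :: "real \<Rightarrow> real \<Rightarrow> nat \<times> nat \<Rightarrow> (nat \<times> nat) set" where
  "J_set \<alpha> \<beta> ls =
     {l. l \<notin> I_less \<alpha> \<beta> ls \<and> (\<forall>m. C_pair m \<subset> C_pair l \<longrightarrow> m \<in> I_less \<alpha> \<beta> ls)}"

text \<open>The cardinalities below are those of finite sets if both thresholds are positive,
  see \<open>finite_big_jumps\<close>.\<close>

definition B_jumps :: "real \<Rightarrow> real \<Rightarrow> nat \<Rightarrow> nat \<Rightarrow> cadlag set" where
  "B_jumps gm gp lm lp = {x. card (down_jumps gm x) \<ge> lm \<and> card (up_jumps gp x) \<ge> lp}"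

definition B_set :: "real \<Rightarrow> real \<Rightarrow> nat \<times> nat \<Rightarrow> real \<Rightarrow> real \<Rightarrow> cadlag set" where
  "B_set \<alpha> \<beta> ls gm gp = (\<Union>(lm, lp)\<in>J_set \<alpha> \<beta> ls. B_jumps gm gp lm lp)"

lemma finite_big_jumps:
  assumes g: "g > 0"
  shows "finite {t\<in>{0<..1}. \<bar>path_of x t - left_limit x t\<bar> > g}" (is "finite ?J")
proof -
  let ?P = "\<lambda>a b. finite (?J \<inter> {a..b})"
  have small: "\<bar>path_of x t - left_limit x t\<bar> \<le> g"
    if t: "t \<in> {0<..1}" and ab: "a < t" "t < b" and c: "\<And>s. a < s \<Longrightarrow> s < b \<Longrightarrow> dist (path_of x s) c < g/2" for a b c t
  proof -
    have "\<forall>\<^sub>F s in at_left t. dist (path_of x s) c < g/2"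
      using ab c by (subst eventually_at_left[of a t]) (auto intro!: exI[of _ a])
    hence "\<forall>\<^sub>F s in at_left t. dist (path_of x s) c \<le> g/2" by (rule eventually_mono) auto
    hence "dist (left_limit x t) c \<le> g/2"
      using tendsto_dist[OF tendsto_left_limit[of t x] tendsto_const[of c]] t
      by (intro tendsto_upperbound) auto
    thus ?thesis using c[of t] ab unfolding dist_real_def by linarith
  qed
  have "?P 0 1"
  proof (rule Bolzano[of 0 1 ?P])
    fix a b c :: real assume "?P a b" "?P b c" "a \<le> b" "b \<le> c"
    moreover have "?J \<inter> {a..c} \<subseteq> (?J \<inter> {a..b}) \<union> (?J \<inter> {b..c})" by auto
    ultimately show "?P a c" by (metis (lifting) finite_UnI finite_subset)
  next
    fix p :: real assume p: "0 \<le> p" "p \<le> 1"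
    have "\<exists>d>0. \<forall>t\<in>?J. \<not> (p < t \<and> t < p + d)"
    proof (cases "p = 1")
      case True
      thus ?thesis by (intro exI[of _ 1]) auto
    next
      case False
      hence "(path_of x \<longlongrightarrow> path_of x p) (at_right p)"
        using is_cadlag_path_of[of x] p by (auto simp: is_cadlag_def)
      hence "\<forall>\<^sub>F t in at_right p. dist (path_of x t) (path_of x p) < g/2" by (rule tendstoD) (use g in auto)
      then obtain b where b: "b > p" "\<And>t. p < t \<Longrightarrow> t < b \<Longrightarrow> dist (path_of x t) (path_of x p) < g/2"
        by (subst (asm) eventually_at_right[of p "p+1"]) auto
      show ?thesis
      proof (intro exI[of _ "b - p"] conjI ballI notI)
        fix t assume t: "t \<in> ?J" "p < t \<and> t < p + (b - p)"
        hence "\<bar>path_of x t - left_limit x t\<bar> \<le> g" by (intro small[of _ p b "path_of x p"] b(2)) auto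
        thus False using t by auto
      qed (use b(1) in auto)
    qed
    then obtain d where d: "d > 0" "\<forall>t\<in>?J. \<not> (p < t \<and> t < p + d)" by blast
    have "\<exists>d>0. \<forall>t\<in>?J. \<not> (p - d < t \<and> t < p)"
    proof (cases "p = 0")
      case True
      thus ?thesis by (intro exI[of _ 1]) auto
    next
      case False
      hence "(path_of x \<longlongrightarrow> left_limit x p) (at_left p)"
        using tendsto_left_limit p by auto
      hence "\<forall>\<^sub>F t in at_left p. dist (path_of x t) (left_limit x p) < g/2" by (rule tendstoD) (use g in auto)
      then obtain b where b: "b < p" "\<And>t. b < t \<Longrightarrow> t < p \<Longrightarrow> dist (path_of x t) (left_limit x p) < g/2"
        by (subst (asm) eventually_at_left[of "p - 1" p]) auto
      show ?thesis
      proof (intro exI[of _ "p - b"] conjI ballI notI)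
        fix t assume t: "t \<in> ?J" "p - (p - b) < t \<and> t < p"
        hence "\<bar>path_of x t - left_limit x t\<bar> \<le> g" by (intro small[of _ b p "left_limit x p"] b(2)) auto
        thus False using t by auto
      qed (use b(1) in auto)
    qed
    then obtain e where e: "e > 0" "\<forall>t\<in>?J. \<not> (p - e < t \<and> t < p)" by blast
    have "?P a b" if ab: "a \<le> p \<and> p \<le> b \<and> b - a < min d e" for a b
    proof (rule finite_subset)
      show "?J \<inter> {a..b} \<subseteq> {p}"
      proof
        fix t assume t: "t \<in> ?J \<inter> {a..b}"
        have "\<not> (p < t \<and> t < p + d)" "\<not> (p - e < t \<and> t < p)" using d e t by blast+
        moreover have "t \<in> {a..b}" using t by blast
        ultimately show "t \<in> {p}" using ab by auto
      qed
    qed auto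
    thus "\<exists>d>0. \<forall>a b. a \<le> p \<and> p \<le> b \<and> b - a < d \<longrightarrow> ?P a b"
      using d(1) e(1) by (intro exI[of _ "min d e"]) auto
  qed auto
  moreover have "?J \<inter> {0..1} = ?J" by auto
  ultimately show ?thesis by simp
qed


section \<open>The limit measures\<close>

text \<open>The measure on \<open>(0,\<infinity>)\<close> (as a measure on the reals) with tail \<open>x\<^sup>-\<^sup>a\<close>,
  see \<open>emeasure_nu_tail\<close>.\<close>

definition nu :: "real \<Rightarrow> real measure" where
  "nu a = density lborel (\<lambda>x. ennreal (a * x powr (- a - 1)) * indicator {0<..} x)"

lemma emeasure_nu_tail:
  assumes a: "a > 0" and x: "x > 0"
  shows "emeasure (nu a) {x<..} = ennreal (x powr (- a))"
proof -
  have "emeasure (nu a) {x<..} =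
      (\<integral>\<^sup>+ t. ennreal (a * t powr (- a - 1)) * indicator {0<..} t * indicator {x<..} t \<partial>lborel)"
    unfolding nu_def by (subst emeasure_density) auto
  also have "\<dots> = (\<integral>\<^sup>+ t. ennreal (a * t powr (- a - 1)) * indicator {x..} t \<partial>lborel)"
    by (rule nn_integral_cong_AE, use AE_lborel_singleton[of x] in eventually_elim)
       (use x in \<open>auto split: split_indicator\<close>)
  also have "\<dots> = ennreal (0 - (- (x powr (- a))))"
  proof (rule nn_integral_FTC_atLeast)
    show "((\<lambda>t. - (t powr (- a))) \<longlongrightarrow> 0) at_top"
      using tendsto_minus[OF tendsto_neg_powr[of "- a", OF _ filterlim_ident]] a by simp
    fix t assume "x \<le> t"
    thus "((\<lambda>t. - (t powr (- a))) has_real_derivative a * t powr (- a - 1)) (at t)"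
      using x by (auto intro!: derivative_eq_intros)
  qed (use a in auto)
  finally show ?thesis by simp
qed

lemma emeasure_nu_nonpos: "emeasure (nu a) {..0} = 0"
  unfolding nu_def by (subst emeasure_density) (auto simp: indicator_inter_arith[symmetric] nn_integral_0_iff_AE split: split_indicator)

text \<open>Vectors of length \<open>m\<close> are functions on the index set \<open>{..<m}\<close>.\<close>

definition nu_vec :: "real \<Rightarrow> nat \<Rightarrow> (nat \<Rightarrow> real) measure" where
  "nu_vec a m = density (\<Pi>\<^sub>M i\<in>{..<m}. nu a)
     (indicator {x. \<forall>i j. i \<le> j \<longrightarrow> j < m \<longrightarrow> x j \<le> x i})"

definition uniform_vec :: "nat \<Rightarrow> (nat \<Rightarrow> real) measure" where
  "uniform_vec m = (\<Pi>\<^sub>M i\<in>{..<m}. uniform_measure lborel {0..1})"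

definition jump_path ::
  "nat \<Rightarrow> nat \<Rightarrow> (nat \<Rightarrow> real) \<Rightarrow> (nat \<Rightarrow> real) \<Rightarrow> (nat \<Rightarrow> real) \<Rightarrow> (nat \<Rightarrow> real) \<Rightarrow> cadlag" where
  "jump_path lm lp x y u v = to_cadlag (\<lambda>t.
     (\<Sum>i<lp. y i * indicator {v i..1} t) - (\<Sum>i<lm. x i * indicator {u i..1} t))"

definition C_measure :: "real \<Rightarrow> real \<Rightarrow> nat \<times> nat \<Rightarrow> cadlag set \<Rightarrow> ennreal" where
  "C_measure \<alpha> \<beta> = (\<lambda>(lm, lp) A.
     if (lm, lp) = (0, 0) then indicator A (to_cadlag (\<lambda>_. 0))
     else \<integral>\<^sup>+ (u, v).
       emeasure (nu_vec \<alpha> lm \<Otimes>\<^sub>M nu_vec \<beta> lp)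
         {(x, y) \<in> space (nu_vec \<alpha> lm \<Otimes>\<^sub>M nu_vec \<beta> lp). jump_path lm lp x y u v \<in> A}
       \<partial>(uniform_vec lm \<Otimes>\<^sub>M uniform_vec lp))"

lemma is_cadlag_add:
  assumes f: "is_cadlag f" and g: "is_cadlag g"
  shows "is_cadlag (\<lambda>t. f t + g t)"
proof (rule is_cadlagI)
  fix t :: real assume "0 \<le> t" "t < 1"
  thus "((\<lambda>t. f t + g t) \<longlongrightarrow> f t + g t) (at_right t)"
    using f g by (intro tendsto_add) (auto simp: is_cadlag_def)
next
  fix t :: real assume "0 < t" "t \<le> 1"
  hence "t \<in> {0<..1}" by auto
  then obtain k l where "(f \<longlongrightarrow> k) (at_left t)" "(g \<longlongrightarrow> l) (at_left t)"
    using f g unfolding is_cadlag_def by blast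
  from tendsto_add[OF this] show "\<exists>l. ((\<lambda>t. f t + g t) \<longlongrightarrow> l) (at_left t)" by blast
qed

lemma is_cadlag_cmult:
  assumes f: "is_cadlag f"
  shows "is_cadlag (\<lambda>t. c * f t)"
proof (rule is_cadlagI)
  fix t :: real assume "0 \<le> t" "t < 1"
  thus "((\<lambda>t. c * f t) \<longlongrightarrow> c * f t) (at_right t)"
    using f by (intro tendsto_mult_left) (auto simp: is_cadlag_def)
next
  fix t :: real assume "0 < t" "t \<le> 1"
  hence "t \<in> {0<..1}" by auto
  then obtain l where "(f \<longlongrightarrow> l) (at_left t)"
    using f unfolding is_cadlag_def by blast
  from tendsto_mult_left[OF this] show "\<exists>l. ((\<lambda>t. c * f t) \<longlongrightarrow> l) (at_left t)" by blast
qed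

lemma is_cadlag_const: "is_cadlag (\<lambda>_. c)"
  by (auto simp: is_cadlag_def)

lemma is_cadlag_sum: "(\<And>i. i \<in> I \<Longrightarrow> is_cadlag (f i)) \<Longrightarrow> is_cadlag (\<lambda>t. \<Sum>i\<in>I. f i t)"
  by (induction I rule: infinite_finite_induct) (auto intro: is_cadlag_add is_cadlag_const)

lemma is_cadlag_indicator: "is_cadlag (indicator {u..1})"
proof (rule is_cadlagI)
  fix t :: real assume t: "0 \<le> t" "t < 1"
  have "\<forall>\<^sub>F s in at_right t. indicator {u..1} s = (indicator {u..1} t :: real)"
    using t by (subst eventually_at_right[of t 1])
      (auto intro!: exI[of _ "if t < u then min u 1 else 1"] split: split_indicator)
  thus "(indicator {u..1} \<longlongrightarrow> (indicator {u..1} t :: real)) (at_right t)"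
    by (rule tendsto_eventually)
next
  fix t :: real assume t: "0 < t" "t \<le> 1"
  have "\<forall>\<^sub>F s in at_left t. indicator {u..1} s = (if u < t then 1 else 0 :: real)"
    using t by (subst eventually_at_left[of 0 t])
      (auto intro!: exI[of _ "if u < t then max u 0 else 0"] split: split_indicator)
  thus "\<exists>l::real. (indicator {u..1} \<longlongrightarrow> l) (at_left t)"
    using tendsto_eventually by blast
qed

lemma path_jump_path:
  assumes "0 \<le> t" "t \<le> 1"
  shows "path_of (jump_path lm lp x y u v) t =
     (\<Sum>i<lp. y i * indicator {v i..1} t) - (\<Sum>i<lm. x i * indicator {u i..1} t)"
proof -
  have "is_cadlag (\<lambda>t. (\<Sum>i<lp. y i * indicator {v i..1} t) + (-1) * (\<Sum>i<lm. x i * indicator {u i..1} t))"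
    by (intro is_cadlag_add is_cadlag_sum is_cadlag_cmult is_cadlag_indicator)
  thus ?thesis unfolding jump_path_def using assms by (subst path_to_cadlag) auto
qed


section \<open>Random walks and the importance sampling estimator\<close>

definition regularly_varying :: "(real \<Rightarrow> real) \<Rightarrow> real \<Rightarrow> bool" where
  "regularly_varying f \<rho> \<longleftrightarrow>
     f \<in> borel_measurable borel \<and> (\<forall>\<^sub>F x in at_top. f x > 0) \<and>
     (\<forall>c>0. ((\<lambda>x. f (c * x) / f x) \<longlongrightarrow> c powr \<rho>) at_top)"

definition random_walk :: "(nat \<Rightarrow> 'a \<Rightarrow> real) \<Rightarrow> nat \<Rightarrow> 'a \<Rightarrow> real" where
  "random_walk Y k \<omega> = (\<Sum>i=1..k. Y i \<omega>)"

definition scaled_walk :: "(nat \<Rightarrow> 'a \<Rightarrow> real) \<Rightarrow> nat \<Rightarrow> 'a \<Rightarrow> cadlag" where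
  "scaled_walk Y n \<omega> = to_cadlag (\<lambda>t. random_walk Y (nat \<lfloor>real n * t\<rfloor>) \<omega> / real n)"

lemma is_cadlag_floor:
  fixes f :: "int \<Rightarrow> real"
  shows "is_cadlag (\<lambda>t. f \<lfloor>real n * t\<rfloor>)"
proof (cases "n = 0")
  case True
  thus ?thesis by (simp add: is_cadlag_const)
next
  case False
  hence n: "real n > 0" by auto
  show ?thesis
  proof (rule is_cadlagI)
    fix t :: real
    define k where "k = \<lfloor>real n * t\<rfloor>"
    have tk: "t < (real_of_int k + 1) / real n"
      using n unfolding k_def by (simp add: field_simps) linarith
    have "\<lfloor>real n * s\<rfloor> = k" if "t < s" "s < (real_of_int k + 1) / real n" for s
    proof -
      have "real n * t \<le> real n * s" using that n by auto
      moreover have "real n * s < real_of_int k + 1" using that n by (simp add: field_simps)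
      ultimately show ?thesis unfolding k_def by linarith
    qed
    hence "\<forall>\<^sub>F s in at_right t. f \<lfloor>real n * s\<rfloor> = f k"
      using tk by (subst eventually_at_right[of t "t + 1"]) auto
    thus "((\<lambda>s. f \<lfloor>real n * s\<rfloor>) \<longlongrightarrow> f \<lfloor>real n * t\<rfloor>) (at_right t)"
      unfolding k_def by (rule tendsto_eventually)
  next
    fix t :: real
    define k where "k = \<lceil>real n * t\<rceil> - 1"
    have tk: "real_of_int k / real n < t"
      using n unfolding k_def by (simp add: field_simps) linarith
    have "\<lfloor>real n * s\<rfloor> = k" if "s < t" "real_of_int k / real n < s" for s
    proof -
      have "real n * s < real n * t" using that n by auto
      moreover have "real_of_int k < real n * s" using that n by (simp add: field_simps)
      ultimately show ?thesis unfolding k_def by linarith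
    qed
    hence "\<forall>\<^sub>F s in at_left t. f \<lfloor>real n * s\<rfloor> = f k"
      using tk by (subst eventually_at_left[of "t - 1" t]) auto
    from tendsto_eventually[OF this]
    show "\<exists>l. ((\<lambda>s. f \<lfloor>real n * s\<rfloor>) \<longlongrightarrow> l) (at_left t)" by (rule exI)
  qed
qed

lemma path_scaled_walk:
  assumes "0 \<le> t" "t \<le> 1"
  shows "path_of (scaled_walk Y n \<omega>) t = random_walk Y (nat \<lfloor>real n * t\<rfloor>) \<omega> / real n"
  unfolding scaled_walk_def
  by (rule path_to_cadlag[OF is_cadlag_floor[of "\<lambda>k. random_walk Y (nat k) \<omega> / real n"] assms])

definition walk_event :: "'a measure \<Rightarrow> (nat \<Rightarrow> 'a \<Rightarrow> real) \<Rightarrow> nat \<Rightarrow> cadlag set \<Rightarrow> 'a set" where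
  "walk_event M Y n E = {\<omega>\<in>space M. scaled_walk Y n \<omega> \<in> E}"

definition mixture :: "real \<Rightarrow> 'a measure \<Rightarrow> 'a measure \<Rightarrow> 'a measure" where
  "mixture w M N = measure_of (space M) (sets M)
     (\<lambda>E. ennreal w * emeasure M E + ennreal (1 - w) * emeasure N E)"

lemma emeasure_mixture:
  assumes "sets N = sets M" "E \<in> sets M"
  shows "emeasure (mixture w M N) E = ennreal w * emeasure M E + ennreal (1 - w) * emeasure N E"
  unfolding mixture_def
proof (rule emeasure_measure_of_sigma)
  show "sigma_algebra (space M) (sets M)" by (rule sets.sigma_algebra_axioms)
  show "positive (sets M) (\<lambda>E. ennreal w * emeasure M E + ennreal (1 - w) * emeasure N E)"
    by (simp add: positive_def)
  show "countably_additive (sets M) (\<lambda>E. ennreal w * emeasure M E + ennreal (1 - w) * emeasure N E)"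
    unfolding countably_additive_def
    using assms(1) by (auto simp: suminf_add[symmetric] ennreal_suminf_cmult suminf_emeasure)
qed fact

lemma sets_mixture [simp]: "sets (mixture w M N) = sets M"
  and space_mixture [simp]: "space (mixture w M N) = space M"
  by (simp_all add: mixture_def)

text \<open>\<^term>\<open>uniform_measure M B\<close> is the conditional probability given \<open>B\<close>
  (and the null measure if \<open>B\<close> has probability \<open>0\<close>).\<close>

definition Q_measure :: "'a measure \<Rightarrow> 'a set \<Rightarrow> real \<Rightarrow> 'a measure" where
  "Q_measure M B w = mixture w M (uniform_measure M B)"

definition IS_estimator :: "'a measure \<Rightarrow> 'a set \<Rightarrow> 'a set \<Rightarrow> real \<Rightarrow> 'a \<Rightarrow> real" where
  "IS_estimator M A B w \<omega> = indicator A \<omega> / (w + (1 - w) / measure M B * indicator B \<omega>)"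

end

theory Submission
  imports Defs
begin

text \<open>
  The likelihood ratio gives \<open>E Z\<^sup>2 \<le> P(B) P(A \<inter> B) / (1 - w) + P(A - B) / w\<close>. Let
  \<open>r\<close> be the rate \<open>(n P(Y \<le> -n))\<^sup>l (n P(Y \<ge> n))\<^sup>m\<close> for the optimal pair \<open>(l, m)\<close>. It
  suffices that \<open>P(A) \<ge> c r\<close>, \<open>P(B) = O(r)\<close> and \<open>P(A - B) = O(r\<^sup>2)\<close>.
  The index set \<open>J\<close> is the finite set of minimal elements of the complement of \<open>I\<close>, and its
  elements other than \<open>(l, m)\<close> have larger cost, so the second bound is a union bound.
  On \<open>A - B\<close> the walk has a number of big jumps that belongs to \<open>I\<close>, so the step function made of
  these jumps is at a fixed distance from \<open>A\<close>; hence the walk with truncated increments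
  reaches a multiple of \<open>n\<close>, which by an exponential Chebyshev bound has probability
  \<open>n\<^sup>-\<^sup>K\<close> with \<open>K\<close> as large as we please for small thresholds.
  For the first bound, the interior of \<open>A\<close> contains a ball around a path with \<open>l\<close> downward and
  \<open>m\<close> upward jumps at distinct times in \<open>(0,1)\<close>, and the walk enters this ball if it has
  increments of about the right size at about the right times and is otherwise quiet.
\<close>


section \<open>Paths with finitely many jumps\<close>

text \<open>The rate \<open>r\<close> is in general not a power of \<open>n\<close>, because the
  tails carry slowly varying factors. Rates of different pairs are therefore compared through power
  bounds on the tails that lose a small exponent per jump. The loss is harmless because
  \<open>I_less\<close> contains all competitors of at most the optimal cost, ties included: a pair
  of \<open>J_set\<close> other than the optimal one costs strictly more, and the gap in cost
  absorbs the loss. The same power bounds replace the target \<open>O(r^2)\<close> for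
  \<open>P(A - B)\<close> by a fixed negative power of \<open>n\<close>. This dictates the order of
  choices. The distance from \<open>A\<close> to \<open>D_less\<close> and that power determine the
  threshold; the bound on \<open>P(B)\<close> then holds for whatever threshold came out, since
  rescaling the argument of a regularly varying tail costs only a constant. One common threshold
  serves both directions. Since the second moment only has to be controlled up to a constant, no
  limit theorem for \<open>P(A)\<close> enters: one small ball around one path already carries
  probability of order \<open>r\<close>.\<close>

definition step_path :: "'i set \<Rightarrow> ('i \<Rightarrow> real) \<Rightarrow> ('i \<Rightarrow> real) \<Rightarrow> cadlag" where
  "step_path I t z = to_cadlag (\<lambda>s. \<Sum>i\<in>I. z i * indicator {t i..1} s)"

lemma path_step_path:
  assumes "0 \<le> s" "s \<le> 1"
  shows "path_of (step_path I t z) s = (\<Sum>i\<in>I. if t i \<le> s then z i else 0)"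
proof -
  have "path_of (step_path I t z) s = (\<Sum>i\<in>I. z i * indicator {t i..1} s)"
    unfolding step_path_def
    by (rule path_to_cadlag[OF is_cadlag_sum assms]) (intro is_cadlag_cmult is_cadlag_indicator)
  also have "\<dots> = (\<Sum>i\<in>I. if t i \<le> s then z i else 0)"
    by (rule sum.cong[OF refl]) (use assms in auto)
  finally show ?thesis .
qed

lemma left_limit_step_path:
  assumes s: "0 < s" "s \<le> 1"
  shows "left_limit (step_path I t z) s = (\<Sum>i\<in>I. if t i < s then z i else 0)"
proof -
  have ind: "((\<lambda>r. if t i \<le> r then z i else 0) \<longlongrightarrow> (if t i < s then z i else 0)) (at_left s)" for i
  proof (rule tendsto_eventually)
    show "\<forall>\<^sub>F r in at_left s. (if t i \<le> r then z i else 0) = (if t i < s then z i else 0)"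
      by (subst eventually_at_left[of "s - 1" s]) (auto intro!: exI[of _ "if t i < s then t i else 0"] s)
  qed
  have "((\<lambda>r. \<Sum>i\<in>I. if t i \<le> r then z i else 0) \<longlongrightarrow> (\<Sum>i\<in>I. if t i < s then z i else 0)) (at_left s)"
    by (intro tendsto_sum ind)
  moreover have "\<forall>\<^sub>F r in at_left s. (\<Sum>i\<in>I. if t i \<le> r then z i else 0) = path_of (step_path I t z) r"
    using s by (subst eventually_at_left[of 0 s]) (auto intro!: exI[of _ 0] simp: path_step_path)
  ultimately have "(path_of (step_path I t z) \<longlongrightarrow> (\<Sum>i\<in>I. if t i < s then z i else 0)) (at_left s)"
    by (simp add: tendsto_cong)
  from tendsto_unique[OF _ tendsto_left_limit[OF s] this] show ?thesis by simp
qed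

text \<open>Times are allowed to coincide, and coinciding jumps add up. This generality is what lets
  one formula cover the walk, the skeleton of its big increments and the paths in
  \<open>C_measure\<close>.\<close>

lemma jump_step_path:
  assumes "finite I" "0 < s" "s \<le> 1"
  shows "path_of (step_path I t z) s - left_limit (step_path I t z) s = (\<Sum>i\<in>{i\<in>I. t i = s}. z i)"
proof -
  have "path_of (step_path I t z) s - left_limit (step_path I t z) s
      = (\<Sum>i\<in>I. (if t i \<le> s then z i else 0) - (if t i < s then z i else 0))"
    using assms by (simp add: path_step_path left_limit_step_path sum_subtractf)
  also have "\<dots> = (\<Sum>i\<in>I. if t i = s then z i else 0)"
    by (rule sum.cong) auto
  finally show ?thesis using assms(1) by (simp add: sum.inter_filter)
qed

lemma jump_step_path_inj:
  assumes "finite I" "0 < s" "s \<le> 1" "inj_on t I" "i \<in> I" "t i = s"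
  shows "path_of (step_path I t z) s - left_limit (step_path I t z) s = z i"
proof -
  have "{j\<in>I. t j = s} = {i}" using assms by (auto dest: inj_onD)
  thus ?thesis by (simp add: jump_step_path[OF assms(1-3)])
qed

lemma jumps_step_path_inj:
  assumes I: "finite I" "inj_on t I" and t: "\<And>i. i \<in> I \<Longrightarrow> 0 < t i \<and> t i \<le> 1" and g: "g \<ge> 0"
  shows "down_jumps g (step_path I t z) = t ` {i\<in>I. z i < - g}"
    and "up_jumps g (step_path I t z) = t ` {i\<in>I. z i > g}"
proof -
  have jump: "path_of (step_path I t z) (t i) - left_limit (step_path I t z) (t i) = z i" if "i \<in> I" for i
    using jump_step_path_inj[OF I(1) _ _ I(2) that] t[OF that] by auto
  have none: "path_of (step_path I t z) s = left_limit (step_path I t z) s"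
    if "0 < s" "s \<le> 1" "s \<notin> t ` I" for s
  proof -
    have "{i\<in>I. t i = s} = {}" using that by auto
    thus ?thesis using jump_step_path[OF I(1) that(1,2), of t z] by (simp only: sum.empty)
  qed
  show "down_jumps g (step_path I t z) = t ` {i\<in>I. z i < - g}"
  proof (intro set_eqI iffI)
    fix s assume s: "s \<in> down_jumps g (step_path I t z)"
    hence "s \<in> t ` I" using none[of s] g by (auto simp: down_jumps_def)
    then obtain i where i: "i \<in> I" "s = t i" by auto
    thus "s \<in> t ` {i\<in>I. z i < - g}" using s jump[of i] by (auto simp: down_jumps_def)
  next
    fix s assume "s \<in> t ` {i\<in>I. z i < - g}"
    then obtain i where "i \<in> I" "z i < - g" "s = t i" by auto
    thus "s \<in> down_jumps g (step_path I t z)" using jump[of i] t[of i] by (auto simp: down_jumps_def)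
  qed
  show "up_jumps g (step_path I t z) = t ` {i\<in>I. z i > g}"
  proof (intro set_eqI iffI)
    fix s assume s: "s \<in> up_jumps g (step_path I t z)"
    hence "s \<in> t ` I" using none[of s] g by (auto simp: up_jumps_def)
    then obtain i where i: "i \<in> I" "s = t i" by auto
    thus "s \<in> t ` {i\<in>I. z i > g}" using s jump[of i] by (auto simp: up_jumps_def)
  next
    fix s assume "s \<in> t ` {i\<in>I. z i > g}"
    then obtain i where "i \<in> I" "z i > g" "s = t i" by auto
    thus "s \<in> up_jumps g (step_path I t z)" using jump[of i] t[of i] by (auto simp: up_jumps_def)
  qed
qed

lemma card_jumps_step_path_inj:
  assumes I: "finite I" "inj_on t I" and t: "\<And>i. i \<in> I \<Longrightarrow> 0 < t i \<and> t i \<le> 1" and g: "g \<ge> 0"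
  shows "card (down_jumps g (step_path I t z)) = card {i\<in>I. z i < - g}"
    and "card (up_jumps g (step_path I t z)) = card {i\<in>I. z i > g}"
proof -
  have "inj_on t {i\<in>I. z i < - g}" "inj_on t {i\<in>I. z i > g}"
    by (rule inj_on_subset[OF I(2)]; auto)+
  thus "card (down_jumps g (step_path I t z)) = card {i\<in>I. z i < - g}"
    "card (up_jumps g (step_path I t z)) = card {i\<in>I. z i > g}"
    by (simp_all add: jumps_step_path_inj[OF I t g] card_image)
qed

lemma step_function_step_path:
  assumes "finite I"
  shows "step_function (step_path I t z)"
  unfolding step_function_def
proof (intro exI[of _ "t ` I"] conjI allI impI)
  fix r s :: real assume rs: "0 \<le> r" "r < s" "s \<le> 1" and no: "{r<..s} \<inter> t ` I = {}"
  have "t i \<le> r \<longleftrightarrow> t i \<le> s" if "i \<in> I" for i using no that rs by force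
  thus "path_of (step_path I t z) r = path_of (step_path I t z) s"
    using rs by (simp add: path_step_path)
qed (use assms in auto)

lemma step_path_0:
  assumes "\<And>i. i \<in> I \<Longrightarrow> 0 < t i"
  shows "path_of (step_path I t z) 0 = 0"
proof -
  have "(\<Sum>i\<in>I. if t i \<le> 0 then z i else 0) = (0::real)"
    by (rule sum.neutral) (use assms in force)
  thus ?thesis by (simp add: path_step_path)
qed

lemma step_path_in_D_jumps:
  assumes I: "finite I" "inj_on t I" and t: "\<And>i. i \<in> I \<Longrightarrow> 0 < t i \<and> t i \<le> 1"
  shows "step_path I t z \<in> D_jumps (card {i\<in>I. z i < 0}) (card {i\<in>I. z i > 0})"
  using card_jumps_step_path_inj[OF assms, of 0 z] step_function_step_path[OF I(1), of t z] t
  by (auto simp: D_jumps_def intro!: step_path_0)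

text \<open>Jumps at a common time add and may cancel. A net downward jump at a time requires a
  negative summand there, and likewise upward, so merging can only lower the two counts. If neither
  count drops, then \<open>t\<close> is injective on the negative and on the positive indices, and
  the two sets of times are disjoint because no time carries jumps of both signs.\<close>

lemma step_path_merged_jumps:
  assumes I: "finite I" and t: "\<And>i. i \<in> I \<Longrightarrow> 0 < t i \<and> t i \<le> 1" and z: "\<And>i. i \<in> I \<Longrightarrow> z i \<noteq> 0"
  obtains lm lp where "step_path I t z \<in> D_jumps lm lp"
    "lm \<le> card {i\<in>I. z i < 0}" "lp \<le> card {i\<in>I. z i > 0}"
    "lm = card {i\<in>I. z i < 0} \<Longrightarrow> lp = card {i\<in>I. z i > 0} \<Longrightarrow> inj_on t I"
proof -
  let ?x = "step_path I t z" and ?N = "{i\<in>I. z i < 0}" and ?P = "{i\<in>I. z i > 0}"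
  have sub: "down_jumps 0 ?x \<subseteq> t ` ?N" "up_jumps 0 ?x \<subseteq> t ` ?P"
  proof -
    show "down_jumps 0 ?x \<subseteq> t ` ?N"
    proof
      fix s assume s: "s \<in> down_jumps 0 ?x"
      hence "(\<Sum>i\<in>{i\<in>I. t i = s}. z i) < 0"
        using jump_step_path[OF I, of s t z] by (auto simp: down_jumps_def)
      hence "\<not> (\<forall>i\<in>{i\<in>I. t i = s}. 0 \<le> z i)" by (meson sum_nonneg not_le)
      then obtain i where "i \<in> I" "t i = s" "z i < 0" by auto
      thus "s \<in> t ` ?N" by auto
    qed
    show "up_jumps 0 ?x \<subseteq> t ` ?P"
    proof
      fix s assume s: "s \<in> up_jumps 0 ?x"
      hence "(\<Sum>i\<in>{i\<in>I. t i = s}. z i) > 0"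
        using jump_step_path[OF I, of s t z] by (auto simp: up_jumps_def)
      hence "\<not> (\<forall>i\<in>{i\<in>I. t i = s}. z i \<le> 0)" by (meson sum_nonpos not_le)
      then obtain i where "i \<in> I" "t i = s" "z i > 0" by auto
      thus "s \<in> t ` ?P" by auto
    qed
  qed
  have fin: "finite ?N" "finite ?P" using I by auto
  have le1: "card (down_jumps 0 ?x) \<le> card (t ` ?N)" "card (t ` ?N) \<le> card ?N"
    "card (up_jumps 0 ?x) \<le> card (t ` ?P)" "card (t ` ?P) \<le> card ?P"
    using sub fin by (simp_all add: card_mono card_image_le)
  show ?thesis
  proof (rule that)
    show "?x \<in> D_jumps (card (down_jumps 0 ?x)) (card (up_jumps 0 ?x))"
      using t by (auto simp: D_jumps_def step_function_step_path[OF I] intro!: step_path_0)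
    assume eq: "card (down_jumps 0 ?x) = card ?N" "card (up_jumps 0 ?x) = card ?P"
    have inj: "inj_on t ?N" "inj_on t ?P"
      using le1 eq fin by (simp_all add: eq_card_imp_inj_on)
    have "down_jumps 0 ?x = t ` ?N" "up_jumps 0 ?x = t ` ?P"
      using sub le1 eq fin by (simp_all add: card_subset_eq)
    moreover have "down_jumps 0 ?x \<inter> up_jumps 0 ?x = {}" by (auto simp: down_jumps_def up_jumps_def)
    ultimately have "t ` ?N \<inter> t ` ?P = {}" by simp
    hence "inj_on t (?N \<union> ?P)" using inj by (auto simp: inj_on_Un)
    moreover have "?N \<union> ?P = I" using z by force
    ultimately show "inj_on t I" by simp
  next
    show "card (down_jumps 0 ?x) \<le> card ?N" using le1 by linarith
    show "card (up_jumps 0 ?x) \<le> card ?P" using le1 by linarith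
  qed
qed

section \<open>The rescaled walk and the limit paths as step paths\<close>

lemma scaled_walk_eq_step_path:
  assumes n: "n > 0"
  shows "scaled_walk Y n \<omega> = step_path {1..n} (\<lambda>k. real k / real n) (\<lambda>k. Y k \<omega> / real n)"
proof (rule cadlag_eqI)
  fix s :: real assume s: "0 \<le> s" "s \<le> 1"
  have eq: "k \<in> {1..nat \<lfloor>real n * s\<rfloor>} \<longleftrightarrow> k \<in> {1..n} \<and> real k / real n \<le> s" for k
  proof -
    have "k \<le> nat \<lfloor>real n * s\<rfloor> \<longleftrightarrow> real k \<le> real n * s" using s by (simp add: le_nat_iff le_floor_iff)
    also have "\<dots> \<longleftrightarrow> real k / real n \<le> s" using n by (simp add: field_simps)
    finally have *: "k \<le> nat \<lfloor>real n * s\<rfloor> \<longleftrightarrow> real k / real n \<le> s" .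
    have "k \<le> n" if "real k / real n \<le> s"
    proof -
      have "real k / real n \<le> 1" using that s by linarith
      thus ?thesis using n by (simp add: field_simps)
    qed
    thus ?thesis using * by auto
  qed
  have "(\<Sum>k=1..nat \<lfloor>real n * s\<rfloor>. Y k \<omega>) / real n = (\<Sum>k\<in>{k\<in>{1..n}. real k / real n \<le> s}. Y k \<omega> / real n)"
    unfolding sum_divide_distrib
    by (rule sum.cong[OF _ refl]) (rule set_eqI, simp only: eq mem_Collect_eq)
  also have "\<dots> = (\<Sum>k\<in>{1..n}. if real k / real n \<le> s then Y k \<omega> / real n else 0)"
    by (rule sum.inter_filter) simp
  finally show "path_of (scaled_walk Y n \<omega>) s = path_of (step_path {1..n} (\<lambda>k. real k / real n) (\<lambda>k. Y k \<omega> / real n)) s"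
    unfolding path_scaled_walk[OF s] random_walk_def path_step_path[OF s] .
qed

lemma walk_times:
  assumes "n > 0"
  shows "inj_on (\<lambda>k. real k / real n) {1..n}"
    "k \<in> {1..n} \<Longrightarrow> 0 < real k / real n \<and> real k / real n \<le> 1"
  using assms by (auto simp: inj_on_def field_simps)

lemma card_jumps_scaled_walk:
  assumes n: "n > 0" and g: "g \<ge> 0"
  shows "card (down_jumps g (scaled_walk Y n \<omega>)) = card {k\<in>{1..n}. Y k \<omega> < - (g * real n)}"
    "card (up_jumps g (scaled_walk Y n \<omega>)) = card {k\<in>{1..n}. Y k \<omega> > g * real n}"
proof -
  have "Y k \<omega> / real n < - g \<longleftrightarrow> Y k \<omega> < - (g * real n)"
    "g < Y k \<omega> / real n \<longleftrightarrow> Y k \<omega> > g * real n" for k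
    using n by (auto simp: field_simps)
  thus "card (down_jumps g (scaled_walk Y n \<omega>)) = card {k\<in>{1..n}. Y k \<omega> < - (g * real n)}"
    "card (up_jumps g (scaled_walk Y n \<omega>)) = card {k\<in>{1..n}. Y k \<omega> > g * real n}"
    using card_jumps_step_path_inj[OF finite_atLeastAtMost walk_times(1)[OF n] walk_times(2)[OF n] g,
      of "\<lambda>k. Y k \<omega> / real n"]
    unfolding scaled_walk_eq_step_path[OF n] by simp_all
qed

text \<open>The sum type gives the downward jumps (\<open>Inl\<close>) and the upward jumps
  (\<open>Inr\<close>) one common index set, so that later arguments treat both directions at once;
  \<open>jump_size\<close> records the direction in the sign.\<close>

definition jump_time :: "(nat \<Rightarrow> real) \<Rightarrow> (nat \<Rightarrow> real) \<Rightarrow> nat + nat \<Rightarrow> real" where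
  "jump_time u v = case_sum u v"

definition jump_size :: "(nat \<Rightarrow> real) \<Rightarrow> (nat \<Rightarrow> real) \<Rightarrow> nat + nat \<Rightarrow> real" where
  "jump_size x y = case_sum (\<lambda>i. - x i) y"

lemma jump_path_eq_step_path:
  "jump_path lm lp x y u v = step_path ({..<lm} <+> {..<lp}) (jump_time u v) (jump_size x y)"
proof (rule cadlag_eqI)
  fix s :: real assume s: "0 \<le> s" "s \<le> 1"
  have ind: "c * indicator {a..1} s = (if a \<le> s then c else 0)" for c a :: real
    using s by auto
  have "(\<Sum>i<lm. if u i \<le> s then - x i else 0) = (\<Sum>i<lm. - (if u i \<le> s then x i else 0))"
    by (rule sum.cong) auto
  hence neg: "(\<Sum>i<lm. if u i \<le> s then - x i else 0) = - (\<Sum>i<lm. if u i \<le> s then x i else 0)"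
    by (simp add: sum_negf)
  show "path_of (jump_path lm lp x y u v) s
      = path_of (step_path ({..<lm} <+> {..<lp}) (jump_time u v) (jump_size x y)) s"
    using neg unfolding path_jump_path[OF s] path_step_path[OF s] ind jump_time_def jump_size_def
    by (simp add: sum.Plus cong: if_cong)
qed

section \<open>Skorokhod distance and time changes\<close>

lemma dist_cadlag_le:
  assumes "\<And>t. 0 \<le> t \<Longrightarrow> t \<le> 1 \<Longrightarrow> \<bar>path_of x t - path_of y t\<bar> \<le> e"
  shows "dist x y \<le> e"
proof (rule field_le_epsilon)
  fix d :: real assume d: "d > 0"
  have "0 \<le> e" using assms[of 0] by auto
  thus "dist x y \<le> e + d"
    unfolding dist_cadlag_def using d assms
    by (intro less_imp_le) (auto simp: skorokhod_dist_less_iff intro!: bexI[OF _ id_time_change] exI[of _ e])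
qed

text \<open>The time change adds to the identity small multiples of hat functions with disjoint supports.\<close>

lemma exists_time_change:
  fixes T :: "'i \<Rightarrow> real"
  assumes I: "finite I" "inj_on T I" and T: "\<And>i. i \<in> I \<Longrightarrow> 0 < T i \<and> T i < 1" and e: "e > 0"
  obtains \<rho> where "\<rho> > 0"
    "\<And>i j. i \<in> I \<Longrightarrow> j \<in> I \<Longrightarrow> i \<noteq> j \<Longrightarrow> 2 * \<rho> < \<bar>T i - T j\<bar>"
    "\<And>i. i \<in> I \<Longrightarrow> \<rho> < T i \<and> T i < 1 - \<rho>"
    "\<And>s. (\<And>i. i \<in> I \<Longrightarrow> \<bar>s i - T i\<bar> \<le> \<rho>) \<Longrightarrow>
       \<exists>\<tau>\<in>time_changes. (\<forall>t. \<bar>\<tau> t - t\<bar> \<le> e) \<and> (\<forall>i\<in>I. \<tau> (T i) = s i)"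
proof -
  define D where "D = insert 1 ((\<lambda>(i, j). \<bar>T i - T j\<bar>) ` {(i, j). i \<in> I \<and> j \<in> I \<and> i \<noteq> j} \<union> T ` I \<union> (\<lambda>i. 1 - T i) ` I)"
  \<comment> \<open>The least gap among the points \<open>T i\<close> and the endpoints 0 and 1; the
    element 1 of \<open>D\<close> covers the case of an empty \<open>I\<close>.\<close>
  define r where "r = Min D"
  have finD: "finite D"
  proof -
    have "finite {(i, j). i \<in> I \<and> j \<in> I \<and> i \<noteq> j}"
      by (rule finite_subset[of _ "I \<times> I"]) (use I in auto)
    thus ?thesis unfolding D_def using I by auto
  qed
  have "\<forall>d\<in>D. d > 0" using T I(2) by (auto simp: D_def dest: inj_onD)
  hence r0: "r > 0" unfolding r_def using finD by (subst Min_gr_iff) (auto simp: D_def)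
  have rle: "r \<le> d" if "d \<in> D" for d unfolding r_def using that finD by auto
  have rT: "r \<le> T i" "r \<le> 1 - T i" if "i \<in> I" for i
    by (rule rle; use that in \<open>auto simp: D_def\<close>)+
  have rTT: "r \<le> \<bar>T i - T j\<bar>" if "i \<in> I" "j \<in> I" "i \<noteq> j" for i j
    by (rule rle) (use that in \<open>force simp: D_def\<close>)
  define L where "L = real (card I) + 1"
  have L: "L \<ge> 1" by (simp add: L_def)
  \<comment> \<open>Each hat has slope at most \<open>1 / r\<close> and coefficient at most \<rho>,
    and there are fewer than \<open>L\<close> of them. Thus \<open>L * \<rho> \<le> r / 4\<close>
    gives the perturbation a Lipschitz constant of at most 1/4, which keeps \<tau> strictly
    increasing, and \<open>L * \<rho> \<le> e / 4\<close> keeps \<tau> near the identity.\<close>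
  define \<rho> where "\<rho> = min r e / (4 * L)"
  have \<rho>0: "\<rho> > 0" using r0 e L by (simp add: \<rho>_def)
  have L\<rho>: "L * \<rho> \<le> r / 4" "L * \<rho> \<le> e / 4" using L by (auto simp: \<rho>_def field_simps)
  have "1 * \<rho> \<le> L * \<rho>" using L \<rho>0 by (intro mult_right_mono) auto
  hence \<rho>r: "\<rho> \<le> r / 4" using L\<rho> by linarith
  show ?thesis
  proof (rule that[of \<rho>])
    show "\<rho> > 0" by fact
    show "2 * \<rho> < \<bar>T i - T j\<bar>" if "i \<in> I" "j \<in> I" "i \<noteq> j" for i j
      using rTT[OF that] \<rho>r r0 by linarith
    show "\<rho> < T i \<and> T i < 1 - \<rho>" if "i \<in> I" for i
      using rT[OF that] \<rho>r r0 by linarith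
    fix s assume s: "\<And>i. i \<in> I \<Longrightarrow> \<bar>s i - T i\<bar> \<le> \<rho>"
    \<comment> \<open>The hat at \<open>T i\<close> has radius \<open>r\<close>, so it vanishes at
      all other \<open>T j\<close> and at 0 and 1, and \<tau> takes the prescribed values there
      exactly. Neighbouring hats may overlap in between; the estimates below sum over all of
      \<open>I\<close>.\<close>
    define h where "h = (\<lambda>i t. max 0 (1 - \<bar>t - T i\<bar> / r))"
    define \<tau> where "\<tau> = (\<lambda>t. t + (\<Sum>i\<in>I. (s i - T i) * h i t))"
    have h01: "0 \<le> h i t" "h i t \<le> 1" for i t using r0 by (auto simp: h_def)
    have h0: "h i t = 0" if "\<bar>t - T i\<bar> \<ge> r" for i t using that r0 by (auto simp: h_def max_def field_simps)
    have lip: "\<bar>h i t - h i t'\<bar> \<le> \<bar>t - t'\<bar> / r" for i t t'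
    proof -
      have "\<bar>h i t - h i t'\<bar> \<le> \<bar>\<bar>t - T i\<bar> / r - \<bar>t' - T i\<bar> / r\<bar>" unfolding h_def by linarith
      also have "\<dots> = \<bar>\<bar>t - T i\<bar> - \<bar>t' - T i\<bar>\<bar> / r" using r0 by (simp add: diff_divide_distrib[symmetric])
      also have "\<dots> \<le> \<bar>t - t'\<bar> / r" using r0 by (intro divide_right_mono) auto
      finally show ?thesis .
    qed
    have at: "\<tau> (T i) = s i" if i: "i \<in> I" for i
    proof -
      have "(\<Sum>j\<in>I. (s j - T j) * h j (T i)) = (\<Sum>j\<in>I. if j = i then s i - T i else 0)"
      proof (rule sum.cong[OF refl])
        fix j assume j: "j \<in> I"
        show "(s j - T j) * h j (T i) = (if j = i then s i - T i else 0)"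
          using h0[where i=j and t="T i"] rTT[OF i j] by (auto simp: h_def)
      qed
      thus ?thesis using I i by (simp add: \<tau>_def)
    qed
    have ends: "\<tau> 0 = 0" "\<tau> 1 = 1"
    proof -
      have "h i 0 = 0" "h i 1 = 0" if "i \<in> I" for i using rT[OF that] by (auto intro!: h0)
      thus "\<tau> 0 = 0" "\<tau> 1 = 1" by (auto simp: \<tau>_def)
    qed
    have cardL: "real (card I) * \<rho> \<le> L * \<rho>" using \<rho>0 by (intro mult_right_mono) (auto simp: L_def)
    have near: "\<bar>\<tau> t - t\<bar> \<le> e" for t
    proof -
      have "\<bar>\<Sum>i\<in>I. (s i - T i) * h i t\<bar> \<le> (\<Sum>i\<in>I. \<rho>)"
      proof (rule sum_norm_le[where 'a=real, unfolded real_norm_def])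
        fix i assume i: "i \<in> I"
        have "\<bar>s i - T i\<bar> * h i t \<le> \<rho> * 1" by (rule mult_mono) (use s[OF i] h01 \<rho>0 in auto)
        thus "\<bar>(s i - T i) * h i t\<bar> \<le> \<rho>" using h01[of i t] by (simp add: abs_mult)
      qed
      thus ?thesis using L\<rho> cardL e by (simp add: \<tau>_def)
    qed
    have mono: "\<tau> a < \<tau> b" if "a < b" for a b
    proof -
      have "\<bar>\<Sum>i\<in>I. (s i - T i) * (h i b - h i a)\<bar> \<le> (\<Sum>i\<in>I. \<rho> * ((b - a) / r))"
      proof (rule sum_norm_le[where 'a=real, unfolded real_norm_def])
        fix i assume i: "i \<in> I"
        have "\<bar>s i - T i\<bar> * \<bar>h i b - h i a\<bar> \<le> \<rho> * ((b - a) / r)"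
          by (rule mult_mono) (use s[OF i] lip[of i b a] \<rho>0 that in auto)
        thus "\<bar>(s i - T i) * (h i b - h i a)\<bar> \<le> \<rho> * ((b - a) / r)" by (simp add: abs_mult)
      qed
      also have "\<dots> = (real (card I) * \<rho>) * ((b - a) / r)" by simp
      also have "\<dots> \<le> (r / 4) * ((b - a) / r)"
        using cardL L\<rho> that r0 by (intro mult_right_mono) auto
      also have "\<dots> < b - a" using that r0 by simp
      finally have "\<bar>(\<Sum>i\<in>I. (s i - T i) * h i b) - (\<Sum>i\<in>I. (s i - T i) * h i a)\<bar> < b - a"
        by (simp add: sum_subtractf right_diff_distrib)
      thus ?thesis unfolding \<tau>_def by linarith
    qed
    have cont: "continuous_on S \<tau>" for S
      unfolding \<tau>_def h_def using r0 by (intro continuous_intros) auto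
    have "\<tau> ` {0..1} = {0..1}"
    proof
      show "\<tau> ` {0..1} \<subseteq> {0..1}"
      proof
        fix y assume "y \<in> \<tau> ` {0..1}"
        then obtain t where t: "0 \<le> t" "t \<le> 1" "y = \<tau> t" by auto
        thus "y \<in> {0..1}" using ends mono[of 0 t] mono[of t 1] by (cases "t = 0"; cases "t = 1") auto
      qed
      show "{0..1} \<subseteq> \<tau> ` {0..1}"
      proof
        fix y :: real assume "y \<in> {0..1}"
        then obtain t where "0 \<le> t" "t \<le> 1" "\<tau> t = y"
          using IVT'[of \<tau> 0 y 1] cont ends by auto
        thus "y \<in> \<tau> ` {0..1}" by auto
      qed
    qed
    moreover have "strict_mono_on {0..1} \<tau>" using mono by (auto simp: strict_mono_on_def)
    ultimately have "\<tau> \<in> time_changes"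
      using cont by (auto simp: time_changes_def bij_betw_def strict_mono_on_imp_inj_on)
    thus "\<exists>\<tau>\<in>time_changes. (\<forall>t. \<bar>\<tau> t - t\<bar> \<le> e) \<and> (\<forall>i\<in>I. \<tau> (T i) = s i)"
      using near at by auto
  qed
qed


section \<open>Measurability of the rescaled walk and the index sets\<close>

text \<open>The walk is a Lipschitz function of finitely many increments, already for the uniform
  distance. It is therefore continuous on the product space, and Borel measurability for the
  Skorokhod metric follows without describing that sigma-algebra by coordinate projections.\<close>

lemma measurable_scaled_walk:
  assumes Y: "\<And>k. 1 \<le> k \<Longrightarrow> Y k \<in> borel_measurable M"
  shows "scaled_walk Y n \<in> measurable M borel"
proof (cases "n = 0")
  case True
  hence "scaled_walk Y n = (\<lambda>\<omega>. to_cadlag (\<lambda>_. 0))"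
    by (auto simp: scaled_walk_def random_walk_def fun_eq_iff)
  thus ?thesis by simp
next
  case False
  hence n: "n > 0" by simp
  define F :: "(nat \<Rightarrow> real) \<Rightarrow> cadlag" where "F = (\<lambda>y. scaled_walk (\<lambda>k y. y k) n y)"
  have dist_F: "dist (F x) (F y) \<le> (\<Sum>k=1..n. \<bar>x k - y k\<bar>)" for x y
  proof (rule dist_cadlag_le)
    fix t :: real assume t: "0 \<le> t" "t \<le> 1"
    define m where "m = nat \<lfloor>real n * t\<rfloor>"
    have "real n * t \<le> real n" using t by (simp add: mult_left_le)
    hence m: "m \<le> n" unfolding m_def using floor_mono[of "real n * t" "real n"] by auto
    have "\<bar>path_of (F x) t - path_of (F y) t\<bar> = \<bar>(\<Sum>k=1..m. x k) / real n - (\<Sum>k=1..m. y k) / real n\<bar>"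
      unfolding F_def path_scaled_walk[OF t] random_walk_def m_def ..
    also have "\<dots> = \<bar>\<Sum>k=1..m. x k - y k\<bar> / real n"
      by (simp add: sum_subtractf diff_divide_distrib[symmetric])
    also have "\<dots> \<le> \<bar>\<Sum>k=1..m. x k - y k\<bar> / 1"
      using n by (intro divide_left_mono) auto
    also have "\<dots> \<le> (\<Sum>k=1..m. \<bar>x k - y k\<bar>)" using sum_abs by simp
    also have "\<dots> \<le> (\<Sum>k=1..n. \<bar>x k - y k\<bar>)" using m by (intro sum_mono2) auto
    finally show "\<bar>path_of (F x) t - path_of (F y) t\<bar> \<le> (\<Sum>k=1..n. \<bar>x k - y k\<bar>)" .
  qed
  have "continuous_on UNIV F"
    unfolding continuous_on_def
  proof
    fix x :: "nat \<Rightarrow> real"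
    have "((\<lambda>y. y k) \<longlongrightarrow> x k) (at x within UNIV)" for k
    proof -
      have "continuous_on UNIV (\<lambda>y :: nat \<Rightarrow> real. y k)" by (rule continuous_on_product_coordinates)
      thus ?thesis by (simp add: continuous_on_def)
    qed
    hence "((\<lambda>y. \<Sum>k=1..n. \<bar>y k - x k\<bar>) \<longlongrightarrow> (\<Sum>k=1..n. \<bar>x k - x k\<bar>)) (at x within UNIV)"
      by (intro tendsto_sum tendsto_rabs tendsto_diff tendsto_const)
    hence lim: "((\<lambda>y. \<Sum>k=1..n. \<bar>y k - x k\<bar>) \<longlongrightarrow> 0) (at x within UNIV)" by simp
    have "((\<lambda>y. dist (F y) (F x)) \<longlongrightarrow> 0) (at x within UNIV)"
    proof (rule tendsto_sandwich[OF _ _ tendsto_const lim])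
      show "\<forall>\<^sub>F y in at x within UNIV. 0 \<le> dist (F y) (F x)" by simp
      show "\<forall>\<^sub>F y in at x within UNIV. dist (F y) (F x) \<le> (\<Sum>k=1..n. \<bar>y k - x k\<bar>)"
        by (rule always_eventually) (rule allI, rule dist_F)
    qed
    thus "(F \<longlongrightarrow> F x) (at x within UNIV)" by (rule iffD2[OF tendsto_dist_iff])
  qed
  hence F: "F \<in> borel_measurable borel" by (rule borel_measurable_continuous_onI)
  \<comment> \<open>Measurability of \<open>Y 0\<close> is not among the assumptions; coordinate 0
    is replaced by a constant, which the walk never reads.\<close>
  have coord: "(\<lambda>\<omega> k. if 1 \<le> k then Y k \<omega> else 0) \<in> measurable M borel"
  proof (rule measurable_coordinatewise_then_product)
    fix k show "(\<lambda>\<omega>. if 1 \<le> k then Y k \<omega> else 0) \<in> borel_measurable M"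
      using Y[of k] by (cases "1 \<le> k") simp_all
  qed
  have eq: "F (\<lambda>k. if 1 \<le> k then Y k \<omega> else 0) = scaled_walk Y n \<omega>" for \<omega>
  proof (rule cadlag_eqI)
    fix t :: real assume t: "0 \<le> t" "t \<le> 1"
    show "path_of (F (\<lambda>k. if 1 \<le> k then Y k \<omega> else 0)) t = path_of (scaled_walk Y n \<omega>) t"
      unfolding F_def path_scaled_walk[OF t] random_walk_def by (intro arg_cong2[of _ _ _ _ "(/)"] sum.cong) auto
  qed
  show ?thesis using measurable_compose[OF coord F] unfolding eq .
qed

section \<open>The order on pairs and the index set J\<close>

lemma D_mono_less_mono: "l \<le> m \<Longrightarrow> D_mono_less l \<subseteq> D_mono_less m"
  by (auto simp: D_mono_less_def)

text \<open>The witness is a staircase with exactly \<open>l\<close> unit jumps at equally spaced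
  times in (0,1).\<close>

lemma exists_D_mono_less:
  assumes "l < m"
  shows "\<exists>x. x \<in> D_mono_less m \<and> x \<notin> D_mono_less l"
proof -
  define t where "t = (\<lambda>i. (real i + 1) / real (l + 1))"
  define x where "x = step_path {..<l} t (\<lambda>_. 1)"
  have t: "0 < t i \<and> t i \<le> 1" if "i < l" for i using that by (auto simp: t_def field_simps)
  have inj: "inj_on t {..<l}" by (auto simp: inj_on_def t_def)
  have jumps: "down_jumps 0 x = {}" "up_jumps 0 x = t ` {..<l}"
    using jumps_step_path_inj[of "{..<l}" t 0 "\<lambda>_. 1"] inj t by (auto simp: x_def)
  have "{s\<in>{0<..1}. path_of x s \<noteq> left_limit x s} = down_jumps 0 x \<union> up_jumps 0 x"
    by (auto simp: down_jumps_def up_jumps_def)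
  hence "card {s\<in>{0<..1}. path_of x s \<noteq> left_limit x s} = l"
    using jumps inj by (simp add: card_image)
  moreover have "step_function x" unfolding x_def by (rule step_function_step_path) simp
  moreover have "path_of x 0 = 0" unfolding x_def using t by (intro step_path_0) auto
  moreover have "mono_on {0..1} (path_of x)"
    unfolding x_def by (intro mono_onI) (auto simp: path_step_path intro!: sum_mono)
  ultimately show ?thesis using assms by (auto simp: D_mono_less_def)
qed

text \<open>Reduces the order in the definition of \<open>J_set\<close> to the componentwise order.
  To separate the two coordinates, one of them is filled with the constant path 1, which does not
  start at 0 and hence lies in no \<open>D_mono_less k\<close>.\<close>

lemma C_pair_subset_iff: "C_pair (l, m) \<subseteq> C_pair (l', m') \<longleftrightarrow> l \<le> l' \<and> m \<le> m'"
proof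
  assume "l \<le> l' \<and> m \<le> m'"
  thus "C_pair (l, m) \<subseteq> C_pair (l', m')"
    using D_mono_less_mono[of l l'] D_mono_less_mono[of m m'] by (auto simp: C_pair_def)
next
  assume sub: "C_pair (l, m) \<subseteq> C_pair (l', m')"
  define one where "one = to_cadlag (\<lambda>_. 1)"
  have "path_of one 0 = 1" unfolding one_def by (subst path_to_cadlag) (auto intro: is_cadlag_const)
  hence one: "one \<notin> D_mono_less k" for k by (simp add: D_mono_less_def)
  show "l \<le> l' \<and> m \<le> m'"
  proof (intro conjI; rule ccontr)
    assume "\<not> l \<le> l'"
    then obtain x where "x \<in> D_mono_less l" "x \<notin> D_mono_less l'"
      using exists_D_mono_less[of l' l] by auto
    hence "(x, one) \<in> C_pair (l, m)" "(x, one) \<notin> C_pair (l', m')" using one by (auto simp: C_pair_def)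
    thus False using sub by blast
  next
    assume "\<not> m \<le> m'"
    then obtain x where "x \<in> D_mono_less m" "x \<notin> D_mono_less m'"
      using exists_D_mono_less[of m' m] by auto
    hence "(one, x) \<in> C_pair (l, m)" "(one, x) \<notin> C_pair (l', m')" using one by (auto simp: C_pair_def)
    thus False using sub by blast
  qed
qed

lemma C_pair_psubset_iff:
  "C_pair (l, m) \<subset> C_pair (l', m') \<longleftrightarrow> l \<le> l' \<and> m \<le> m' \<and> (l, m) \<noteq> (l', m')"
  unfolding psubset_eq by (auto simp: set_eq_subset C_pair_subset_iff)

text \<open>Among the pairs outside \<open>I_less\<close> that lie below \<open>l\<close>, one with
  the fewest jumps in total is minimal. Hence a path whose numbers of big jumps are not in
  \<open>I_less\<close> has enough of them to belong to \<open>B_set\<close>.\<close>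

lemma J_set_below:
  assumes "l \<notin> I_less \<alpha> \<beta> ls"
  shows "\<exists>lm lp. (lm, lp) \<in> J_set \<alpha> \<beta> ls \<and> lm \<le> fst l \<and> lp \<le> snd l"
proof -
  let ?P = "\<lambda>l'. l' \<notin> I_less \<alpha> \<beta> ls \<and> fst l' \<le> fst l \<and> snd l' \<le> snd l"
  obtain l' where l': "?P l'" and min: "\<And>k. ?P k \<Longrightarrow> fst l' + snd l' \<le> fst k + snd k"
    using ex_has_least_nat[of ?P l "\<lambda>k. fst k + snd k"] assms by auto
  have "m \<in> I_less \<alpha> \<beta> ls" if "C_pair m \<subset> C_pair l'" for m
  proof -
    have lt: "fst m \<le> fst l'" "snd m \<le> snd l'" "m \<noteq> l'"
      using that C_pair_psubset_iff[of "fst m" "snd m" "fst l'" "snd l'"] by auto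
    hence "fst m + snd m < fst l' + snd l'"
      using add_mono[OF lt(1,2)] by (cases m; cases l') auto
    thus ?thesis using min[of m] lt l' by force
  qed
  thus ?thesis using l' by (intro exI[of _ "fst l'"] exI[of _ "snd l'"]) (auto simp: J_set_def)
qed

lemma finite_jump_cost_le:
  assumes "\<alpha> > 1" "\<beta> > 1"
  shows "finite {l. jump_cost \<alpha> \<beta> l \<le> c}"
proof (rule finite_subset)
  show "{l. jump_cost \<alpha> \<beta> l \<le> c} \<subseteq> {..nat \<lceil>c / (\<alpha> - 1)\<rceil>} \<times> {..nat \<lceil>c / (\<beta> - 1)\<rceil>}"
  proof
    fix l assume "l \<in> {l. jump_cost \<alpha> \<beta> l \<le> c}"
    then obtain a b where l: "l = (a, b)" and c: "(\<alpha> - 1) * real a + (\<beta> - 1) * real b \<le> c"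
      by (cases l) (auto simp: jump_cost_def)
    have nn: "(\<alpha> - 1) * real a \<ge> 0" "(\<beta> - 1) * real b \<ge> 0" using assms by auto
    have "real a \<le> c / (\<alpha> - 1)" "real b \<le> c / (\<beta> - 1)"
      using c nn assms by (simp_all add: field_simps)
    thus "l \<in> {..nat \<lceil>c / (\<alpha> - 1)\<rceil>} \<times> {..nat \<lceil>c / (\<beta> - 1)\<rceil>}"
      unfolding l by (auto simp: le_nat_iff) linarith+
  qed
qed auto

text \<open>Removing one jump from a pair in \<open>J_set\<close> lands in \<open>I_less\<close>, so
  the pair costs at most one jump more than \<open>ls\<close>. Only (0,0) has no predecessor and is
  added separately.\<close>

lemma finite_J_set:
  assumes "\<alpha> > 1" "\<beta> > 1"
  shows "finite (J_set \<alpha> \<beta> ls)"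
proof (rule finite_subset)
  let ?c = "jump_cost \<alpha> \<beta> ls + (\<alpha> - 1) + (\<beta> - 1)"
  show "J_set \<alpha> \<beta> ls \<subseteq> {l. jump_cost \<alpha> \<beta> l \<le> ?c} \<union> {(0, 0)}"
  proof
    fix l assume l: "l \<in> J_set \<alpha> \<beta> ls"
    obtain a b where ab: "l = (a, b)" by (cases l)
    have I: "(a', b') \<in> I_less \<alpha> \<beta> ls" if "a' \<le> a" "b' \<le> b" "(a', b') \<noteq> (a, b)" for a' b'
      using l that C_pair_psubset_iff[of a' b' a b] unfolding ab J_set_def by auto
    consider "a > 0" | "b > 0" | "a = 0" "b = 0" by linarith
    thus "l \<in> {l. jump_cost \<alpha> \<beta> l \<le> ?c} \<union> {(0, 0)}"
    proof cases
      case 1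
      hence "jump_cost \<alpha> \<beta> (a - 1, b) \<le> jump_cost \<alpha> \<beta> ls"
        using I[of "a - 1" b] by (auto simp: I_less_def)
      thus ?thesis using 1 assms unfolding ab by (auto simp: jump_cost_def of_nat_diff algebra_simps)
    next
      case 2
      hence "jump_cost \<alpha> \<beta> (a, b - 1) \<le> jump_cost \<alpha> \<beta> ls"
        using I[of a "b - 1"] by (auto simp: I_less_def)
      thus ?thesis using 2 assms unfolding ab by (auto simp: jump_cost_def of_nat_diff algebra_simps)
    qed (simp add: ab)
  qed
qed (use finite_jump_cost_le[OF assms] in auto)

lemma bounded_away_dist:
  assumes "bounded_away A S"
  obtains \<delta> where "\<delta> > 0" "\<And>x y. x \<in> A \<Longrightarrow> y \<in> S \<Longrightarrow> \<delta> \<le> dist x y"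
proof -
  have "(0::ereal) < (INF (x, y)\<in>A \<times> S. ereal (dist x y))" using assms by (simp add: bounded_away_def)
  \<comment> \<open>The infimum may be infinite, namely if one of the sets is empty, so a real
    number strictly between 0 and the infimum is taken.\<close>
  then obtain \<delta> where \<delta>: "0 < ereal \<delta>" "ereal \<delta> < (INF (x, y)\<in>A \<times> S. ereal (dist x y))"
    using ereal_dense2 by blast
  have "\<delta> \<le> dist x y" if "x \<in> A" "y \<in> S" for x y
  proof -
    have "(INF (x, y)\<in>A \<times> S. ereal (dist x y)) \<le> ereal (dist x y)"
      by (rule INF_lower2[of "(x, y)"]) (use that in auto)
    thus ?thesis using \<delta>(2) by (metis ereal_less_eq(3) less_le_trans less_imp_le)
  qed
  thus ?thesis using \<delta>(1) that by auto
qed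


section \<open>Regularly varying tails\<close>

lemma dyadic_scale:
  fixes X x :: real
  assumes "0 < X" "X \<le> x"
  obtains m :: nat where "2 ^ m * X \<le> x" "x < 2 ^ Suc m * X"
proof
  define m where "m = nat \<lfloor>log 2 (x / X)\<rfloor>"
  have l0: "log 2 (x / X) \<ge> 0" using assms by (subst zero_le_log_cancel_iff) auto
  have pos: "x / X > 0" using assms by auto
  have "2 ^ m = 2 powr real m" by (simp add: powr_realpow)
  also have "\<dots> \<le> 2 powr log 2 (x / X)" using l0 by (intro powr_mono) (auto simp: m_def)
  finally have "2 ^ m \<le> x / X" using pos by simp
  thus "2 ^ m * X \<le> x" using assms by (simp add: field_simps)
  have "x / X = 2 powr log 2 (x / X)" using pos by simp
  also have "\<dots> < 2 powr real (Suc m)" using l0 by (intro powr_less_mono) (auto simp: m_def, linarith)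
  also have "\<dots> = 2 ^ Suc m" by (rule powr_realpow) simp
  finally show "x < 2 ^ Suc m * X" using assms by (simp add: field_simps)
qed

text \<open>Half of a Potter bound, from dilation by 2 alone: beyond \<open>X\<close> the ratio
  \<open>f (2 * x) / f x\<close> stays below \<open>2 powr (- p)\<close>. This iterates along the
  points \<open>2 ^ m * X\<close>, and monotonicity fills the gaps at the price of a factor
  \<open>2 powr p\<close>.\<close>

lemma regularly_varying_upper:
  assumes f: "regularly_varying f (- a)" and anti: "\<And>x y. x \<le> y \<Longrightarrow> f y \<le> f x" and p: "0 < p" "p < a"
  obtains C X where "C > 0" "X \<ge> 1" "\<And>x. x \<ge> X \<Longrightarrow> f x \<le> C * x powr (- p)"
proof -
  have lim: "((\<lambda>x. f (2 * x) / f x) \<longlongrightarrow> 2 powr (- a)) at_top" and pos: "\<forall>\<^sub>F x in at_top. f x > 0"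
    using f unfolding regularly_varying_def by auto
  have "\<forall>\<^sub>F x in at_top. f (2 * x) / f x < 2 powr (- p)"
    by (rule order_tendstoD[OF lim]) (use p in \<open>simp add: powr_less_mono\<close>)
  hence "\<forall>\<^sub>F x in at_top. f (2 * x) / f x < 2 powr (- p) \<and> f x > 0 \<and> x \<ge> 1"
    using pos eventually_ge_at_top[of 1] by eventually_elim auto
  then obtain X where X: "\<And>x. x \<ge> X \<Longrightarrow> f (2 * x) / f x < 2 powr (- p) \<and> f x > 0 \<and> x \<ge> 1"
    by (auto simp: eventually_at_top_linorder)
  have X1: "X \<ge> 1" using X[of X] by auto
  have dbl: "f (2 * x) \<le> 2 powr (- p) * f x" if "x \<ge> X" for x
    using X[OF that] by (auto simp: field_simps)
  have pw: "f (2 ^ m * X) \<le> (2 ^ m) powr (- p) * f X" for m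
  proof (induction m)
    case (Suc m)
    have "1 * X \<le> 2 ^ m * X" using X1 by (intro mult_right_mono) auto
    hence "f (2 * (2 ^ m * X)) \<le> 2 powr (- p) * f (2 ^ m * X)" by (intro dbl) auto
    also have "\<dots> \<le> 2 powr (- p) * ((2 ^ m) powr (- p) * f X)" using Suc by (intro mult_left_mono) auto
    also have "\<dots> = (2 ^ Suc m) powr (- p) * f X" by (simp add: powr_mult)
    finally show ?case by (simp add: mult.assoc)
  qed auto
  show ?thesis
  proof (rule that)
    show "(2 * X) powr p * f X > 0" using X[of X] X1 by auto
    show "X \<ge> 1" by fact
    fix x assume x: "x \<ge> X"
    obtain m where m: "2 ^ m * X \<le> x" "x < 2 ^ Suc m * X" using dyadic_scale[of X x] x X1 by auto
    have "f x \<le> f (2 ^ m * X)" by (rule anti) fact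
    also have "\<dots> \<le> (2 ^ m) powr (- p) * f X" by (rule pw)
    also have "\<dots> \<le> (x / (2 * X)) powr (- p) * f X"
    proof (intro mult_right_mono powr_mono2')
      show "0 \<le> f X" using X[of X] by auto
      show "x / (2 * X) \<le> 2 ^ m" using m(2) X1 by (simp add: field_simps)
    qed (use x X1 p in auto)
    also have "\<dots> = (2 * X) powr p * f X * x powr (- p)"
      using x X1 by (simp add: powr_divide powr_minus divide_simps)
    finally show "f x \<le> (2 * X) powr p * f X * x powr (- p)" .
  qed
qed

text \<open>Mirror image of the upper bound; here \<open>x\<close> is compared with the next dyadic
  point above it.\<close>

lemma regularly_varying_lower:
  assumes f: "regularly_varying f (- a)" and anti: "\<And>x y. x \<le> y \<Longrightarrow> f y \<le> f x" and p: "0 < a" "a < p"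
  obtains c X where "c > 0" "X \<ge> 1" "\<And>x. x \<ge> X \<Longrightarrow> c * x powr (- p) \<le> f x"
proof -
  have lim: "((\<lambda>x. f (2 * x) / f x) \<longlongrightarrow> 2 powr (- a)) at_top" and pos: "\<forall>\<^sub>F x in at_top. f x > 0"
    using f unfolding regularly_varying_def by auto
  have "\<forall>\<^sub>F x in at_top. 2 powr (- p) < f (2 * x) / f x"
    by (rule order_tendstoD[OF lim]) (use p in \<open>simp add: powr_less_mono\<close>)
  hence "\<forall>\<^sub>F x in at_top. 2 powr (- p) < f (2 * x) / f x \<and> f x > 0 \<and> x \<ge> 1"
    using pos eventually_ge_at_top[of 1] by eventually_elim auto
  then obtain X where X: "\<And>x. x \<ge> X \<Longrightarrow> 2 powr (- p) < f (2 * x) / f x \<and> f x > 0 \<and> x \<ge> 1"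
    by (auto simp: eventually_at_top_linorder)
  have X1: "X \<ge> 1" using X[of X] by auto
  have dbl: "2 powr (- p) * f x \<le> f (2 * x)" if "x \<ge> X" for x
    using X[OF that] by (auto simp: field_simps)
  have pw: "(2 ^ m) powr (- p) * f X \<le> f (2 ^ m * X)" for m
  proof (induction m)
    case (Suc m)
    have "(2 ^ Suc m) powr (- p) * f X = 2 powr (- p) * ((2 ^ m) powr (- p) * f X)" by (simp add: powr_mult)
    also have "\<dots> \<le> 2 powr (- p) * f (2 ^ m * X)" using Suc by (intro mult_left_mono) auto
    also have "1 * X \<le> 2 ^ m * X" using X1 by (intro mult_right_mono) auto
    hence "2 powr (- p) * f (2 ^ m * X) \<le> f (2 * (2 ^ m * X))" by (intro dbl) auto
    finally show ?case by (simp add: mult.assoc)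
  qed auto
  show ?thesis
  proof (rule that)
    show "(2 / X) powr (- p) * f X > 0" using X[of X] X1 by auto
    show "X \<ge> 1" by fact
    fix x assume x: "x \<ge> X"
    obtain m where m: "2 ^ m * X \<le> x" "x < 2 ^ Suc m * X" using dyadic_scale[of X x] x X1 by auto
    have "(2 / X) powr (- p) * f X * x powr (- p) = (2 * x / X) powr (- p) * f X"
      using x X1 by (simp add: powr_divide powr_mult powr_minus divide_simps)
    also have "\<dots> \<le> (2 ^ Suc m) powr (- p) * f X"
    proof (intro mult_right_mono powr_mono2')
      show "0 \<le> f X" using X[of X] by auto
      show "2 ^ Suc m \<le> 2 * x / X" using m(1) X1 by (simp add: field_simps)
    qed (use p in auto)
    also have "\<dots> \<le> f (2 ^ Suc m * X)" by (rule pw)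
    also have "\<dots> \<le> f x" by (rule anti) (use m in auto)
    finally show "(2 / X) powr (- p) * f X * x powr (- p) \<le> f x" .
  qed
qed

text \<open>Makes the probability that an increment divided by \<open>n\<close> falls into a fixed
  interval comparable with the tail at \<open>n\<close>. The ratio tends to
  \<open>s powr (- a) - t powr (- a)\<close>, and half of this limit is a safe constant.\<close>

lemma regularly_varying_window:
  assumes f: "regularly_varying f (- a)" and "a > 0" "0 < s" "s < t"
  obtains c where "c > 0" "\<forall>\<^sub>F n in sequentially. c * f (real n) \<le> f (s * real n) - f (t * real n)"
proof -
  have pos: "\<forall>\<^sub>F x in at_top. f x > 0" using f unfolding regularly_varying_def by auto
  define c where "c = s powr (- a) - t powr (- a)"
  have "t powr (- a) < s powr (- a)" using assms by (intro powr_less_mono2_neg) auto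
  hence c: "c > 0" by (simp add: c_def)
  have "((\<lambda>x. f (s * x) / f x - f (t * x) / f x) \<longlongrightarrow> c) at_top"
    using f assms unfolding regularly_varying_def c_def by (intro tendsto_diff) auto
  hence "\<forall>\<^sub>F x in at_top. c / 2 < f (s * x) / f x - f (t * x) / f x"
    by (rule order_tendstoD) (use c in auto)
  with pos have "\<forall>\<^sub>F x in at_top. c / 2 * f x \<le> f (s * x) - f (t * x)"
    by eventually_elim (auto simp: field_simps)
  hence "\<forall>\<^sub>F n in sequentially. c / 2 * f (real n) \<le> f (s * real n) - f (t * real n)"
    by (rule eventually_compose_filterlim) (rule filterlim_real_sequentially)
  thus ?thesis using c by (intro that[of "c / 2"]) auto
qed

lemma regularly_varying_scale:
  assumes f: "regularly_varying f (- a)" and "0 < s"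
  obtains C where "C > 0" "\<forall>\<^sub>F n in sequentially. f (s * real n) \<le> C * f (real n)"
proof -
  have pos: "\<forall>\<^sub>F x in at_top. f x > 0" using f unfolding regularly_varying_def by auto
  define C where "C = s powr (- a) + 1"
  have C: "C > 0" by (simp add: C_def add_nonneg_pos)
  have "((\<lambda>x. f (s * x) / f x) \<longlongrightarrow> s powr (- a)) at_top"
    using f assms unfolding regularly_varying_def by auto
  hence "\<forall>\<^sub>F x in at_top. f (s * x) / f x < C"
    by (rule order_tendstoD) (auto simp: C_def)
  with pos have "\<forall>\<^sub>F x in at_top. f (s * x) \<le> C * f x"
    by eventually_elim (auto simp: field_simps)
  hence "\<forall>\<^sub>F n in sequentially. f (s * real n) \<le> C * f (real n)"
    by (rule eventually_compose_filterlim) (rule filterlim_real_sequentially)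
  thus ?thesis using C by (intro that[of C]) auto
qed


section \<open>Concentration of truncated random walks\<close>

text \<open>Large values are replaced by 0 rather than clipped to the bound, so a truncated sum is
  exactly the sum over the increments that are not big.\<close>

definition truncate :: "real \<Rightarrow> real \<Rightarrow> real" where
  "truncate b y = (if \<bar>y\<bar> \<le> b then y else 0)"

lemma measurable_truncate [measurable]: "truncate b \<in> borel_measurable borel"
  unfolding truncate_def by measurable

text \<open>Second-order Taylor formula. The factor with \<open>\<bar>u\<bar>\<close> stays explicit
  because it will be applied with \<open>u\<close> of logarithmic size in \<open>n\<close>, where
  this factor is a small power of \<open>n\<close>.\<close>

lemma exp_quadratic_upper: "exp u \<le> 1 + u + u\<^sup>2 * exp \<bar>u\<bar>" for u :: real
proof -
  obtain t where t: "\<bar>t\<bar> \<le> \<bar>u\<bar>" "exp u = (\<Sum>m<2. (u ^ m) / fact m) + (exp t / fact 2) * u ^ 2"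
    using Maclaurin_exp_le[of u 2] by blast
  have "exp t / 2 * u\<^sup>2 \<le> exp \<bar>u\<bar> * u\<^sup>2"
  proof (rule mult_right_mono)
    have "exp t / 2 \<le> exp t" by simp
    also have "\<dots> \<le> exp \<bar>u\<bar>" using t(1) by simp
    finally show "exp t / 2 \<le> exp \<bar>u\<bar>" .
  qed simp
  thus ?thesis using t(2) by (simp add: eval_nat_numeral algebra_simps)
qed

locale heavy_walk = prob_space M for M :: "'a measure" +
  fixes Y :: "nat \<Rightarrow> 'a \<Rightarrow> real" and \<alpha> \<beta> :: real
  assumes indep: "indep_vars (\<lambda>_. borel) Y {1..}"
    and ident: "\<And>k. k \<ge> 1 \<Longrightarrow> distr M borel (Y k) = distr M borel (Y 1)"
    and integrable_Y: "integrable M (Y 1)" and mean_Y: "expectation (Y 1) = 0"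
    and alpha: "\<alpha> > 1" and beta: "\<beta> > 1"
    and rv_down: "regularly_varying (\<lambda>x. prob {\<omega>\<in>space M. Y 1 \<omega> \<le> - x}) (- \<alpha>)"
    and rv_up: "regularly_varying (\<lambda>x. prob {\<omega>\<in>space M. Y 1 \<omega> \<ge> x}) (- \<beta>)"
begin

definition tail_down :: "real \<Rightarrow> real" where
  "tail_down x = prob {\<omega>\<in>space M. Y 1 \<omega> \<le> - x}"

definition tail_up :: "real \<Rightarrow> real" where
  "tail_up x = prob {\<omega>\<in>space M. Y 1 \<omega> \<ge> x}"

lemma measurable_Y [measurable]: "1 \<le> k \<Longrightarrow> Y k \<in> borel_measurable M"
  using indep by (auto simp: indep_vars_def)

lemma measurable_Y1 [measurable]: "Y (Suc 0) \<in> borel_measurable M"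
  using measurable_Y[of 1] by simp

lemma prob_Y:
  assumes "1 \<le> k" "S \<in> sets borel"
  shows "prob {\<omega>\<in>space M. Y k \<omega> \<in> S} = prob {\<omega>\<in>space M. Y 1 \<omega> \<in> S}"
proof -
  have "measure (distr M borel (Y k)) S = measure (distr M borel (Y 1)) S" using ident[OF assms(1)] by simp
  moreover have "measure (distr M borel (Y k)) S = prob {\<omega>\<in>space M. Y k \<omega> \<in> S}" if "1 \<le> k" for k
    using measurable_Y[OF that] assms(2) by (subst measure_distr) (auto intro!: arg_cong[where f = prob])
  ultimately show ?thesis using assms(1) by simp
qed

lemma expectation_Y:
  fixes f :: "real \<Rightarrow> real"
  assumes k: "1 \<le> k" and f: "f \<in> borel_measurable borel"
  shows "expectation (\<lambda>\<omega>. f (Y k \<omega>)) = expectation (\<lambda>\<omega>. f (Y 1 \<omega>))"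
proof -
  have "integral\<^sup>L (distr M borel (Y k)) f = integral\<^sup>L (distr M borel (Y 1)) f" using ident[OF k] by simp
  thus ?thesis using integral_distr[OF measurable_Y[OF k] f] integral_distr[OF measurable_Y[of 1] f] by simp
qed

lemma tail_down_antimono: "x \<le> y \<Longrightarrow> tail_down y \<le> tail_down x"
  unfolding tail_down_def by (rule finite_measure_mono) auto

lemma tail_up_antimono: "x \<le> y \<Longrightarrow> tail_up y \<le> tail_up x"
  unfolding tail_up_def by (rule finite_measure_mono) auto

lemma rv_tail_down: "regularly_varying tail_down (- \<alpha>)"
  using rv_down unfolding tail_down_def[abs_def] .

lemma rv_tail_up: "regularly_varying tail_up (- \<beta>)"
  using rv_up unfolding tail_up_def[abs_def] .

lemma tail_nonneg: "0 \<le> tail_down x" "0 \<le> tail_up x"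
  by (auto simp: tail_down_def tail_up_def)

section \<open>Tail bounds and moments of the increments\<close>

lemma abs_tail_bound:
  assumes p: "0 < p" "p < \<alpha>" "p < \<beta>"
  obtains C where "C > 0" "\<And>x. x \<ge> 1 \<Longrightarrow> prob {\<omega>\<in>space M. \<bar>Y 1 \<omega>\<bar> \<ge> x} \<le> C * x powr (- p)"
proof -
  obtain C1 X1 where 1: "C1 > 0" "X1 \<ge> 1" "\<And>x. x \<ge> X1 \<Longrightarrow> tail_down x \<le> C1 * x powr (- p)"
    using regularly_varying_upper[OF rv_tail_down tail_down_antimono p(1,2)] by blast
  obtain C2 X2 where 2: "C2 > 0" "X2 \<ge> 1" "\<And>x. x \<ge> X2 \<Longrightarrow> tail_up x \<le> C2 * x powr (- p)"
    using regularly_varying_upper[OF rv_tail_up tail_up_antimono p(1,3)] by blast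
  define X where "X = max X1 X2"
  \<comment> \<open>The summand \<open>X powr p\<close> pays for the range between 1 and
    \<open>X\<close>, where the probability is merely bounded by 1.\<close>
  define C where "C = C1 + C2 + X powr p"
  have X: "X \<ge> 1" "X \<ge> X1" "X \<ge> X2" using 1 2 by (auto simp: X_def)
  show ?thesis
  proof (rule that)
    show "C > 0" using 1 2 by (auto simp: C_def intro!: add_pos_nonneg)
    fix x :: real assume x: "x \<ge> 1"
    show "prob {\<omega>\<in>space M. \<bar>Y 1 \<omega>\<bar> \<ge> x} \<le> C * x powr (- p)"
    proof (cases "x \<ge> X")
      case True
      have "{\<omega>\<in>space M. \<bar>Y 1 \<omega>\<bar> \<ge> x} \<subseteq> {\<omega>\<in>space M. Y 1 \<omega> \<le> - x} \<union> {\<omega>\<in>space M. Y 1 \<omega> \<ge> x}" by auto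
      hence "prob {\<omega>\<in>space M. \<bar>Y 1 \<omega>\<bar> \<ge> x} \<le> prob ({\<omega>\<in>space M. Y 1 \<omega> \<le> - x} \<union> {\<omega>\<in>space M. Y 1 \<omega> \<ge> x})"
        by (rule finite_measure_mono) auto
      also have "\<dots> \<le> tail_down x + tail_up x"
        unfolding tail_down_def tail_up_def by (rule measure_Un_le) auto
      also have "\<dots> \<le> C1 * x powr (- p) + C2 * x powr (- p)"
        using True X by (intro add_mono 1 2) auto
      also have "\<dots> \<le> C * x powr (- p)"
        by (simp add: C_def algebra_simps)
      finally show ?thesis .
    next
      case False
      have "prob {\<omega>\<in>space M. \<bar>Y 1 \<omega>\<bar> \<ge> x} \<le> 1" by simp
      also have "1 \<le> (X / x) powr p" using False x p by (intro ge_one_powr_ge_zero) auto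
      also have "\<dots> = X powr p * x powr (- p)" using X x by (simp add: powr_divide powr_minus divide_simps)
      also have "\<dots> \<le> C * x powr (- p)" using 1 2 by (intro mult_right_mono) (auto simp: C_def)
      finally show ?thesis .
    qed
  qed
qed

text \<open>The values are cut into dyadic layers. With a tail exponent \<open>a\<close> strictly
  between \<open>p\<close> and both indices, layer \<open>m\<close> contributes at most a constant
  times \<open>2 powr (m * (p - a))\<close>, a convergent geometric series.\<close>

lemma integrable_moment:
  assumes p: "1 \<le> p" "p < \<alpha>" "p < \<beta>"
  shows "integrable M (\<lambda>\<omega>. \<bar>Y 1 \<omega>\<bar> powr p)"
proof -
  define a where "a = (p + min \<alpha> \<beta>) / 2"
  have a: "p < a" "a < \<alpha>" "a < \<beta>" using p by (auto simp: a_def min_def field_simps)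
  obtain C where C: "C > 0" "\<And>x. x \<ge> 1 \<Longrightarrow> prob {\<omega>\<in>space M. \<bar>Y 1 \<omega>\<bar> \<ge> x} \<le> C * x powr (- a)"
    using abs_tail_bound[of a] a p by auto
  let ?E = "\<lambda>m. {\<omega>\<in>space M. \<bar>Y 1 \<omega>\<bar> \<ge> 2 ^ m}"
  have E: "?E m \<in> sets M" for m by auto
  have "(\<integral>\<^sup>+\<omega>. ennreal (\<bar>Y 1 \<omega>\<bar> powr p) \<partial>M)
      \<le> (\<integral>\<^sup>+\<omega>. 1 + (\<Sum>m. ennreal ((2 ^ Suc m) powr p) * indicator (?E m) \<omega>) \<partial>M)"
  proof (rule nn_integral_mono)
    fix \<omega> assume \<omega>: "\<omega> \<in> space M"
    show "ennreal (\<bar>Y 1 \<omega>\<bar> powr p) \<le> 1 + (\<Sum>m. ennreal ((2 ^ Suc m) powr p) * indicator (?E m) \<omega>)"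
    proof (cases "\<bar>Y 1 \<omega>\<bar> \<ge> 1")
      case True
      then obtain m where m: "2 ^ m \<le> \<bar>Y 1 \<omega>\<bar>" "\<bar>Y 1 \<omega>\<bar> < 2 ^ Suc m"
        using dyadic_scale[of 1 "\<bar>Y 1 \<omega>\<bar>"] by auto
      have "ennreal (\<bar>Y 1 \<omega>\<bar> powr p) \<le> ennreal ((2 ^ Suc m) powr p) * indicator (?E m) \<omega>"
        using m \<omega> p by (auto intro!: ennreal_leI powr_mono2)
      also have "\<dots> = (\<Sum>m\<in>{m}. ennreal ((2 ^ Suc m) powr p) * indicator (?E m) \<omega>)"
        by (simp only: sum.insert[OF finite.emptyI] sum.empty empty_iff not_False_eq_True add_0_right)
      also have "\<dots> \<le> (\<Sum>m. ennreal ((2 ^ Suc m) powr p) * indicator (?E m) \<omega>)"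
        by (intro sum_le_suminf) auto
      finally show ?thesis by (simp add: add_increasing)
    next
      case False
      hence "\<bar>Y 1 \<omega>\<bar> powr p \<le> 1" using p by (intro powr_le1) auto
      hence "ennreal (\<bar>Y 1 \<omega>\<bar> powr p) \<le> 1" by (simp add: ennreal_le_1)
      thus ?thesis by (simp add: add_increasing2)
    qed
  qed
  also have "\<dots> = (\<integral>\<^sup>+\<omega>. 1 \<partial>M) + (\<integral>\<^sup>+\<omega>. (\<Sum>m. ennreal ((2 ^ Suc m) powr p) * indicator (?E m) \<omega>) \<partial>M)"
    by (rule nn_integral_add) auto
  also have "(\<integral>\<^sup>+\<omega>. 1 \<partial>M) = 1" by (simp add: emeasure_space_1)
  also have "(\<integral>\<^sup>+\<omega>. (\<Sum>m. ennreal ((2 ^ Suc m) powr p) * indicator (?E m) \<omega>) \<partial>M)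
      = (\<Sum>m. ennreal ((2 ^ Suc m) powr p) * emeasure M (?E m))"
    using E by (subst nn_integral_suminf) (auto simp: nn_integral_cmult_indicator)
  also have "\<dots> \<le> (\<Sum>m. ennreal (C * 2 powr p * (2 powr (p - a)) ^ m))"
  proof (intro suminf_le summableI)
    fix m
    have "ennreal ((2 ^ Suc m) powr p) * emeasure M (?E m) = ennreal ((2 ^ Suc m) powr p * prob (?E m))"
      by (simp add: emeasure_eq_measure ennreal_mult'')
    also have "(2 ^ Suc m) powr p * prob (?E m) \<le> (2 ^ Suc m) powr p * (C * (2 ^ m) powr (- a))"
      by (intro mult_left_mono C(2)) auto
    also have "\<dots> = C * 2 powr p * ((2 ^ m) powr p * (2 ^ m) powr (- a))" by (simp add: powr_mult)
    also have "(2 ^ m) powr p * (2 ^ m) powr (- a) = (2 ^ m) powr (p - a)"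
      by (simp add: powr_add[symmetric])
    also have "\<dots> = (2 powr (p - a)) ^ m"
      by (simp add: powr_realpow[symmetric] powr_powr mult.commute)
    finally show "ennreal ((2 ^ Suc m) powr p) * emeasure M (?E m) \<le> ennreal (C * 2 powr p * (2 powr (p - a)) ^ m)"
      by (simp add: ennreal_leI)
  qed
  also have "\<dots> = ennreal (\<Sum>m. C * 2 powr p * (2 powr (p - a)) ^ m)"
  proof (intro suminf_ennreal2 summable_mult summable_geometric)
    have "2 powr (p - a) < 2 powr (0::real)" using a by (intro powr_less_mono) auto
    thus "norm (2 powr (p - a)) < (1::real)" by simp
  qed (use C in auto)
  finally have "(\<integral>\<^sup>+\<omega>. ennreal (\<bar>Y 1 \<omega>\<bar> powr p) \<partial>M) \<le> 1 + ennreal (\<Sum>m. C * 2 powr p * (2 powr (p - a)) ^ m)"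
    by (simp add: add_mono)
  also have "\<dots> < \<infinity>" by simp
  finally show ?thesis by (intro integrableI_bounded) auto
qed

text \<open>Second-order expansion of the exponential. Truncation destroys centering, but since
  \<open>Y 1\<close> has mean 0 the new mean equals, up to sign, the mean of the part cut off, which
  is at most \<open>b powr (1 - p) * m\<close>. The variance may be infinite, so the quadratic term
  is also bounded through the moment of order \<open>p < 2\<close>, by
  \<open>b powr (2 - p) * m\<close>.\<close>

lemma mgf_truncate:
  assumes p: "1 < p" "p < 2" "p < \<alpha>" "p < \<beta>" and b: "b > 0" and k: "1 \<le> k"
    and m: "m = expectation (\<lambda>\<omega>. \<bar>Y 1 \<omega>\<bar> powr p)"
  shows "expectation (\<lambda>\<omega>. exp (\<theta> * truncate b (Y k \<omega>)))
    \<le> exp (\<bar>\<theta>\<bar> * b powr (1 - p) * m + \<theta>\<^sup>2 * b powr (2 - p) * m * exp (\<bar>\<theta>\<bar> * b))"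
proof -
  let ?X = "\<lambda>\<omega>. truncate b (Y 1 \<omega>)"
  have int_m: "integrable M (\<lambda>\<omega>. \<bar>Y 1 \<omega>\<bar> powr p)" using p by (intro integrable_moment) auto
  have bd: "\<bar>?X \<omega>\<bar> \<le> b" for \<omega> using b by (auto simp: truncate_def)
  have int_X: "integrable M ?X"
    by (rule integrable_const_bound[of _ b]) (use bd in auto)
  have int_X2: "integrable M (\<lambda>\<omega>. (?X \<omega>)\<^sup>2)"
  proof (rule integrable_const_bound[of _ "b\<^sup>2"])
    show "AE \<omega> in M. norm ((?X \<omega>)\<^sup>2) \<le> b\<^sup>2"
      using bd b by (intro always_eventually allI) (simp add: abs_le_square_iff[symmetric])
  qed auto
  have int_exp: "integrable M (\<lambda>\<omega>. exp (\<theta> * ?X \<omega>))"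
  proof (rule integrable_const_bound[of _ "exp (\<bar>\<theta>\<bar> * b)"])
    have "\<theta> * ?X \<omega> \<le> \<bar>\<theta>\<bar> * b" for \<omega>
    proof -
      have "\<theta> * ?X \<omega> \<le> \<bar>\<theta>\<bar> * \<bar>?X \<omega>\<bar>" by (simp add: abs_mult[symmetric])
      also have "\<dots> \<le> \<bar>\<theta>\<bar> * b" using bd by (intro mult_left_mono) auto
      finally show ?thesis .
    qed
    thus "AE \<omega> in M. norm (exp (\<theta> * ?X \<omega>)) \<le> exp (\<bar>\<theta>\<bar> * b)" by simp
  qed auto
  have EX: "\<bar>expectation ?X\<bar> \<le> b powr (1 - p) * m"
  proof -
    have "expectation ?X = expectation (\<lambda>\<omega>. ?X \<omega> - Y 1 \<omega>)"
      using int_X integrable_Y mean_Y by simp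
    hence "\<bar>expectation ?X\<bar> \<le> expectation (\<lambda>\<omega>. \<bar>?X \<omega> - Y 1 \<omega>\<bar>)"
      using integral_abs_bound[of M "\<lambda>\<omega>. ?X \<omega> - Y 1 \<omega>"] by simp
    also have "\<dots> \<le> expectation (\<lambda>\<omega>. b powr (1 - p) * \<bar>Y 1 \<omega>\<bar> powr p)"
    proof (rule integral_mono)
      show "integrable M (\<lambda>\<omega>. \<bar>?X \<omega> - Y 1 \<omega>\<bar>)" using int_X integrable_Y by auto
      fix \<omega>
      show "\<bar>?X \<omega> - Y 1 \<omega>\<bar> \<le> b powr (1 - p) * \<bar>Y 1 \<omega>\<bar> powr p"
      proof (cases "\<bar>Y 1 \<omega>\<bar> \<le> b")
        case False
        have "\<bar>Y 1 \<omega>\<bar> powr 1 = \<bar>Y 1 \<omega>\<bar> powr (1 - p) * \<bar>Y 1 \<omega>\<bar> powr p"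
          by (simp add: powr_add[symmetric])
        also have "\<dots> \<le> b powr (1 - p) * \<bar>Y 1 \<omega>\<bar> powr p"
          using False b p by (intro mult_right_mono powr_mono2') auto
        finally show ?thesis using False b by (simp add: truncate_def)
      qed (auto simp: truncate_def)
    qed (use int_m in auto)
    also have "\<dots> = b powr (1 - p) * m" by (simp add: m)
    finally show ?thesis .
  qed
  have EX2: "expectation (\<lambda>\<omega>. (?X \<omega>)\<^sup>2) \<le> b powr (2 - p) * m"
  proof -
    have "expectation (\<lambda>\<omega>. (?X \<omega>)\<^sup>2) \<le> expectation (\<lambda>\<omega>. b powr (2 - p) * \<bar>Y 1 \<omega>\<bar> powr p)"
    proof (rule integral_mono)
      fix \<omega>
      show "(?X \<omega>)\<^sup>2 \<le> b powr (2 - p) * \<bar>Y 1 \<omega>\<bar> powr p"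
      proof (cases "\<bar>Y 1 \<omega>\<bar> \<le> b \<and> Y 1 \<omega> \<noteq> 0")
        case True
        have "(Y 1 \<omega>)\<^sup>2 = \<bar>Y 1 \<omega>\<bar> powr 2" using True by simp
        also have "\<dots> = \<bar>Y 1 \<omega>\<bar> powr (2 - p) * \<bar>Y 1 \<omega>\<bar> powr p" by (simp add: powr_add[symmetric])
        also have "\<dots> \<le> b powr (2 - p) * \<bar>Y 1 \<omega>\<bar> powr p"
          using True p by (intro mult_right_mono powr_mono2) auto
        finally show ?thesis using True by (simp add: truncate_def)
      qed (auto simp: truncate_def)
    qed (use int_m int_X2 in auto)
    thus ?thesis by (simp add: m)
  qed
  have "expectation (\<lambda>\<omega>. exp (\<theta> * truncate b (Y k \<omega>))) = expectation (\<lambda>\<omega>. exp (\<theta> * ?X \<omega>))"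
    using k by (intro expectation_Y) measurable
  also have "\<dots> \<le> expectation (\<lambda>\<omega>. 1 + \<theta> * ?X \<omega> + \<theta>\<^sup>2 * exp (\<bar>\<theta>\<bar> * b) * (?X \<omega>)\<^sup>2)"
  proof (rule integral_mono)
    fix \<omega>
    have "exp (\<theta> * ?X \<omega>) \<le> 1 + \<theta> * ?X \<omega> + (\<theta> * ?X \<omega>)\<^sup>2 * exp \<bar>\<theta> * ?X \<omega>\<bar>" by (rule exp_quadratic_upper)
    also have "(\<theta> * ?X \<omega>)\<^sup>2 * exp \<bar>\<theta> * ?X \<omega>\<bar> \<le> (\<theta> * ?X \<omega>)\<^sup>2 * exp (\<bar>\<theta>\<bar> * b)"
      using bd[of \<omega>] by (intro mult_left_mono) (auto simp: abs_mult intro!: mult_left_mono)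
    finally show "exp (\<theta> * ?X \<omega>) \<le> 1 + \<theta> * ?X \<omega> + \<theta>\<^sup>2 * exp (\<bar>\<theta>\<bar> * b) * (?X \<omega>)\<^sup>2"
      by (simp add: power_mult_distrib algebra_simps)
  qed (use int_exp int_X int_X2 in auto)
  also have "\<dots> = 1 + \<theta> * expectation ?X + \<theta>\<^sup>2 * exp (\<bar>\<theta>\<bar> * b) * expectation (\<lambda>\<omega>. (?X \<omega>)\<^sup>2)"
    using int_X int_X2 by (simp add: prob_space)
  also have "\<dots> \<le> 1 + \<bar>\<theta>\<bar> * (b powr (1 - p) * m) + \<theta>\<^sup>2 * exp (\<bar>\<theta>\<bar> * b) * (b powr (2 - p) * m)"
  proof (intro add_mono mult_left_mono EX2 order_refl)
    have "\<theta> * expectation ?X \<le> \<bar>\<theta>\<bar> * \<bar>expectation ?X\<bar>" by (simp add: abs_mult[symmetric])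
    also have "\<dots> \<le> \<bar>\<theta>\<bar> * (b powr (1 - p) * m)" using EX by (intro mult_left_mono) auto
    finally show "\<theta> * expectation ?X \<le> \<bar>\<theta>\<bar> * (b powr (1 - p) * m)" .
  qed auto
  also have "\<dots> = 1 + (\<bar>\<theta>\<bar> * b powr (1 - p) * m + \<theta>\<^sup>2 * b powr (2 - p) * m * exp (\<bar>\<theta>\<bar> * b))"
    by (simp add: mult_ac)
  also have "\<dots> \<le> exp (\<bar>\<theta>\<bar> * b powr (1 - p) * m + \<theta>\<^sup>2 * b powr (2 - p) * m * exp (\<bar>\<theta>\<bar> * b))"
    by (rule exp_ge_add_one_self)
  finally show ?thesis .
qed

text \<open>Exponential Chebyshev inequality; \<theta> may have either sign, so both tails are
  covered. An arbitrary index set \<open>J\<close> can be allowed because the exponent per factor is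
  nonnegative and there are at most \<open>n\<close> factors.\<close>

lemma chernoff_truncate:
  assumes p: "1 < p" "p < 2" "p < \<alpha>" "p < \<beta>" and b: "b > 0" and J: "J \<subseteq> {1..n}"
    and m: "m = expectation (\<lambda>\<omega>. \<bar>Y 1 \<omega>\<bar> powr p)"
  shows "prob {\<omega>\<in>space M. d \<le> \<theta> * (\<Sum>j\<in>J. truncate b (Y j \<omega>))}
    \<le> exp (real n * (\<bar>\<theta>\<bar> * b powr (1 - p) * m + \<theta>\<^sup>2 * b powr (2 - p) * m * exp (\<bar>\<theta>\<bar> * b)) - d)"
proof -
  define \<kappa> where "\<kappa> = \<bar>\<theta>\<bar> * b powr (1 - p) * m + \<theta>\<^sup>2 * b powr (2 - p) * m * exp (\<bar>\<theta>\<bar> * b)"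
  have m0: "m \<ge> 0" unfolding m by (rule Bochner_Integration.integral_nonneg) auto
  have \<kappa>0: "\<kappa> \<ge> 0" using m0 by (auto simp: \<kappa>_def)
  have finJ: "finite J" using J finite_subset by blast
  have J1: "1 \<le> j" if "j \<in> J" for j using J that by auto
  let ?e = "\<lambda>j \<omega>. exp (\<theta> * truncate b (Y j \<omega>))"
  have ind: "indep_vars (\<lambda>_. borel) ?e J"
    by (rule indep_vars_compose2[OF indep_vars_subset[OF indep]]) (use J1 in auto)
  have meas: "Y j \<in> borel_measurable M" if "j \<in> J" for j using J1[OF that] by (rule measurable_Y)
  have inte: "integrable M (?e j)" if j: "j \<in> J" for j
  proof (rule integrable_const_bound[of _ "exp (\<bar>\<theta>\<bar> * b)"])
    have "\<theta> * truncate b y \<le> \<bar>\<theta>\<bar> * b" for y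
    proof -
      have "\<theta> * truncate b y \<le> \<bar>\<theta>\<bar> * \<bar>truncate b y\<bar>" by (simp add: abs_mult[symmetric])
      also have "\<dots> \<le> \<bar>\<theta>\<bar> * b" using b by (intro mult_left_mono) (auto simp: truncate_def)
      finally show ?thesis .
    qed
    thus "AE \<omega> in M. norm (?e j \<omega>) \<le> exp (\<bar>\<theta>\<bar> * b)" by simp
  qed (use meas[OF j] in measurable)
  have prod: "exp (\<theta> * (\<Sum>j\<in>J. truncate b (Y j \<omega>))) = (\<Prod>j\<in>J. ?e j \<omega>)" for \<omega>
    using finJ by (simp add: sum_distrib_left exp_sum)
  have int_prod: "integrable M (\<lambda>\<omega>. \<Prod>j\<in>J. ?e j \<omega>)"
    by (rule indep_vars_integrable[OF finJ ind inte])
  have "expectation (\<lambda>\<omega>. \<Prod>j\<in>J. ?e j \<omega>) = (\<Prod>j\<in>J. expectation (?e j))"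
    by (rule indep_vars_lebesgue_integral[OF finJ ind inte])
  also have "\<dots> \<le> (\<Prod>j\<in>J. exp \<kappa>)"
    using mgf_truncate[OF p b J1 m, of _ \<theta>] unfolding \<kappa>_def by (intro prod_mono) auto
  also have "\<dots> = exp (real (card J) * \<kappa>)" by (simp add: exp_of_nat_mult)
  also have "\<dots> \<le> exp (real n * \<kappa>)"
    using card_mono[OF _ J] \<kappa>0 by (auto intro!: mult_right_mono)
  finally have E: "expectation (\<lambda>\<omega>. \<Prod>j\<in>J. ?e j \<omega>) \<le> exp (real n * \<kappa>)" .
  have "{\<omega>\<in>space M. d \<le> \<theta> * (\<Sum>j\<in>J. truncate b (Y j \<omega>))} = {\<omega>\<in>space M. (\<Prod>j\<in>J. ?e j \<omega>) \<ge> exp d}"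
    unfolding prod[symmetric] by simp
  also have "prob \<dots> \<le> expectation (\<lambda>\<omega>. \<Prod>j\<in>J. ?e j \<omega>) / exp d"
    by (rule integral_Markov_inequality_measure[where A = "{}"]) (auto intro!: int_prod prod_nonneg always_eventually)
  also have "\<dots> \<le> exp (real n * \<kappa>) / exp d" using E by (intro divide_right_mono) auto
  finally show ?thesis by (simp add: \<kappa>_def exp_diff)
qed

end

lemma ln_powr_tendsto_0:
  assumes "q > 0"
  shows "(\<lambda>n. ln (real n) * real n powr (- q)) \<longlonglongrightarrow> 0"
proof (rule tendsto_sandwich[OF _ _ tendsto_const])
  have "(\<lambda>n. real n powr (- (q / 2))) \<longlonglongrightarrow> 0"
    using assms by (intro tendsto_neg_powr filterlim_real_sequentially) auto
  from tendsto_mult_left[OF this, of "2 / q"]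
  show "(\<lambda>n. 2 / q * real n powr (- (q / 2))) \<longlonglongrightarrow> 0" by simp
  show "\<forall>\<^sub>F n in sequentially. ln (real n) * real n powr (- q) \<le> 2 / q * real n powr (- (q / 2))"
    using eventually_ge_at_top[of 1]
  proof eventually_elim
    fix n :: nat assume n: "n \<ge> 1"
    have "ln (real n) \<le> real n powr (q / 2) / (q / 2)"
      using n assms by (intro ln_powr_bound) auto
    hence "ln (real n) * real n powr (- q) \<le> (real n powr (q / 2) / (q / 2)) * real n powr (- q)"
      by (intro mult_right_mono) auto
    also have "\<dots> = 2 / q * (real n powr (q / 2) * real n powr (- q))" by (simp add: field_simps)
    also have "real n powr (q / 2) * real n powr (- q) = real n powr (- (q / 2))"
      by (simp add: powr_add[symmetric])
    finally show "ln (real n) * real n powr (- q) \<le> 2 / q * real n powr (- (q / 2))" .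
  qed
  show "\<forall>\<^sub>F n in sequentially. 0 \<le> ln (real n) * real n powr (- q)"
    using eventually_ge_at_top[of 1] by eventually_elim auto
qed

context heavy_walk
begin

lemma measurable_truncated_sum:
  assumes "J \<subseteq> {1..}"
  shows "(\<lambda>\<omega>. \<Sum>j\<in>J. truncate b (Y j \<omega>)) \<in> borel_measurable M"
  using assms by (intro borel_measurable_sum measurable_compose[OF measurable_Y measurable_truncate]) auto

text \<open>The choice \<open>\<theta> = c * ln n / n\<close> makes the gain
  \<open>\<theta> * \<delta> * n\<close> equal to \<open>(K + 1) * ln n\<close>. Truncation at
  \<open>\<gamma> * n\<close> makes the exponential factor \<open>exp (\<theta> * b)\<close> equal
  to \<open>n powr (c * \<gamma>)\<close>. With \<open>q = p - 1\<close>, the moment bounds give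
  linear and quadratic terms of order \<open>ln n * n powr (- q)\<close> and
  \<open>(ln n)^2 * n powr (c * \<gamma> - q)\<close>; both vanish once \<gamma> is small, whatever
  \<open>K\<close> is.\<close>

lemma truncated_sum_concentration:
  assumes \<delta>: "\<delta> > 0" and K: "K \<ge> 0"
  obtains \<gamma>0 where "\<gamma>0 > 0"
    "\<And>\<gamma>. 0 < \<gamma> \<Longrightarrow> \<gamma> \<le> \<gamma>0 \<Longrightarrow> \<forall>\<^sub>F n in sequentially. \<forall>J\<subseteq>{1..n}.
       prob {\<omega>\<in>space M. \<delta> * real n \<le> \<bar>\<Sum>j\<in>J. truncate (\<gamma> * real n) (Y j \<omega>)\<bar>} \<le> real n powr (- K)"
proof -
  \<comment> \<open>Midpoint between 1 and the least of 2, \<alpha> and \<beta>.\<close>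
  define p where "p = (1 + min 2 (min \<alpha> \<beta>)) / 2"
  have p: "1 < p" "p < 2" "p < \<alpha>" "p < \<beta>" using alpha beta by (auto simp: p_def min_def)
  define m where "m = expectation (\<lambda>\<omega>. \<bar>Y 1 \<omega>\<bar> powr p)"
  have m0: "m \<ge> 0" unfolding m_def by (rule Bochner_Integration.integral_nonneg) auto
  define c where "c = (K + 1) / \<delta>"
  define q where "q = p - 1"
  have c: "c > 0" and q: "q > 0" using \<delta> K p by (auto simp: c_def q_def)
  show ?thesis
  proof (rule that[of "q / (2 * c)"])
    show "q / (2 * c) > 0" using c q by auto
    fix \<gamma> assume \<gamma>: "0 < \<gamma>" "\<gamma> \<le> q / (2 * c)"
    \<comment> \<open>This bound is the origin of \<gamma>0: the exponential factor may use up at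
      most half of the decay \<open>n powr (- q)\<close>.\<close>
    have c\<gamma>: "c * \<gamma> \<le> q / 2" using \<gamma> c by (simp add: field_simps)
    define A where "A = c * \<gamma> powr (1 - p) * m"
    define B where "B = c\<^sup>2 * \<gamma> powr (2 - p) * m"
    define s where "s = (\<lambda>n. A * (ln (real n) * real n powr (- q)) + B * (ln (real n) * real n powr (- (q / 4)))\<^sup>2)"
    have "s \<longlonglongrightarrow> A * 0 + B * 0\<^sup>2"
      unfolding s_def using q by (intro tendsto_add tendsto_mult_left tendsto_power ln_powr_tendsto_0) auto
    hence "s \<longlonglongrightarrow> 0" by simp
    hence "\<forall>\<^sub>F n in sequentially. s n < 1" by (rule order_tendstoD) simp
    thus "\<forall>\<^sub>F n in sequentially. \<forall>J\<subseteq>{1..n}.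
       prob {\<omega>\<in>space M. \<delta> * real n \<le> \<bar>\<Sum>j\<in>J. truncate (\<gamma> * real n) (Y j \<omega>)\<bar>} \<le> real n powr (- K)"
      \<comment> \<open>From 6 on, \<open>n\<close> absorbs the factor \<open>2 * exp 1\<close> left
        by the two tails and the error exponent 1.\<close>
      using eventually_ge_at_top[of 6]
    proof eventually_elim
      fix n :: nat assume sn: "s n < 1" and n: "n \<ge> 6"
      define \<theta> where "\<theta> = c * ln (real n) / real n"
      have lnn: "ln (real n) > 0" using n by simp
      have \<theta>: "\<theta> > 0" using c lnn n by (auto simp: \<theta>_def)
      define b where "b = \<gamma> * real n"
      have b: "b > 0" using \<gamma> n by (auto simp: b_def)
      define \<kappa> where "\<kappa> = \<theta> * b powr (1 - p) * m + \<theta>\<^sup>2 * b powr (2 - p) * m * exp (\<theta> * b)"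
      have "real n * (\<theta> * b powr (1 - p) * m) = A * (ln (real n) * real n powr (- q))"
        using n \<gamma> by (simp add: \<theta>_def b_def powr_mult A_def q_def field_simps)
      moreover have "real n * (\<theta>\<^sup>2 * b powr (2 - p) * m * exp (\<theta> * b))
          \<le> B * (ln (real n) * real n powr (- (q / 4)))\<^sup>2"
      proof -
        have "exp (\<theta> * b) = real n powr (c * \<gamma>)"
          using n by (simp add: \<theta>_def b_def powr_def mult_ac)
        also have "\<dots> \<le> real n powr (q / 2)" using c\<gamma> n by (intro powr_mono) auto
        finally have e: "exp (\<theta> * b) \<le> real n powr (q / 2)" .
        have "real n * \<theta>\<^sup>2 = c\<^sup>2 * (ln (real n))\<^sup>2 * real n powr (- 1)"
          using n by (simp add: \<theta>_def power2_eq_square powr_minus field_simps)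
        have "real n * (\<theta>\<^sup>2 * b powr (2 - p) * m * exp (\<theta> * b))
            = (real n * \<theta>\<^sup>2) * (\<gamma> powr (2 - p) * real n powr (2 - p)) * m * exp (\<theta> * b)"
          using n \<gamma> by (simp add: b_def powr_mult)
        also note \<open>real n * \<theta>\<^sup>2 = c\<^sup>2 * (ln (real n))\<^sup>2 * real n powr (- 1)\<close>
        also have "c\<^sup>2 * (ln (real n))\<^sup>2 * real n powr (- 1) * (\<gamma> powr (2 - p) * real n powr (2 - p)) * m * exp (\<theta> * b)
            = B * (ln (real n))\<^sup>2 * (real n powr (- 1) * real n powr (2 - p)) * exp (\<theta> * b)"
          by (simp only: B_def mult_ac)
        also have "real n powr (- 1) * real n powr (2 - p) = real n powr (- q)"
          by (subst powr_add[symmetric]) (simp add: q_def)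
        also have "B * (ln (real n))\<^sup>2 * real n powr (- q) * exp (\<theta> * b)
            \<le> B * (ln (real n))\<^sup>2 * real n powr (- q) * real n powr (q / 2)"
          using e m0 by (intro mult_left_mono) (auto simp: B_def)
        also have "\<dots> = B * (ln (real n))\<^sup>2 * (real n powr (- q) * real n powr (q / 2))" by (simp add: mult_ac)
        also have "real n powr (- q) * real n powr (q / 2) = (real n powr (- (q / 4)))\<^sup>2"
          by (simp add: powr_add[symmetric] power2_eq_square)
        finally show ?thesis by (simp add: power_mult_distrib mult_ac)
      qed
      ultimately have "real n * \<kappa> \<le> s n" by (simp add: \<kappa>_def s_def distrib_left)
      hence \<kappa>: "real n * \<kappa> \<le> 1" using sn by simp
      have \<theta>\<delta>: "\<theta> * (\<delta> * real n) = (K + 1) * ln (real n)"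
        using n \<delta> by (simp add: \<theta>_def c_def field_simps)
      show "\<forall>J\<subseteq>{1..n}. prob {\<omega>\<in>space M. \<delta> * real n \<le> \<bar>\<Sum>j\<in>J. truncate (\<gamma> * real n) (Y j \<omega>)\<bar>} \<le> real n powr (- K)"
      proof (intro allI impI)
        fix J assume J: "J \<subseteq> {1..n}"
        let ?S = "\<lambda>\<omega>. \<Sum>j\<in>J. truncate b (Y j \<omega>)"
        let ?E = "\<lambda>\<theta>. {\<omega>\<in>space M. (K + 1) * ln (real n) \<le> \<theta> * ?S \<omega>}"
        have [measurable]: "?S \<in> borel_measurable M" using J by (intro measurable_truncated_sum) auto
        have "{\<omega>\<in>space M. \<delta> * real n \<le> \<bar>?S \<omega>\<bar>} \<subseteq> ?E \<theta> \<union> ?E (- \<theta>)"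
        proof
          fix \<omega> assume \<omega>: "\<omega> \<in> {\<omega>\<in>space M. \<delta> * real n \<le> \<bar>?S \<omega>\<bar>}"
          hence "\<theta> * (\<delta> * real n) \<le> \<theta> * \<bar>?S \<omega>\<bar>" using \<theta> by (intro mult_left_mono) auto
          thus "\<omega> \<in> ?E \<theta> \<union> ?E (- \<theta>)" using \<omega> \<theta>\<delta> by (auto simp: abs_if split: if_splits)
        qed
        hence "prob {\<omega>\<in>space M. \<delta> * real n \<le> \<bar>?S \<omega>\<bar>} \<le> prob (?E \<theta> \<union> ?E (- \<theta>))"
          by (rule finite_measure_mono) measurable
        also have "\<dots> \<le> prob (?E \<theta>) + prob (?E (- \<theta>))" by (rule measure_Un_le) measurable
        also have "\<dots> \<le> exp (real n * \<kappa> - (K + 1) * ln (real n)) + exp (real n * \<kappa> - (K + 1) * ln (real n))"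
          using chernoff_truncate[OF p b J m_def, of "(K + 1) * ln (real n)" \<theta>]
            chernoff_truncate[OF p b J m_def, of "(K + 1) * ln (real n)" "- \<theta>"] \<theta>
          unfolding \<kappa>_def by (intro add_mono) auto
        also have "\<dots> \<le> 2 * exp (1 - (K + 1) * ln (real n))" using \<kappa> by simp
        also have "\<dots> = 2 * exp 1 / real n * real n powr (- K)"
          using n by (simp add: powr_def exp_diff exp_minus exp_add distrib_right field_simps)
        also have "2 * exp 1 / real n \<le> 1"
        proof -
          have "exp 1 \<le> (3::real)" using exp_le by simp
          thus ?thesis using n by (simp add: field_simps)
        qed
        hence "2 * exp 1 / real n * real n powr (- K) \<le> 1 * real n powr (- K)"
          by (intro mult_right_mono) auto
        finally show "prob {\<omega>\<in>space M. \<delta> * real n \<le> \<bar>\<Sum>j\<in>J. truncate (\<gamma> * real n) (Y j \<omega>)\<bar>} \<le> real n powr (- K)"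
          by (simp add: b_def)
      qed
    qed
  qed
qed

text \<open>Union bound over the \<open>n + 1\<close> partial sums, paid for by two extra powers of
  \<open>n\<close>. The set \<open>S\<close> of deleted positions is empty for the estimate of
  \<open>A - B\<close>; for the lower bound it holds the positions of the big increments, and
  uniformity in \<open>S\<close> is then essential.\<close>

lemma truncated_walk_concentration:
  assumes \<delta>: "\<delta> > 0" and K: "K \<ge> 0"
  obtains \<gamma>0 where "\<gamma>0 > 0"
    "\<And>\<gamma>. 0 < \<gamma> \<Longrightarrow> \<gamma> \<le> \<gamma>0 \<Longrightarrow> \<forall>\<^sub>F n in sequentially. \<forall>S.
       prob {\<omega>\<in>space M. \<exists>k\<le>n. \<delta> * real n \<le> \<bar>\<Sum>j\<in>{1..k} - S. truncate (\<gamma> * real n) (Y j \<omega>)\<bar>} \<le> real n powr (- K)"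
proof -
  obtain \<gamma>0 where \<gamma>0: "\<gamma>0 > 0"
    "\<And>\<gamma>. 0 < \<gamma> \<Longrightarrow> \<gamma> \<le> \<gamma>0 \<Longrightarrow> \<forall>\<^sub>F n in sequentially. \<forall>J\<subseteq>{1..n}.
       prob {\<omega>\<in>space M. \<delta> * real n \<le> \<bar>\<Sum>j\<in>J. truncate (\<gamma> * real n) (Y j \<omega>)\<bar>} \<le> real n powr (- (K + 2))"
    using truncated_sum_concentration[OF \<delta>, of "K + 2"] K by auto
  show ?thesis
  proof (rule that[OF \<gamma>0(1)])
    fix \<gamma> assume "0 < \<gamma>" "\<gamma> \<le> \<gamma>0"
    from \<gamma>0(2)[OF this] eventually_ge_at_top[of 2]
    show "\<forall>\<^sub>F n in sequentially. \<forall>S.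
       prob {\<omega>\<in>space M. \<exists>k\<le>n. \<delta> * real n \<le> \<bar>\<Sum>j\<in>{1..k} - S. truncate (\<gamma> * real n) (Y j \<omega>)\<bar>} \<le> real n powr (- K)"
    proof eventually_elim
      case (elim n)
      show ?case
      proof
        fix S
        let ?E = "\<lambda>k. {\<omega>\<in>space M. \<delta> * real n \<le> \<bar>\<Sum>j\<in>{1..k} - S. truncate (\<gamma> * real n) (Y j \<omega>)\<bar>}"
        have [measurable]: "(\<lambda>\<omega>. \<Sum>j\<in>{1..k} - S. truncate (\<gamma> * real n) (Y j \<omega>)) \<in> borel_measurable M" for k
          by (rule measurable_truncated_sum) auto
        have "{\<omega>\<in>space M. \<exists>k\<le>n. \<delta> * real n \<le> \<bar>\<Sum>j\<in>{1..k} - S. truncate (\<gamma> * real n) (Y j \<omega>)\<bar>} = (\<Union>k\<in>{..n}. ?E k)"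
          by auto
        also have "prob \<dots> \<le> (\<Sum>k\<in>{..n}. prob (?E k))"
          by (rule measure_UNION_le) auto
        also have "\<dots> \<le> (\<Sum>k\<in>{..n}. real n powr (- (K + 2)))"
        proof (rule sum_mono)
          fix k assume "k \<in> {..n}"
          hence "{1..k} - S \<subseteq> {1..n}" by auto
          thus "prob (?E k) \<le> real n powr (- (K + 2))" using elim(1) by blast
        qed
        also have "\<dots> = (real n + 1) * real n powr (- (K + 2))" by simp
        also have "\<dots> \<le> (real n powr 2) * real n powr (- (K + 2))"
        proof (rule mult_right_mono)
          have "2 * real n \<le> real n * real n" using elim(2) by (intro mult_right_mono) auto
          moreover have "real n + 1 \<le> 2 * real n" using elim(2) by simp
          ultimately have "real n + 1 \<le> (real n)\<^sup>2" unfolding power2_eq_square by linarith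
          thus "real n + 1 \<le> real n powr 2" by simp
        qed auto
        also have "\<dots> = real n powr (- K)" by (subst powr_add[symmetric]) simp
        finally show "prob {\<omega>\<in>space M. \<exists>k\<le>n. \<delta> * real n \<le> \<bar>\<Sum>j\<in>{1..k} - S. truncate (\<gamma> * real n) (Y j \<omega>)\<bar>} \<le> real n powr (- K)" .
      qed
    qed
  qed
qed

end


section \<open>The probability of many big jumps\<close>

context heavy_walk
begin

text \<open>The bases are the expected numbers, among \<open>n\<close> increments, of those beyond
  \<open>n\<close> in the respective direction. Up to constants this is the probability that the
  walk has the given numbers of increments of order \<open>n\<close>.\<close>

definition rate :: "nat \<Rightarrow> nat \<times> nat \<Rightarrow> real" where
  "rate n = (\<lambda>(lm, lp). (real n * tail_down (real n)) ^ lm * (real n * tail_up (real n)) ^ lp)"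

lemma rate_nonneg: "0 \<le> rate n l"
  by (cases l) (auto simp: rate_def tail_nonneg)

lemma prob_box:
  assumes "S \<subseteq> {1..}" "finite S" "\<And>k. k \<in> S \<Longrightarrow> A k \<in> sets borel"
  shows "prob {\<omega>\<in>space M. \<forall>k\<in>S. Y k \<omega> \<in> A k} = (\<Prod>k\<in>S. prob {\<omega>\<in>space M. Y 1 \<omega> \<in> A k})"
proof (cases "S = {}")
  case False
  have "{\<omega>\<in>space M. \<forall>k\<in>S. Y k \<omega> \<in> A k} = (\<Inter>k\<in>S. Y k -` A k \<inter> space M)" using False by auto
  also have "prob \<dots> = (\<Prod>k\<in>S. prob (Y k -` A k \<inter> space M))"
    using assms False by (intro indep_varsD[OF indep]) auto
  also have "\<dots> = (\<Prod>k\<in>S. prob {\<omega>\<in>space M. Y 1 \<omega> \<in> A k})"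
  proof (rule prod.cong[OF refl])
    fix k assume k: "k \<in> S"
    have "Y k -` A k \<inter> space M = {\<omega>\<in>space M. Y k \<omega> \<in> A k}" by auto
    thus "prob (Y k -` A k \<inter> space M) = prob {\<omega>\<in>space M. Y 1 \<omega> \<in> A k}"
      using prob_Y[of k "A k"] assms k by auto
  qed
  finally show ?thesis .
qed (simp add: prob_space)

definition jump_count_event :: "nat \<Rightarrow> real \<Rightarrow> nat \<times> nat \<Rightarrow> 'a set" where
  "jump_count_event n c = (\<lambda>(lm, lp). {\<omega>\<in>space M.
     lm \<le> card {k\<in>{1..n}. Y k \<omega> < - c} \<and> lp \<le> card {k\<in>{1..n}. Y k \<omega> > c}})"

definition jump_sets :: "nat \<Rightarrow> nat \<times> nat \<Rightarrow> (nat set \<times> nat set) set" where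
  "jump_sets n = (\<lambda>(lm, lp). {(S, T). S \<subseteq> {1..n} \<and> card S = lm \<and> T \<subseteq> {1..n} \<and> card T = lp \<and> S \<inter> T = {}})"

text \<open>Turns a counting event into a finite union of boxes, which yields both measurability and
  the union bound. Nonnegative \<open>c\<close> makes the two position sets disjoint, so that
  independence applies to each box.\<close>

lemma jump_count_event_eq:
  assumes "c \<ge> 0"
  shows "jump_count_event n c l = (\<Union>(S, T)\<in>jump_sets n l.
    {\<omega>\<in>space M. \<forall>k\<in>S \<union> T. Y k \<omega> \<in> (if k \<in> S then {..<- c} else {c<..})})"
proof (intro equalityI subsetI)
  fix \<omega> assume \<omega>: "\<omega> \<in> jump_count_event n c l"
  let ?S = "{k\<in>{1..n}. Y k \<omega> < - c}" and ?T = "{k\<in>{1..n}. Y k \<omega> > c}"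
  have le: "fst l \<le> card ?S" "snd l \<le> card ?T" and sp: "\<omega> \<in> space M"
    using \<omega> by (auto simp: jump_count_event_def split: prod.splits)
  obtain S where S: "S \<subseteq> ?S" "card S = fst l" using obtain_subset_with_card_n[OF le(1)] by metis
  obtain T where T: "T \<subseteq> ?T" "card T = snd l" using obtain_subset_with_card_n[OF le(2)] by metis
  have "S \<inter> T = {}" using S(1) T(1) assms by force
  hence "(S, T) \<in> jump_sets n l" using S T by (auto simp: jump_sets_def split: prod.splits)
  moreover have "\<omega> \<in> {\<omega>\<in>space M. \<forall>k\<in>S \<union> T. Y k \<omega> \<in> (if k \<in> S then {..<- c} else {c<..})}"
    using S(1) T(1) sp by auto
  ultimately show "\<omega> \<in> (\<Union>(S, T)\<in>jump_sets n l.
    {\<omega>\<in>space M. \<forall>k\<in>S \<union> T. Y k \<omega> \<in> (if k \<in> S then {..<- c} else {c<..})})" by blast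
next
  fix \<omega> assume "\<omega> \<in> (\<Union>(S, T)\<in>jump_sets n l.
    {\<omega>\<in>space M. \<forall>k\<in>S \<union> T. Y k \<omega> \<in> (if k \<in> S then {..<- c} else {c<..})})"
  then obtain S T where ST: "(S, T) \<in> jump_sets n l" and sp: "\<omega> \<in> space M"
    and \<omega>: "\<forall>k\<in>S \<union> T. Y k \<omega> \<in> (if k \<in> S then {..<- c} else {c<..})" by auto
  have dis: "S \<inter> T = {}" "S \<subseteq> {1..n}" "T \<subseteq> {1..n}" "card S = fst l" "card T = snd l"
    using ST by (auto simp: jump_sets_def split: prod.splits)
  have "S \<subseteq> {k\<in>{1..n}. Y k \<omega> < - c}" "T \<subseteq> {k\<in>{1..n}. Y k \<omega> > c}"
  proof -
    show "S \<subseteq> {k\<in>{1..n}. Y k \<omega> < - c}"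
    proof
      fix k assume k: "k \<in> S"
      have "Y k \<omega> < - c" using bspec[OF \<omega>, of k] k by simp
      thus "k \<in> {k\<in>{1..n}. Y k \<omega> < - c}" using subsetD[OF dis(2) k] by simp
    qed
    show "T \<subseteq> {k\<in>{1..n}. Y k \<omega> > c}"
    proof
      fix k assume k: "k \<in> T"
      hence "k \<notin> S" using dis(1) by auto
      hence "Y k \<omega> > c" using bspec[OF \<omega>, of k] k by simp
      thus "k \<in> {k\<in>{1..n}. Y k \<omega> > c}" using subsetD[OF dis(3) k] by simp
    qed
  qed
  hence "card S \<le> card {k\<in>{1..n}. Y k \<omega> < - c}" "card T \<le> card {k\<in>{1..n}. Y k \<omega> > c}"
    by (simp_all add: card_mono)
  thus "\<omega> \<in> jump_count_event n c l" using sp dis by (auto simp: jump_count_event_def split: prod.splits)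
qed

lemma finite_jump_sets: "finite (jump_sets n l)"
  by (rule finite_subset[of _ "Pow {1..n} \<times> Pow {1..n}"]) (auto simp: jump_sets_def split: prod.splits)

lemma sets_box:
  assumes "S \<subseteq> {1..n}" "T \<subseteq> {1..n}"
  shows "{\<omega>\<in>space M. \<forall>k\<in>S \<union> T. Y k \<omega> \<in> (if k \<in> S then {..<- c} else {c<..})} \<in> events"
proof (rule sets.sets_Collect_finite_All)
  show "finite (S \<union> T)" using assms finite_subset by blast
  fix k assume "k \<in> S \<union> T"
  hence "1 \<le> k" using assms by auto
  have "Y k -` (if k \<in> S then {..<- c} else {c<..}) \<inter> space M \<in> events"
    by (rule measurable_sets[OF measurable_Y[OF \<open>1 \<le> k\<close>]]) auto
  moreover have "Y k -` (if k \<in> S then {..<- c} else {c<..}) \<inter> space M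
      = {\<omega>\<in>space M. Y k \<omega> \<in> (if k \<in> S then {..<- c} else {c<..})}" by auto
  ultimately show "{\<omega>\<in>space M. Y k \<omega> \<in> (if k \<in> S then {..<- c} else {c<..})} \<in> events" by simp
qed

lemma sets_jump_count_event:
  assumes "c \<ge> 0"
  shows "jump_count_event n c l \<in> events"
  unfolding jump_count_event_eq[OF assms]
proof (rule sets.finite_UN[OF finite_jump_sets])
  fix ST assume "ST \<in> jump_sets n l"
  then obtain S T where ST: "ST = (S, T)" "S \<subseteq> {1..n}" "T \<subseteq> {1..n}"
    by (auto simp: jump_sets_def split: prod.splits)
  show "(case ST of (S, T) \<Rightarrow> {\<omega>\<in>space M. \<forall>k\<in>S \<union> T. Y k \<omega> \<in> (if k \<in> S then {..<- c} else {c<..})}) \<in> events"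
    using sets_box[OF ST(2,3)] unfolding ST(1) prod.case .
qed

text \<open>Union bound over the positions: there are at most \<open>n ^ lm * n ^ lp\<close>
  choices, and each box has product probability.\<close>

lemma prob_jump_count_event_le:
  assumes c: "c \<ge> 0"
  shows "prob (jump_count_event n c (lm, lp)) \<le> (real n * tail_down c) ^ lm * (real n * tail_up c) ^ lp"
proof -
  let ?F = "\<lambda>S T. {\<omega>\<in>space M. \<forall>k\<in>S \<union> T. Y k \<omega> \<in> (if k \<in> S then {..<- c} else {c<..})}"
  have one: "prob (?F S T) \<le> tail_down c ^ lm * tail_up c ^ lp" if "(S, T) \<in> jump_sets n (lm, lp)" for S T
  proof -
    have ST: "S \<inter> T = {}" "S \<subseteq> {1..n}" "T \<subseteq> {1..n}" "card S = lm" "card T = lp"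
      using that by (auto simp: jump_sets_def)
    have fin: "finite S" "finite T" using ST finite_subset by blast+
    have "prob (?F S T) = (\<Prod>k\<in>S \<union> T. prob {\<omega>\<in>space M. Y 1 \<omega> \<in> (if k \<in> S then {..<- c} else {c<..})})"
      using ST fin by (intro prob_box) auto
    also have "\<dots> = (\<Prod>k\<in>S. prob {\<omega>\<in>space M. Y 1 \<omega> \<in> (if k \<in> S then {..<- c} else {c<..})})
        * (\<Prod>k\<in>T. prob {\<omega>\<in>space M. Y 1 \<omega> \<in> (if k \<in> S then {..<- c} else {c<..})})"
      using ST fin by (intro prod.union_disjoint) auto
    also have "\<dots> \<le> (\<Prod>k\<in>S. tail_down c) * (\<Prod>k\<in>T. tail_up c)"
    proof (intro mult_mono prod_mono conjI prod_nonneg tail_nonneg)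
      fix k assume "k \<in> S"
      thus "prob {\<omega>\<in>space M. Y 1 \<omega> \<in> (if k \<in> S then {..<- c} else {c<..})} \<le> tail_down c"
        unfolding tail_down_def by (intro finite_measure_mono) auto
    next
      fix k assume "k \<in> T"
      hence "k \<notin> S" using ST by auto
      thus "prob {\<omega>\<in>space M. Y 1 \<omega> \<in> (if k \<in> S then {..<- c} else {c<..})} \<le> tail_up c"
        unfolding tail_up_def by (intro finite_measure_mono) auto
    qed auto
    finally show ?thesis using ST by simp
  qed
  have choose: "real (n choose r) \<le> real n ^ r" for r
  proof (cases "r \<le> n")
    case True
    thus ?thesis using binomial_le_pow[of r n] by (metis of_nat_le_iff of_nat_power)
  qed (simp add: binomial_eq_0)
  have "card (jump_sets n (lm, lp)) \<le> card ({S. S \<subseteq> {1..n} \<and> card S = lm} \<times> {T. T \<subseteq> {1..n} \<and> card T = lp})"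
    by (rule card_mono) (auto simp: jump_sets_def)
  also have "\<dots> = (n choose lm) * (n choose lp)"
    by (simp add: card_cartesian_product n_subsets)
  finally have "real (card (jump_sets n (lm, lp))) \<le> real (n choose lm) * real (n choose lp)"
    by (metis of_nat_le_iff of_nat_mult)
  also have "\<dots> \<le> real n ^ lm * real n ^ lp" by (intro mult_mono choose) auto
  finally have card: "real (card (jump_sets n (lm, lp))) \<le> real n ^ lm * real n ^ lp" .
  have "prob (jump_count_event n c (lm, lp)) \<le> (\<Sum>ST\<in>jump_sets n (lm, lp). prob (case ST of (S, T) \<Rightarrow> ?F S T))"
    unfolding jump_count_event_eq[OF c]
  proof (rule measure_UNION_le[OF finite_jump_sets])
    fix ST assume "ST \<in> jump_sets n (lm, lp)"
    then obtain S T where ST: "ST = (S, T)" "S \<subseteq> {1..n}" "T \<subseteq> {1..n}"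
      by (auto simp: jump_sets_def)
    show "(case ST of (S, T) \<Rightarrow> ?F S T) \<in> events"
      using sets_box[OF ST(2,3)] unfolding ST(1) prod.case .
  qed
  also have "\<dots> \<le> (\<Sum>ST\<in>jump_sets n (lm, lp). tail_down c ^ lm * tail_up c ^ lp)"
  proof (rule sum_mono)
    fix ST assume ST: "ST \<in> jump_sets n (lm, lp)"
    obtain S T where "ST = (S, T)" by (cases ST)
    thus "prob (case ST of (S, T) \<Rightarrow> ?F S T) \<le> tail_down c ^ lm * tail_up c ^ lp"
      using one[of S T] ST by (simp only: prod.case)
  qed
  also have "\<dots> = real (card (jump_sets n (lm, lp))) * (tail_down c ^ lm * tail_up c ^ lp)" by simp
  also have "\<dots> \<le> (real n ^ lm * real n ^ lp) * (tail_down c ^ lm * tail_up c ^ lp)"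
    using card by (intro mult_right_mono) (auto simp: tail_nonneg)
  finally show ?thesis by (simp add: power_mult_distrib mult_ac)
qed

lemma walk_in_B_jumps_iff:
  assumes "n > 0" "g > 0" "\<omega> \<in> space M"
  shows "scaled_walk Y n \<omega> \<in> B_jumps g g lm lp \<longleftrightarrow> \<omega> \<in> jump_count_event n (g * real n) (lm, lp)"
  using assms by (simp add: B_jumps_def card_jumps_scaled_walk jump_count_event_def)

lemma walk_event_B_set:
  assumes "n > 0" "g > 0"
  shows "walk_event M Y n (B_set \<alpha> \<beta> ls g g) = (\<Union>l\<in>J_set \<alpha> \<beta> ls. jump_count_event n (g * real n) l)"
proof -
  have "walk_event M Y n (B_set \<alpha> \<beta> ls g g) = (\<Union>(lm, lp)\<in>J_set \<alpha> \<beta> ls. {\<omega>\<in>space M. scaled_walk Y n \<omega> \<in> B_jumps g g lm lp})"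
    by (auto simp: walk_event_def B_set_def)
  also have "\<dots> = (\<Union>(lm, lp)\<in>J_set \<alpha> \<beta> ls. jump_count_event n (g * real n) (lm, lp))"
  proof (intro SUP_cong refl, clarify)
    fix lm lp
    have "jump_count_event n (g * real n) (lm, lp) \<subseteq> space M" by (auto simp: jump_count_event_def)
    thus "{\<omega>\<in>space M. scaled_walk Y n \<omega> \<in> B_jumps g g lm lp} = jump_count_event n (g * real n) (lm, lp)"
      using walk_in_B_jumps_iff[OF assms] by blast
  qed
  finally show ?thesis by simp
qed

lemma sets_walk_event_B_set:
  assumes "n > 0" "g > 0"
  shows "walk_event M Y n (B_set \<alpha> \<beta> ls g g) \<in> events"
  unfolding walk_event_B_set[OF assms]
  using assms by (intro sets.finite_UN finite_J_set alpha beta sets_jump_count_event) auto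

lemma sets_walk_event:
  assumes "A \<in> sets borel"
  shows "walk_event M Y n A \<in> events"
proof -
  have "scaled_walk Y n -` A \<inter> space M \<in> events"
    by (rule measurable_sets[OF measurable_scaled_walk assms]) (rule measurable_Y)
  moreover have "scaled_walk Y n -` A \<inter> space M = walk_event M Y n A" by (auto simp: walk_event_def)
  ultimately show ?thesis by simp
qed

text \<open>Each factor is about \<open>n powr (1 - \<alpha>)\<close> or
  \<open>n powr (1 - \<beta>)\<close>, which is where \<open>jump_cost\<close> comes from; the
  slowly varying part costs an exponent \<eta> per jump.\<close>

lemma rate_lower:
  assumes \<eta>: "\<eta> > 0"
  obtains c where "c > 0"
    "\<forall>\<^sub>F n in sequentially. c * real n powr (- (jump_cost \<alpha> \<beta> l + \<eta> * real (fst l + snd l))) \<le> rate n l"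
proof -
  obtain lm lp where l: "l = (lm, lp)" by (cases l)
  have ab: "0 < \<alpha>" "\<alpha> < \<alpha> + \<eta>" "0 < \<beta>" "\<beta> < \<beta> + \<eta>"
    using alpha beta \<eta> by auto
  have pwk: "(c * real n powr a) ^ k = c ^ k * real n powr (a * real k)" if "n \<ge> 1" for n k :: nat and a c
    using that by (simp add: power_mult_distrib powr_power mult.commute)
  obtain c1 X1 where 1: "c1 > 0" "X1 \<ge> 1" "\<And>x. x \<ge> X1 \<Longrightarrow> c1 * x powr (- (\<alpha> + \<eta>)) \<le> tail_down x"
    using regularly_varying_lower[OF rv_tail_down tail_down_antimono ab(1,2)] by blast
  obtain c2 X2 where 2: "c2 > 0" "X2 \<ge> 1" "\<And>x. x \<ge> X2 \<Longrightarrow> c2 * x powr (- (\<beta> + \<eta>)) \<le> tail_up x"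
    using regularly_varying_lower[OF rv_tail_up tail_up_antimono ab(3,4)] by blast
  have pw: "real n * (c * real n powr (- (a + \<eta>))) = c * real n powr (- (a - 1 + \<eta>))" if "n \<ge> 1" for n c a
  proof -
    have "real n * real n powr (- (a + \<eta>)) = real n powr (1 + - (a + \<eta>))"
      using that by (subst powr_add) simp
    also have "1 + - (a + \<eta>) = - (a - 1 + \<eta>)" by simp
    finally show ?thesis by (simp add: mult.left_commute)
  qed
  show ?thesis
  proof (rule that[of "c1 ^ lm * c2 ^ lp"])
    show "c1 ^ lm * c2 ^ lp > 0" using 1 2 by simp
    have "\<forall>\<^sub>F n in sequentially. n \<ge> 1 \<and> real n \<ge> X1 \<and> real n \<ge> X2"
      using filterlim_real_sequentially eventually_ge_at_top[of 1]
      by (auto simp: filterlim_at_top eventually_conj_iff)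
    thus "\<forall>\<^sub>F n in sequentially. c1 ^ lm * c2 ^ lp * real n powr (- (jump_cost \<alpha> \<beta> l + \<eta> * real (fst l + snd l))) \<le> rate n l"
    proof eventually_elim
      case (elim n)
      hence n1: "n \<ge> 1" by simp
      have "c1 * real n powr (- (\<alpha> - 1 + \<eta>)) \<le> real n * tail_down (real n)"
        unfolding pw[OF n1, symmetric] by (intro mult_left_mono 1(3)) (use elim in auto)
      moreover have "c2 * real n powr (- (\<beta> - 1 + \<eta>)) \<le> real n * tail_up (real n)"
        unfolding pw[OF n1, symmetric] by (intro mult_left_mono 2(3)) (use elim in auto)
      ultimately have "(c1 * real n powr (- (\<alpha> - 1 + \<eta>))) ^ lm * (c2 * real n powr (- (\<beta> - 1 + \<eta>))) ^ lp \<le> rate n l"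
        using 1(1) 2(1) unfolding rate_def l prod.case
        by (intro mult_mono[OF power_mono power_mono]) (auto simp: tail_nonneg)
      also have "(c1 * real n powr (- (\<alpha> - 1 + \<eta>))) ^ lm * (c2 * real n powr (- (\<beta> - 1 + \<eta>))) ^ lp
          = c1 ^ lm * c2 ^ lp * (real n powr (- (\<alpha> - 1 + \<eta>) * real lm) * real n powr (- (\<beta> - 1 + \<eta>) * real lp))"
        using elim by (simp only: pwk mult_ac)
      also have "real n powr (- (\<alpha> - 1 + \<eta>) * real lm) * real n powr (- (\<beta> - 1 + \<eta>) * real lp)
          = real n powr (- (jump_cost \<alpha> \<beta> l + \<eta> * real (fst l + snd l)))"
        unfolding powr_add[symmetric] by (simp add: l jump_cost_def algebra_simps)
      finally show ?case .
    qed
  qed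
qed

lemma rate_upper:
  assumes \<eta>: "0 < \<eta>" "\<eta> < 1"
  obtains C where "C > 0"
    "\<forall>\<^sub>F n in sequentially. rate n l \<le> C * real n powr (- (jump_cost \<alpha> \<beta> l - \<eta> * real (fst l + snd l)))"
proof -
  obtain lm lp where l: "l = (lm, lp)" by (cases l)
  \<comment> \<open>The restriction \<open>\<eta> < 1\<close> keeps both reduced exponents positive,
    as the upper tail bound requires.\<close>
  have ab: "0 < \<alpha> - \<eta>" "\<alpha> - \<eta> < \<alpha>" "0 < \<beta> - \<eta>" "\<beta> - \<eta> < \<beta>"
    using alpha beta \<eta> by auto
  have pwk: "(c * real n powr a) ^ k = c ^ k * real n powr (a * real k)" if "n \<ge> 1" for n k :: nat and a c
    using that by (simp add: power_mult_distrib powr_power mult.commute)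
  obtain c1 X1 where 1: "c1 > 0" "X1 \<ge> 1" "\<And>x. x \<ge> X1 \<Longrightarrow> tail_down x \<le> c1 * x powr (- (\<alpha> - \<eta>))"
    using regularly_varying_upper[OF rv_tail_down tail_down_antimono ab(1,2)] by blast
  obtain c2 X2 where 2: "c2 > 0" "X2 \<ge> 1" "\<And>x. x \<ge> X2 \<Longrightarrow> tail_up x \<le> c2 * x powr (- (\<beta> - \<eta>))"
    using regularly_varying_upper[OF rv_tail_up tail_up_antimono ab(3,4)] by blast
  have pw: "real n * (c * real n powr (- (a - \<eta>))) = c * real n powr (- (a - 1 - \<eta>))" if "n \<ge> 1" for n c a
  proof -
    have "real n * real n powr (- (a - \<eta>)) = real n powr (1 + - (a - \<eta>))"
      using that by (subst powr_add) simp
    also have "1 + - (a - \<eta>) = - (a - 1 - \<eta>)" by simp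
    finally show ?thesis by (simp add: mult.left_commute)
  qed
  show ?thesis
  proof (rule that[of "c1 ^ lm * c2 ^ lp"])
    show "c1 ^ lm * c2 ^ lp > 0" using 1 2 by simp
    have "\<forall>\<^sub>F n in sequentially. n \<ge> 1 \<and> real n \<ge> X1 \<and> real n \<ge> X2"
      using filterlim_real_sequentially eventually_ge_at_top[of 1]
      by (auto simp: filterlim_at_top eventually_conj_iff)
    thus "\<forall>\<^sub>F n in sequentially. rate n l \<le> c1 ^ lm * c2 ^ lp * real n powr (- (jump_cost \<alpha> \<beta> l - \<eta> * real (fst l + snd l)))"
    proof eventually_elim
      case (elim n)
      hence n1: "n \<ge> 1" by simp
      have "real n * tail_down (real n) \<le> c1 * real n powr (- (\<alpha> - 1 - \<eta>))"
        unfolding pw[OF n1, symmetric] by (intro mult_left_mono 1(3)) (use elim in auto)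
      moreover have "real n * tail_up (real n) \<le> c2 * real n powr (- (\<beta> - 1 - \<eta>))"
        unfolding pw[OF n1, symmetric] by (intro mult_left_mono 2(3)) (use elim in auto)
      ultimately have "rate n l \<le> (c1 * real n powr (- (\<alpha> - 1 - \<eta>))) ^ lm * (c2 * real n powr (- (\<beta> - 1 - \<eta>))) ^ lp"
        using 1(1) 2(1) unfolding rate_def l prod.case
        by (intro mult_mono[OF power_mono power_mono]) (auto simp: tail_nonneg)
      also have "(c1 * real n powr (- (\<alpha> - 1 - \<eta>))) ^ lm * (c2 * real n powr (- (\<beta> - 1 - \<eta>))) ^ lp
          = c1 ^ lm * c2 ^ lp * (real n powr (- (\<alpha> - 1 - \<eta>) * real lm) * real n powr (- (\<beta> - 1 - \<eta>) * real lp))"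
        using elim by (simp only: pwk mult_ac)
      also have "real n powr (- (\<alpha> - 1 - \<eta>) * real lm) * real n powr (- (\<beta> - 1 - \<eta>) * real lp)
          = real n powr (- (jump_cost \<alpha> \<beta> l - \<eta> * real (fst l + snd l)))"
        unfolding powr_add[symmetric] by (simp add: l jump_cost_def algebra_simps)
      finally show ?case .
    qed
  qed
qed

lemma rate_dominated:
  assumes "jump_cost \<alpha> \<beta> l < jump_cost \<alpha> \<beta> l'"
  obtains C where "C > 0" "\<forall>\<^sub>F n in sequentially. rate n l' \<le> C * rate n l"
proof -
  define d where "d = jump_cost \<alpha> \<beta> l' - jump_cost \<alpha> \<beta> l"
  define s where "s = real (fst l + snd l) + real (fst l' + snd l') + 1"
  \<comment> \<open>The gap \<open>d\<close> in cost has to pay \<eta> for every jump of both pairs.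
    The extra 1 in \<open>s\<close> avoids division by zero, and 1/2 ensures
    \<open>\<eta> < 1\<close>.\<close>
  define \<eta> where "\<eta> = min (1 / 2) (d / s)"
  have d: "d > 0" and s: "s > 0" using assms by (auto simp: d_def s_def)
  have \<eta>: "0 < \<eta>" "\<eta> < 1" using d s by (auto simp: \<eta>_def)
  have "\<eta> * s \<le> (d / s) * s" using s by (intro mult_right_mono) (auto simp: \<eta>_def)
  hence "\<eta> * s \<le> d" using s by simp
  hence "\<eta> * (real (fst l + snd l) + real (fst l' + snd l')) \<le> d"
    using \<eta> by (simp add: s_def distrib_left)
  hence exps: "- (jump_cost \<alpha> \<beta> l' - \<eta> * real (fst l' + snd l')) \<le> - (jump_cost \<alpha> \<beta> l + \<eta> * real (fst l + snd l))"
    by (simp add: d_def distrib_left)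
  obtain c where c: "c > 0"
    "\<forall>\<^sub>F n in sequentially. c * real n powr (- (jump_cost \<alpha> \<beta> l + \<eta> * real (fst l + snd l))) \<le> rate n l"
    using rate_lower[OF \<eta>(1)] by blast
  obtain C where C: "C > 0"
    "\<forall>\<^sub>F n in sequentially. rate n l' \<le> C * real n powr (- (jump_cost \<alpha> \<beta> l' - \<eta> * real (fst l' + snd l')))"
    using rate_upper[OF \<eta>] by blast
  show ?thesis
  proof (rule that[of "C / c"])
    show "C / c > 0" using c C by auto
    show "\<forall>\<^sub>F n in sequentially. rate n l' \<le> C / c * rate n l"
      using c(2) C(2) eventually_ge_at_top[of 1]
    proof eventually_elim
      case (elim n)
      have "rate n l' \<le> C * real n powr (- (jump_cost \<alpha> \<beta> l' - \<eta> * real (fst l' + snd l')))" by (rule elim)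
      also have "\<dots> \<le> C * real n powr (- (jump_cost \<alpha> \<beta> l + \<eta> * real (fst l + snd l)))"
        using C elim exps by (intro mult_left_mono powr_mono) auto
      also have "\<dots> = C / c * (c * real n powr (- (jump_cost \<alpha> \<beta> l + \<eta> * real (fst l + snd l))))"
        using c by simp
      also have "\<dots> \<le> C / c * rate n l" using elim c C by (intro mult_left_mono) auto
      finally show ?case .
    qed
  qed
qed

lemma prob_jump_count_event_rate:
  assumes g: "g > 0"
  obtains C where "C > 0" "\<forall>\<^sub>F n in sequentially. prob (jump_count_event n (g * real n) l) \<le> C * rate n l"
proof -
  obtain lm lp where l: "l = (lm, lp)" by (cases l)
  obtain C1 where 1: "C1 > 0" "\<forall>\<^sub>F n in sequentially. tail_down (g * real n) \<le> C1 * tail_down (real n)"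
    using regularly_varying_scale[OF rv_tail_down g] by auto
  obtain C2 where 2: "C2 > 0" "\<forall>\<^sub>F n in sequentially. tail_up (g * real n) \<le> C2 * tail_up (real n)"
    using regularly_varying_scale[OF rv_tail_up g] by auto
  show ?thesis
  proof (rule that[of "C1 ^ lm * C2 ^ lp"])
    show "C1 ^ lm * C2 ^ lp > 0" using 1 2 by simp
    show "\<forall>\<^sub>F n in sequentially. prob (jump_count_event n (g * real n) l) \<le> C1 ^ lm * C2 ^ lp * rate n l"
      using 1(2) 2(2)
    proof eventually_elim
      case (elim n)
      have "prob (jump_count_event n (g * real n) l)
          \<le> (real n * tail_down (g * real n)) ^ lm * (real n * tail_up (g * real n)) ^ lp"
        unfolding l using g by (intro prob_jump_count_event_le) auto
      also have "\<dots> \<le> (real n * (C1 * tail_down (real n))) ^ lm * (real n * (C2 * tail_up (real n))) ^ lp"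
        using elim 1(1) 2(1) by (intro mult_mono[OF power_mono[OF mult_left_mono] power_mono[OF mult_left_mono]]) (auto simp: tail_nonneg)
      also have "\<dots> = C1 ^ lm * C2 ^ lp * rate n l" by (simp add: l rate_def power_mult_distrib mult_ac)
      finally show ?case .
    qed
  qed
qed

lemma prob_walk_event_B_set_rate:
  assumes g: "g > 0"
  obtains C where "C > 0"
    "\<forall>\<^sub>F n in sequentially. prob (walk_event M Y n (B_set \<alpha> \<beta> ls g g)) \<le> C * rate n ls"
proof -
  let ?J = "J_set \<alpha> \<beta> ls"
  have finJ: "finite ?J" by (rule finite_J_set[OF alpha beta])
  have "\<exists>C>0. \<forall>\<^sub>F n in sequentially. prob (jump_count_event n (g * real n) l) \<le> C * rate n ls" if l: "l \<in> ?J" for l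
  proof -
    obtain C where C: "C > 0" "\<forall>\<^sub>F n in sequentially. prob (jump_count_event n (g * real n) l) \<le> C * rate n l"
      using prob_jump_count_event_rate[OF g] by blast
    show ?thesis
    proof (cases "l = ls")
      case False
      \<comment> \<open>Strict because \<open>I_less\<close> also contains the pairs of equal cost
        other than \<open>ls\<close>.\<close>
      hence "jump_cost \<alpha> \<beta> ls < jump_cost \<alpha> \<beta> l" using l by (auto simp: J_set_def I_less_def)
      then obtain D where D: "D > 0" "\<forall>\<^sub>F n in sequentially. rate n l \<le> D * rate n ls"
        using rate_dominated by blast
      have "\<forall>\<^sub>F n in sequentially. prob (jump_count_event n (g * real n) l) \<le> (C * D) * rate n ls"
        using C(2) D(2)
      proof eventually_elim
        case (elim n)
        have "C * rate n l \<le> C * (D * rate n ls)" using elim C by (intro mult_left_mono) auto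
        thus ?case using elim by (simp add: mult.assoc)
      qed
      thus ?thesis using C D by (intro exI[of _ "C * D"]) auto
    qed (use C in auto)
  qed
  then obtain C where C: "\<And>l. l \<in> ?J \<Longrightarrow> C l > 0"
    "\<And>l. l \<in> ?J \<Longrightarrow> \<forall>\<^sub>F n in sequentially. prob (jump_count_event n (g * real n) l) \<le> C l * rate n ls"
    by metis
  have "\<forall>\<^sub>F n in sequentially. \<forall>l\<in>?J. prob (jump_count_event n (g * real n) l) \<le> C l * rate n ls"
    using C(2) by (simp add: eventually_ball_finite_distrib[OF finJ])
  hence "\<forall>\<^sub>F n in sequentially. prob (walk_event M Y n (B_set \<alpha> \<beta> ls g g)) \<le> (1 + (\<Sum>l\<in>?J. C l)) * rate n ls"
    using eventually_gt_at_top[of 0]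
  proof eventually_elim
    case (elim n)
    have "prob (walk_event M Y n (B_set \<alpha> \<beta> ls g g)) \<le> (\<Sum>l\<in>?J. prob (jump_count_event n (g * real n) l))"
      unfolding walk_event_B_set[OF elim(2) g] using g
      by (intro measure_UNION_le finJ sets_jump_count_event) auto
    also have "\<dots> \<le> (\<Sum>l\<in>?J. C l * rate n ls)" using elim(1) by (intro sum_mono) auto
    also have "\<dots> \<le> (1 + (\<Sum>l\<in>?J. C l)) * rate n ls"
      using rate_nonneg[of n ls] by (simp add: sum_distrib_right[symmetric] distrib_right)
    finally show ?case .
  qed
  moreover have "1 + (\<Sum>l\<in>?J. C l) > 0" using C(1) by (intro add_pos_nonneg sum_nonneg) (auto intro: less_imp_le)
  ultimately show ?thesis by (rule that[rotated])
qed

end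


section \<open>The probability of the target event without the required jumps\<close>

text \<open>Separates the jumps at chosen positions from a remainder that is again a partial sum. It
  serves both directions: \<open>Z\<close> consists of the big increments of a given outcome, or of
  prescribed positions in the lower bound.\<close>

lemma path_scaled_walk_split:
  assumes n: "n > 0" and Z: "Z \<subseteq> {1..n}" and s: "0 \<le> s" "s \<le> 1"
  obtains m where "m \<le> n" "path_of (scaled_walk Y n \<omega>) s
    = (\<Sum>k\<in>Z. if real k / real n \<le> s then Y k \<omega> / real n else 0) + (\<Sum>k\<in>{1..m} - Z. Y k \<omega>) / real n"
proof
  define m where "m = nat \<lfloor>real n * s\<rfloor>"
  have "real n * s \<le> real n" using s by (simp add: mult_left_le)
  thus "m \<le> n" unfolding m_def using floor_mono[of "real n * s" "real n"] by auto
  \<comment> \<open>Setting the chosen increments to 0 turns the remainder into another rescaled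
    walk, whose value is a known partial sum.\<close>
  define Y' where "Y' = (\<lambda>k \<omega>. if k \<in> Z then 0 else Y k \<omega>)"
  have "path_of (scaled_walk Y n \<omega>) s = (\<Sum>k\<in>{1..n}. if real k / real n \<le> s then Y k \<omega> / real n else 0)"
    unfolding scaled_walk_eq_step_path[OF n] path_step_path[OF s] ..
  also have "\<dots> = (\<Sum>k\<in>{1..n} - Z. if real k / real n \<le> s then Y k \<omega> / real n else 0)
      + (\<Sum>k\<in>Z. if real k / real n \<le> s then Y k \<omega> / real n else 0)"
    using Z by (intro sum.subset_diff) auto
  also have "(\<Sum>k\<in>{1..n} - Z. if real k / real n \<le> s then Y k \<omega> / real n else 0)
      = (\<Sum>k\<in>{1..n}. if real k / real n \<le> s then Y' k \<omega> / real n else 0)"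
    by (rule sum.mono_neutral_cong_left) (auto simp: Y'_def)
  also have "\<dots> = path_of (scaled_walk Y' n \<omega>) s"
    unfolding scaled_walk_eq_step_path[OF n] path_step_path[OF s] ..
  also have "\<dots> = (\<Sum>k=1..m. Y' k \<omega>) / real n"
    unfolding path_scaled_walk[OF s] random_walk_def m_def ..
  also have "(\<Sum>k=1..m. Y' k \<omega>) = (\<Sum>k\<in>{1..m} - Z. Y k \<omega>)"
    by (rule sum.mono_neutral_cong_right) (auto simp: Y'_def)
  finally show "path_of (scaled_walk Y n \<omega>) s
    = (\<Sum>k\<in>Z. if real k / real n \<le> s then Y k \<omega> / real n else 0) + (\<Sum>k\<in>{1..m} - Z. Y k \<omega>) / real n"
    by simp
qed

text \<open>On \<open>B\<close> the density of the sampling measure is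
  \<open>w + (1 - w) / P(B)\<close>, the reciprocal of the estimator on \<open>A \<inter> B\<close>.
  One of the two factors in the square therefore cancels, and the other is at most
  \<open>P(B) / (1 - w)\<close>. Off \<open>B\<close> the density is \<open>w\<close> and the
  estimator on \<open>A\<close> is \<open>1 / w\<close>.\<close>

lemma IS_second_moment_le:
  assumes "prob_space M" "A \<in> sets M" "B \<in> sets M" "0 < w" "w < 1"
  shows "(\<integral>\<omega>. (IS_estimator M A B w \<omega>)\<^sup>2 \<partial>Q_measure M B w)
    \<le> measure M B * measure M (A \<inter> B) / (1 - w) + measure M (A - B) / w"
proof -
  interpret prob_space M by fact
  have [measurable]: "A \<in> sets M" "B \<in> sets M" by fact+
  define b where "b = prob B"
  define a where "a = 1 / (w + (1 - w) / b)"
  have b0: "0 \<le> b" by (simp add: b_def)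
  let ?Q = "Q_measure M B w"
  have sets: "sets ?Q = sets M" and space: "space ?Q = space M" by (simp_all add: Q_measure_def)
  have Q: "emeasure ?Q E = ennreal (w * prob E + (1 - w) * (prob (B \<inter> E) / b))" if "E \<in> sets M" for E
  proof -
    define q where "q = prob (B \<inter> E) / b"
    have q0: "0 \<le> q" using b0 by (simp add: q_def)
    have u: "emeasure (uniform_measure M B) E = ennreal (prob (B \<inter> E) / b)"
    proof (cases "b = 0")
      case True
      \<comment> \<open>If \<open>B\<close> has probability 0, the conditional measure is the null
        measure, in agreement with real division by zero.\<close>
      hence "prob (B \<inter> E) = 0"
        using finite_measure_mono[of "B \<inter> E" B] by (simp add: b_def order_antisym)
      thus ?thesis using that True by (simp add: emeasure_eq_measure)
    next
      case False
      hence "b > 0" using b0 by linarith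
      thus ?thesis using that by (simp add: emeasure_eq_measure divide_ennreal b_def)
    qed
    have "emeasure ?Q E = ennreal w * ennreal (prob E) + ennreal (1 - w) * ennreal q"
      unfolding Q_measure_def
      by (subst emeasure_mixture) (use that u in \<open>simp_all only: sets_uniform_measure emeasure_eq_measure q_def\<close>)
    also have "\<dots> = ennreal (w * prob E + (1 - w) * q)"
      using assms q0 by (simp add: ennreal_mult)
    finally show ?thesis by (simp only: q_def)
  qed
  have mQ: "measure ?Q E = w * prob E + (1 - w) * (prob (B \<inter> E) / b)" if "E \<in> sets M" for E
    by (rule measure_eq_emeasure_eq_ennreal[OF _ Q[OF that]])
      (use assms b0 in \<open>intro add_nonneg_nonneg mult_nonneg_nonneg divide_nonneg_nonneg measure_nonneg, auto\<close>)
  have fin: "emeasure ?Q E < \<infinity>" if "E \<in> sets M" for E using Q[OF that] by simp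
  have Z: "(IS_estimator M A B w \<omega>)\<^sup>2 = a\<^sup>2 * indicator (A \<inter> B) \<omega> + (1 / w)\<^sup>2 * indicator (A - B) \<omega>" for \<omega>
    by (auto simp: IS_estimator_def a_def b_def split: split_indicator)
  have int: "integrable ?Q (\<lambda>\<omega>. c * indicator E \<omega> :: real)" if "E \<in> sets M" for E c
    using that fin[OF that] by (intro integrable_mult_right integrable_real_indicator) (auto simp: sets)
  have "(\<integral>\<omega>. (IS_estimator M A B w \<omega>)\<^sup>2 \<partial>?Q)
      = (\<integral>\<omega>. a\<^sup>2 * indicator (A \<inter> B) \<omega> \<partial>?Q) + (\<integral>\<omega>. (1 / w)\<^sup>2 * indicator (A - B) \<omega> \<partial>?Q)"
    unfolding Z by (intro Bochner_Integration.integral_add int) auto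
  also have "(\<integral>\<omega>. a\<^sup>2 * indicator (A \<inter> B) \<omega> \<partial>?Q) = a\<^sup>2 * measure ?Q (A \<inter> B)"
    using assms sets.sets_into_space[of "A \<inter> B" M] by (simp add: space Int_absorb2 Int_absorb1)
  also have "(\<integral>\<omega>. (1 / w)\<^sup>2 * indicator (A - B) \<omega> \<partial>?Q) = (1 / w)\<^sup>2 * measure ?Q (A - B)"
    using assms sets.sets_into_space[of "A - B" M] by (simp add: space Int_absorb2 Int_absorb1)
  also have "(1 / w)\<^sup>2 * measure ?Q (A - B) = prob (A - B) / w"
  proof -
    have "B \<inter> (A - B) = {}" by auto
    thus ?thesis using assms by (subst mQ) (auto simp: power2_eq_square)
  qed
  also have "a\<^sup>2 * measure ?Q (A \<inter> B) \<le> b * prob (A \<inter> B) / (1 - w)"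
  proof (cases "b = 0")
    case True
    hence "prob (A \<inter> B) = 0"
      using finite_measure_mono[of "A \<inter> B" B] by (simp add: b_def order_antisym)
    thus ?thesis using True by (subst mQ) auto
  next
    case False
    hence b: "b > 0" using b0 by auto
    have d: "w + (1 - w) / b > 0" using assms b by (intro add_pos_nonneg) auto
    have "B \<inter> (A \<inter> B) = A \<inter> B" by auto
    hence "measure ?Q (A \<inter> B) = (w + (1 - w) / b) * prob (A \<inter> B)"
      by (subst mQ) (auto simp: algebra_simps)
    hence "a\<^sup>2 * measure ?Q (A \<inter> B) = a * prob (A \<inter> B)"
      using d by (simp add: a_def power2_eq_square)
    also have "a \<le> 1 / ((1 - w) / b)"
      unfolding a_def using assms b d by (intro divide_left_mono mult_pos_pos) auto
    hence "a * prob (A \<inter> B) \<le> 1 / ((1 - w) / b) * prob (A \<inter> B)" by (intro mult_right_mono) auto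
    also have "\<dots> = b * prob (A \<inter> B) / (1 - w)" by simp
    finally show ?thesis .
  qed
  finally show ?thesis by (simp add: b_def)
qed

context heavy_walk
begin

text \<open>The skeleton \<open>x\<close> of big increments jumps at the same times as the walk, so
  no time change is involved: the difference of the paths is a truncated partial sum divided by
  \<open>n\<close>. If all of these stayed below \<open>\<delta> / 2\<close>, the skeleton, a member
  of \<open>D_less\<close>, would be too close to \<open>A\<close>.\<close>

lemma few_big_jumps_imp_truncated_walk_large:
  assumes n: "n > 0" and g: "g > 0" and \<delta>: "\<delta> > 0"
    and away: "\<And>x y. x \<in> A \<Longrightarrow> y \<in> D_less \<alpha> \<beta> ls \<Longrightarrow> \<delta> \<le> dist x y"
    and \<omega>: "\<omega> \<in> walk_event M Y n A - walk_event M Y n (B_set \<alpha> \<beta> ls g g)"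
  shows "\<exists>k\<le>n. \<delta> / 2 * real n \<le> \<bar>\<Sum>j\<in>{1..k}. truncate (g * real n) (Y j \<omega>)\<bar>"
proof (rule ccontr)
  assume small: "\<not> ?thesis"
  let ?Nm = "{k\<in>{1..n}. Y k \<omega> < - (g * real n)}" and ?Np = "{k\<in>{1..n}. Y k \<omega> > g * real n}"
  let ?c = "g * real n"
  have sp: "\<omega> \<in> space M" using \<omega> by (auto simp: walk_event_def)
  have I: "(card ?Nm, card ?Np) \<in> I_less \<alpha> \<beta> ls"
  proof (rule ccontr)
    assume "(card ?Nm, card ?Np) \<notin> I_less \<alpha> \<beta> ls"
    then obtain lm lp where "(lm, lp) \<in> J_set \<alpha> \<beta> ls" "lm \<le> card ?Nm" "lp \<le> card ?Np"
      using J_set_below by fastforce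
    hence "\<omega> \<in> walk_event M Y n (B_set \<alpha> \<beta> ls g g)"
      unfolding walk_event_B_set[OF n g] using sp by (auto simp: jump_count_event_def)
    thus False using \<omega> by auto
  qed
  define Z where "Z = {k\<in>{1..n}. \<bar>Y k \<omega>\<bar> > ?c}"
  define x where "x = step_path Z (\<lambda>k. real k / real n) (\<lambda>k. Y k \<omega> / real n)"
  have c: "?c > 0" using n g by simp
  have "{k\<in>Z. Y k \<omega> / real n < 0} = ?Nm" "{k\<in>Z. Y k \<omega> / real n > 0} = ?Np"
  proof -
    have "Y k \<omega> / real n < 0 \<longleftrightarrow> Y k \<omega> < 0" "Y k \<omega> / real n > 0 \<longleftrightarrow> Y k \<omega> > 0" for k
      using n by (auto simp: field_simps)
    thus "{k\<in>Z. Y k \<omega> / real n < 0} = ?Nm" "{k\<in>Z. Y k \<omega> / real n > 0} = ?Np"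
      using c unfolding Z_def by auto
  qed
  moreover have "x \<in> D_jumps (card {k\<in>Z. Y k \<omega> / real n < 0}) (card {k\<in>Z. Y k \<omega> / real n > 0})"
    unfolding x_def
  proof (rule step_path_in_D_jumps)
    show "finite Z" by (simp add: Z_def)
    show "inj_on (\<lambda>k. real k / real n) Z"
      by (rule inj_on_subset[OF walk_times(1)[OF n]]) (auto simp: Z_def)
    fix k assume "k \<in> Z"
    thus "0 < real k / real n \<and> real k / real n \<le> 1" by (intro walk_times(2)[OF n]) (auto simp: Z_def)
  qed
  ultimately have "x \<in> D_less \<alpha> \<beta> ls" using I by (auto simp: D_less_def)
  moreover have "scaled_walk Y n \<omega> \<in> A" using \<omega> by (auto simp: walk_event_def)
  ultimately have "\<delta> \<le> dist (scaled_walk Y n \<omega>) x" by (rule away[rotated])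
  also have "\<dots> \<le> \<delta> / 2"
  proof (rule dist_cadlag_le)
    fix s :: real assume s: "0 \<le> s" "s \<le> 1"
    let ?t = "\<lambda>k \<omega>. truncate ?c (Y k \<omega>)"
    have "Z \<subseteq> {1..n}" by (auto simp: Z_def)
    obtain k where k: "k \<le> n" "path_of (scaled_walk Y n \<omega>) s
        = (\<Sum>k\<in>Z. if real k / real n \<le> s then Y k \<omega> / real n else 0) + (\<Sum>k\<in>{1..k} - Z. Y k \<omega>) / real n"
      using path_scaled_walk_split[OF n \<open>Z \<subseteq> {1..n}\<close> s, of Y \<omega>] by blast
    have "(\<Sum>k\<in>{1..k} - Z. Y k \<omega>) = (\<Sum>j=1..k. ?t j \<omega>)"
      using k(1) by (intro sum.mono_neutral_cong_left) (auto simp: Z_def truncate_def)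
    hence "\<bar>path_of (scaled_walk Y n \<omega>) s - path_of x s\<bar> = \<bar>\<Sum>j=1..k. ?t j \<omega>\<bar> / real n"
      unfolding k(2) x_def path_step_path[OF s] by simp
    also have "\<bar>\<Sum>j=1..k. ?t j \<omega>\<bar> < \<delta> / 2 * real n" using small k(1) by (meson not_le)
    hence "\<bar>\<Sum>j=1..k. ?t j \<omega>\<bar> / real n \<le> \<delta> / 2" using n by (simp add: divide_le_eq)
    finally show "\<bar>path_of (scaled_walk Y n \<omega>) s - path_of x s\<bar> \<le> \<delta> / 2" .
  qed
  finally show False using \<delta> by simp
qed

lemma prob_few_big_jumps:
  assumes A: "A \<in> sets borel" and away: "bounded_away A (D_less \<alpha> \<beta> ls)"
  obtains g where "g > 0" "\<forall>\<^sub>F n in sequentially.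
    prob (walk_event M Y n A - walk_event M Y n (B_set \<alpha> \<beta> ls g g)) \<le> real n powr (- K)"
proof -
  obtain \<delta> where \<delta>: "\<delta> > 0" "\<And>x y. x \<in> A \<Longrightarrow> y \<in> D_less \<alpha> \<beta> ls \<Longrightarrow> \<delta> \<le> dist x y"
    using bounded_away_dist[OF away] by blast
  \<comment> \<open>\<open>K\<close> may be negative here, whereas the concentration bound takes a
    nonnegative exponent.\<close>
  obtain g where g: "g > 0"
    "\<And>\<gamma>. 0 < \<gamma> \<Longrightarrow> \<gamma> \<le> g \<Longrightarrow> \<forall>\<^sub>F n in sequentially. \<forall>S.
       prob {\<omega>\<in>space M. \<exists>k\<le>n. \<delta> / 2 * real n \<le> \<bar>\<Sum>j\<in>{1..k} - S. truncate (\<gamma> * real n) (Y j \<omega>)\<bar>}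
         \<le> real n powr (- max 0 K)"
    using truncated_walk_concentration[of "\<delta> / 2" "max 0 K"] \<delta>(1) by auto
  show ?thesis
  proof (rule that[OF g(1)])
    show "\<forall>\<^sub>F n in sequentially.
      prob (walk_event M Y n A - walk_event M Y n (B_set \<alpha> \<beta> ls g g)) \<le> real n powr (- K)"
      using g(2)[OF g(1) order_refl] eventually_ge_at_top[of 1]
    proof eventually_elim
      case (elim n)
      let ?E = "{\<omega>\<in>space M. \<exists>k\<le>n. \<delta> / 2 * real n \<le> \<bar>\<Sum>j\<in>{1..k} - {}. truncate (g * real n) (Y j \<omega>)\<bar>}"
      have n: "n > 0" using elim by simp
      have [measurable]: "(\<lambda>\<omega>. \<Sum>j\<in>{1..k} - {}. truncate (g * real n) (Y j \<omega>)) \<in> borel_measurable M" for k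
        by (rule measurable_truncated_sum) auto
      have "walk_event M Y n A - walk_event M Y n (B_set \<alpha> \<beta> ls g g) \<subseteq> ?E"
      proof
        fix \<omega> assume \<omega>: "\<omega> \<in> walk_event M Y n A - walk_event M Y n (B_set \<alpha> \<beta> ls g g)"
        hence "\<omega> \<in> space M" by (auto simp: walk_event_def)
        thus "\<omega> \<in> ?E" using few_big_jumps_imp_truncated_walk_large[OF n g(1) \<delta> \<omega>] by simp
      qed
      moreover have "?E \<in> events" by measurable
      ultimately have "prob (walk_event M Y n A - walk_event M Y n (B_set \<alpha> \<beta> ls g g)) \<le> prob ?E"
        by (rule finite_measure_mono)
      also have "\<dots> \<le> real n powr (- max 0 K)" using elim(1) by blast
      also have "\<dots> \<le> real n powr (- K)" using elim by (intro powr_mono) auto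
      finally show ?case .
    qed
  qed
qed

end


section \<open>The lower bound\<close>

text \<open>The time change carries each \<open>T i\<close> to the time of the big increment
  \<open>\<kappa> i\<close>, so both paths switch on their jumps simultaneously. The errors in the
  jump sizes and the quiet remainder contribute \<open>r / 4\<close> each, and the time change stays
  within \<open>r / 4\<close>; hence distance at most \<open>r / 2\<close>.\<close>

lemma dist_scaled_walk_step_path_less:
  assumes n: "n > 0" and I: "finite I" and \<kappa>: "\<kappa> ` I \<subseteq> {1..n}" "inj_on \<kappa> I"
    and T: "\<And>i. i \<in> I \<Longrightarrow> 0 < T i \<and> T i < 1"
    and \<tau>: "\<tau> \<in> time_changes" "\<And>t. \<bar>\<tau> t - t\<bar> \<le> r / 4" "\<And>i. i \<in> I \<Longrightarrow> \<tau> (T i) = real (\<kappa> i) / real n"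
    and big: "\<And>i. i \<in> I \<Longrightarrow> \<bar>Y (\<kappa> i) \<omega> / real n - z i\<bar> \<le> \<zeta>" "real (card I) * \<zeta> \<le> r / 4"
    and rest: "\<And>m. m \<le> n \<Longrightarrow> \<bar>\<Sum>j\<in>{1..m} - \<kappa> ` I. Y j \<omega>\<bar> < r / 4 * real n"
    and r: "r > 0"
  shows "dist (scaled_walk Y n \<omega>) (step_path I T z) < r"
proof -
  have "\<bar>path_of (scaled_walk Y n \<omega>) (\<tau> t) - path_of (step_path I T z) t\<bar> \<le> r / 2"
    if t: "0 \<le> t" "t \<le> 1" for t
  proof -
    have s: "0 \<le> \<tau> t" "\<tau> t \<le> 1" using time_change_range[OF \<tau>(1) t] by auto
    obtain m where m: "m \<le> n" "path_of (scaled_walk Y n \<omega>) (\<tau> t)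
        = (\<Sum>k\<in>\<kappa> ` I. if real k / real n \<le> \<tau> t then Y k \<omega> / real n else 0)
          + (\<Sum>k\<in>{1..m} - \<kappa> ` I. Y k \<omega>) / real n"
      using path_scaled_walk_split[OF n \<kappa>(1) s, of Y \<omega>] by blast
    have mono: "strict_mono_on {0..1} \<tau>" using \<tau>(1) by (simp add: time_changes_def)
    have iff: "real (\<kappa> i) / real n \<le> \<tau> t \<longleftrightarrow> T i \<le> t" if i: "i \<in> I" for i
      using strict_mono_on_less_eq[OF mono, of "T i" t] T[OF i] t \<tau>(3)[OF i] by auto
    have "(\<Sum>k\<in>\<kappa> ` I. if real k / real n \<le> \<tau> t then Y k \<omega> / real n else 0)
        = (\<Sum>i\<in>I. if T i \<le> t then Y (\<kappa> i) \<omega> / real n else 0)"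
      unfolding sum.reindex[OF \<kappa>(2)] o_def using iff by (intro sum.cong) auto
    hence "path_of (scaled_walk Y n \<omega>) (\<tau> t) - path_of (step_path I T z) t
        = (\<Sum>i\<in>I. (if T i \<le> t then Y (\<kappa> i) \<omega> / real n else 0) - (if T i \<le> t then z i else 0))
          + (\<Sum>k\<in>{1..m} - \<kappa> ` I. Y k \<omega>) / real n"
      unfolding m(2) path_step_path[OF t] sum_subtractf by simp
    moreover have "\<bar>\<Sum>i\<in>I. (if T i \<le> t then Y (\<kappa> i) \<omega> / real n else 0) - (if T i \<le> t then z i else 0)\<bar> \<le> (\<Sum>i\<in>I. \<zeta>)"
    proof (rule sum_norm_le[where 'a=real, unfolded real_norm_def])
      fix i assume i: "i \<in> I"
      show "\<bar>(if T i \<le> t then Y (\<kappa> i) \<omega> / real n else 0) - (if T i \<le> t then z i else 0)\<bar> \<le> \<zeta>"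
        using big(1)[OF i] by auto
    qed
    moreover have "\<bar>(\<Sum>k\<in>{1..m} - \<kappa> ` I. Y k \<omega>) / real n\<bar> \<le> r / 4"
      using rest[OF m(1)] n by (simp add: divide_le_eq)
    ultimately show ?thesis using big(2) unfolding sum_constant by linarith
  qed
  moreover have "\<bar>\<tau> t - t\<bar> \<le> r / 2" for t using \<tau>(2)[of t] r by simp
  ultimately show ?thesis
    unfolding dist_cadlag_def skorokhod_dist_less_iff using r \<tau>(1)
    by (intro bexI[of _ \<tau>] exI[of _ "r / 2"]) auto
qed

text \<open>Provides the factor \<open>n\<close> per jump in \<open>rate\<close>. The window has
  length \<open>2 * \<rho> * n\<close> before rounding, and rounding loses at most 2, which is at
  most \<open>\<rho> * n\<close>.\<close>

lemma card_window_ge: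
  fixes t \<rho> :: real
  assumes "\<rho> > 0" "\<rho> < t" "t < 1 - \<rho>" and n: "real n * \<rho> \<ge> 2"
  shows "\<rho> * real n \<le> real (card {k\<in>{1..n}. \<bar>real k / real n - t\<bar> \<le> \<rho>})"
proof -
  have n0: "n > 0" using n assms by (cases "n = 0") auto
  define a where "a = nat \<lceil>real n * (t - \<rho>)\<rceil>"
  define b where "b = nat \<lfloor>real n * (t + \<rho>)\<rfloor>"
  have p: "real n * (t - \<rho>) > 0" "real n * (t + \<rho>) > 0" "real n * (t + \<rho>) < real n"
    using assms n0 by (auto simp: mult_less_cancel_left1)
  have a: "real n * (t - \<rho>) \<le> real a" "real a < real n * (t - \<rho>) + 1"
    using p unfolding a_def by linarith+
  have b: "real b \<le> real n * (t + \<rho>)" "real n * (t + \<rho>) < real b + 1"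
    using p unfolding b_def by linarith+
  have "{a..b} \<subseteq> {k\<in>{1..n}. \<bar>real k / real n - t\<bar> \<le> \<rho>}"
  proof
    fix k assume k: "k \<in> {a..b}"
    have ak: "real a \<le> real k" "real k \<le> real b" using k by auto
    have "real k > 0" "real k < real n" using ak a b p by linarith+
    moreover have "real n * (t - \<rho>) \<le> real k" "real k \<le> real n * (t + \<rho>)" using ak a b by linarith+
    hence "t - \<rho> \<le> real k / real n" "real k / real n \<le> t + \<rho>"
      using n0 by (simp_all add: field_simps)
    ultimately show "k \<in> {k\<in>{1..n}. \<bar>real k / real n - t\<bar> \<le> \<rho>}" by (auto simp: abs_le_iff)
  qed
  hence "card {a..b} \<le> card {k\<in>{1..n}. \<bar>real k / real n - t\<bar> \<le> \<rho>}" by (intro card_mono) auto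
  moreover have "real b - real a \<ge> 2 * (real n * \<rho>) - 2"
    using a b by (simp add: algebra_simps)
  hence "\<rho> * real n \<le> real (card {a..b})" using n by (simp add: of_nat_diff mult.commute)
  ultimately show ?thesis by linarith
qed

context heavy_walk
begin

section \<open>Increments of prescribed size and a quiet remainder\<close>

definition near_interval :: "nat \<Rightarrow> real \<Rightarrow> real \<Rightarrow> real set" where
  "near_interval n \<zeta> z = {y. \<bar>y / real n - z\<bar> \<le> \<zeta>}"

lemma sets_near_interval [measurable]: "near_interval n \<zeta> z \<in> sets borel"
  unfolding near_interval_def by measurable

text \<open>With \<open>\<zeta> < \<bar>z\<bar>\<close> the interval stays on one side of 0, so its
  probability is at least a difference of two values of a single tail.\<close>

lemma prob_near_interval_ge:
  assumes \<zeta>: "0 < \<zeta>" "\<zeta> < \<bar>z\<bar>"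
  obtains c where "c > 0" "\<forall>\<^sub>F n in sequentially.
    c * (if z < 0 then tail_down (real n) else tail_up (real n)) \<le> prob {\<omega>\<in>space M. Y 1 \<omega> \<in> near_interval n \<zeta> z}"
proof (cases "z < 0")
  case True
  obtain c where c: "c > 0" "\<forall>\<^sub>F n in sequentially.
      c * tail_down (real n) \<le> tail_down ((- z - \<zeta>) * real n) - tail_down ((- z + \<zeta>) * real n)"
    using regularly_varying_window[OF rv_tail_down, of "- z - \<zeta>" "- z + \<zeta>"] alpha \<zeta> True by auto
  have "\<forall>\<^sub>F n in sequentially. c * tail_down (real n) \<le> prob {\<omega>\<in>space M. Y 1 \<omega> \<in> near_interval n \<zeta> z}"
    using c(2) eventually_gt_at_top[of 0]
  proof eventually_elim
    case (elim n)
    let ?s = "(- z - \<zeta>) * real n" and ?t = "(- z + \<zeta>) * real n"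
    have st: "?s \<le> ?t" using \<zeta> by (intro mult_right_mono) auto
    note elim(1)
    also have "tail_down ?s - tail_down ?t = prob ({\<omega>\<in>space M. Y 1 \<omega> \<le> - ?s} - {\<omega>\<in>space M. Y 1 \<omega> \<le> - ?t})"
      unfolding tail_down_def using st by (subst finite_measure_Diff) auto
    also have "\<dots> \<le> prob {\<omega>\<in>space M. Y 1 \<omega> \<in> near_interval n \<zeta> z}"
      using elim(2) by (intro finite_measure_mono) (auto simp: near_interval_def abs_le_iff field_simps)
    finally show ?case .
  qed
  thus ?thesis using c True by (intro that[of c]) auto
next
  case False
  obtain c where c: "c > 0" "\<forall>\<^sub>F n in sequentially.
      c * tail_up (real n) \<le> tail_up ((z - \<zeta>) * real n) - tail_up ((z + \<zeta>) * real n)"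
    using regularly_varying_window[OF rv_tail_up, of "z - \<zeta>" "z + \<zeta>"] beta \<zeta> False by auto
  have "\<forall>\<^sub>F n in sequentially. c * tail_up (real n) \<le> prob {\<omega>\<in>space M. Y 1 \<omega> \<in> near_interval n \<zeta> z}"
    using c(2) eventually_gt_at_top[of 0]
  proof eventually_elim
    case (elim n)
    let ?s = "(z - \<zeta>) * real n" and ?t = "(z + \<zeta>) * real n"
    have st: "?s \<le> ?t" using \<zeta> by (intro mult_right_mono) auto
    note elim(1)
    also have "tail_up ?s - tail_up ?t = prob ({\<omega>\<in>space M. Y 1 \<omega> \<ge> ?s} - {\<omega>\<in>space M. Y 1 \<omega> \<ge> ?t})"
      unfolding tail_up_def using st by (subst finite_measure_Diff) auto
    also have "\<dots> \<le> prob {\<omega>\<in>space M. Y 1 \<omega> \<in> near_interval n \<zeta> z}"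
      using elim(2) by (intro finite_measure_mono) (auto simp: near_interval_def abs_le_iff field_simps)
    finally show ?case .
  qed
  thus ?thesis using c False by (intro that[of c]) auto
qed

text \<open>The first condition makes the truncation in the second invisible, so the actual partial
  sums are small; concentration is only available for truncated ones. It also makes the positions of
  the big increments recoverable from the outcome.\<close>

definition quiet_event :: "nat \<Rightarrow> real \<Rightarrow> real \<Rightarrow> nat set \<Rightarrow> 'a set" where
  "quiet_event n c d S = {\<omega>\<in>space M. (\<forall>j\<in>{1..n} - S. \<bar>Y j \<omega>\<bar> \<le> c) \<and>
     (\<forall>m\<le>n. \<bar>\<Sum>j\<in>{1..m} - S. truncate c (Y j \<omega>)\<bar> < d)}"

text \<open>The box depends only on the increments in \<open>S\<close> and the quiet event only on
  the others, so the two blocks are independent. Both events are written as preimages of measurable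
  sets \<open>Xa\<close> and \<open>Xb\<close> in the two product spaces.\<close>

lemma prob_box_quiet:
  assumes S: "S \<subseteq> {1..n}" and A: "\<And>k. k \<in> S \<Longrightarrow> A k \<in> sets borel"
  shows "{\<omega>\<in>space M. \<forall>k\<in>S. Y k \<omega> \<in> A k} \<inter> quiet_event n c d S \<in> events"
    "prob ({\<omega>\<in>space M. \<forall>k\<in>S. Y k \<omega> \<in> A k} \<inter> quiet_event n c d S)
      = (\<Prod>k\<in>S. prob {\<omega>\<in>space M. Y 1 \<omega> \<in> A k}) * prob (quiet_event n c d S)"
    "quiet_event n c d S \<in> events"
proof -
  let ?R = "{1..n} - S"
  let ?X = "\<lambda>\<omega>. restrict (\<lambda>i. Y i \<omega>) S" and ?Z = "\<lambda>\<omega>. restrict (\<lambda>i. Y i \<omega>) ?R"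
  define Xa where "Xa = Pi\<^sub>E S A"
  define Xb where "Xb = {f\<in>space (PiM ?R (\<lambda>_. borel :: real measure)). (\<forall>j\<in>?R. \<bar>f j\<bar> \<le> c) \<and>
     (\<forall>m\<le>n. \<bar>\<Sum>j\<in>{1..m} - S. truncate c (f j)\<bar> < d)}"
  have finS: "finite S" using S finite_subset by blast
  have ind: "indep_var (PiM S (\<lambda>_. borel)) ?X (PiM ?R (\<lambda>_. borel)) ?Z"
    using S by (intro indep_var_restrict[OF indep]) auto
  have Xa: "Xa \<in> sets (PiM S (\<lambda>_. borel))"
    unfolding Xa_def using finS A by (intro sets_PiM_I_finite) auto
  have Xb: "Xb \<in> sets (PiM ?R (\<lambda>_. borel))"
  proof -
    have comp: "(\<lambda>f. f j) \<in> borel_measurable (PiM ?R (\<lambda>_. borel :: real measure))" if "j \<in> ?R" for j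
      using that by (rule measurable_component_singleton)
    have "{f\<in>space (PiM ?R (\<lambda>_. borel :: real measure)). \<forall>j\<in>?R. \<bar>f j\<bar> \<le> c} \<in> sets (PiM ?R (\<lambda>_. borel))"
    proof (rule sets.sets_Collect_finite_All)
      fix j assume "j \<in> ?R"
      from comp[OF this] show "{f\<in>space (PiM ?R (\<lambda>_. borel :: real measure)). \<bar>f j\<bar> \<le> c} \<in> sets (PiM ?R (\<lambda>_. borel))"
        by measurable
    qed auto
    moreover have "{f\<in>space (PiM ?R (\<lambda>_. borel :: real measure)). \<forall>m\<in>{..n}. \<bar>\<Sum>j\<in>{1..m} - S. truncate c (f j)\<bar> < d} \<in> sets (PiM ?R (\<lambda>_. borel))"
    proof (rule sets.sets_Collect_finite_All)
      fix m assume "m \<in> {..n}"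
      hence [measurable]: "(\<lambda>f. \<Sum>j\<in>{1..m} - S. truncate c (f j)) \<in> borel_measurable (PiM ?R (\<lambda>_. borel))"
        by (intro borel_measurable_sum measurable_compose[OF comp measurable_truncate]) auto
      show "{f\<in>space (PiM ?R (\<lambda>_. borel :: real measure)). \<bar>\<Sum>j\<in>{1..m} - S. truncate c (f j)\<bar> < d} \<in> sets (PiM ?R (\<lambda>_. borel))"
        by measurable
    qed auto
    ultimately have "{f\<in>space (PiM ?R (\<lambda>_. borel :: real measure)). \<forall>j\<in>?R. \<bar>f j\<bar> \<le> c}
        \<inter> {f\<in>space (PiM ?R (\<lambda>_. borel :: real measure)). \<forall>m\<in>{..n}. \<bar>\<Sum>j\<in>{1..m} - S. truncate c (f j)\<bar> < d}
        \<in> sets (PiM ?R (\<lambda>_. borel))" by (rule sets.Int)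
    also have "{f\<in>space (PiM ?R (\<lambda>_. borel :: real measure)). \<forall>j\<in>?R. \<bar>f j\<bar> \<le> c}
        \<inter> {f\<in>space (PiM ?R (\<lambda>_. borel :: real measure)). \<forall>m\<in>{..n}. \<bar>\<Sum>j\<in>{1..m} - S. truncate c (f j)\<bar> < d} = Xb"
      unfolding Xb_def by auto
    finally show ?thesis .
  qed
  have 1: "?X -` Xa \<inter> space M = {\<omega>\<in>space M. \<forall>k\<in>S. Y k \<omega> \<in> A k}"
    by (auto simp: Xa_def PiE_iff)
  have 2: "?Z -` Xb \<inter> space M = quiet_event n c d S"
  proof -
    have "(\<Sum>j\<in>{1..m} - S. truncate c (?Z \<omega> j)) = (\<Sum>j\<in>{1..m} - S. truncate c (Y j \<omega>))" if "m \<le> n" for m \<omega>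
      using that by (intro sum.cong) auto
    moreover have "(\<forall>j\<in>?R. \<bar>?Z \<omega> j\<bar> \<le> c) \<longleftrightarrow> (\<forall>j\<in>?R. \<bar>Y j \<omega>\<bar> \<le> c)" for \<omega> by auto
    ultimately show ?thesis
      unfolding Xb_def quiet_event_def space_PiM by (auto simp: PiE_iff)
  qed
  have 3: "(\<lambda>x. (?X x, ?Z x)) -` (Xa \<times> Xb) \<inter> space M = {\<omega>\<in>space M. \<forall>k\<in>S. Y k \<omega> \<in> A k} \<inter> quiet_event n c d S"
    unfolding 1[symmetric] 2[symmetric] by auto
  have mX: "?X \<in> measurable M (PiM S (\<lambda>_. borel))" and mZ: "?Z \<in> measurable M (PiM ?R (\<lambda>_. borel))"
    using indep_var_rv1[OF ind] indep_var_rv2[OF ind] by auto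
  have E: "{\<omega>\<in>space M. \<forall>k\<in>S. Y k \<omega> \<in> A k} \<in> events" "quiet_event n c d S \<in> events"
    unfolding 1[symmetric] 2[symmetric] using measurable_sets[OF mX Xa] measurable_sets[OF mZ Xb] by auto
  thus "{\<omega>\<in>space M. \<forall>k\<in>S. Y k \<omega> \<in> A k} \<inter> quiet_event n c d S \<in> events" "quiet_event n c d S \<in> events"
    by auto
  have "prob ({\<omega>\<in>space M. \<forall>k\<in>S. Y k \<omega> \<in> A k}) = (\<Prod>k\<in>S. prob {\<omega>\<in>space M. Y 1 \<omega> \<in> A k})"
    using S finS A by (intro prob_box) auto
  thus "prob ({\<omega>\<in>space M. \<forall>k\<in>S. Y k \<omega> \<in> A k} \<inter> quiet_event n c d S)
      = (\<Prod>k\<in>S. prob {\<omega>\<in>space M. Y 1 \<omega> \<in> A k}) * prob (quiet_event n c d S)"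
    using indep_varD[OF ind Xa Xb] unfolding 1 2 3 by simp
qed

text \<open>Both tail indices exceed 1, so a tail exponent \<open>a > 1\<close> beats the factor
  \<open>n\<close>.\<close>

lemma prob_exceed_tendsto_0:
  assumes g: "g > 0"
  shows "(\<lambda>n. real n * prob {\<omega>\<in>space M. \<bar>Y 1 \<omega>\<bar> \<ge> g * real n}) \<longlonglongrightarrow> 0"
proof -
  define a where "a = (1 + min \<alpha> \<beta>) / 2"
  have a: "1 < a" "a < \<alpha>" "a < \<beta>" using alpha beta by (auto simp: a_def min_def)
  obtain C where C: "C > 0" "\<And>x. x \<ge> 1 \<Longrightarrow> prob {\<omega>\<in>space M. \<bar>Y 1 \<omega>\<bar> \<ge> x} \<le> C * x powr (- a)"
    using abs_tail_bound[of a] a by auto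
  have "(\<lambda>n. real n powr (- (a - 1))) \<longlonglongrightarrow> 0"
    using a by (intro tendsto_neg_powr filterlim_real_sequentially) auto
  from tendsto_mult_left[OF this, of "C * g powr (- a)"]
  have lim: "(\<lambda>n. C * g powr (- a) * real n powr (- (a - 1))) \<longlonglongrightarrow> 0" by simp
  show ?thesis
  proof (rule tendsto_sandwich[OF _ _ tendsto_const lim])
    have "filterlim (\<lambda>n. g * real n) at_top sequentially"
      using g by (intro filterlim_tendsto_pos_mult_at_top[OF tendsto_const _ filterlim_real_sequentially])
    hence "\<forall>\<^sub>F n in sequentially. g * real n \<ge> 1" by (auto simp: filterlim_at_top)
    thus "\<forall>\<^sub>F n in sequentially. real n * prob {\<omega>\<in>space M. \<bar>Y 1 \<omega>\<bar> \<ge> g * real n} \<le> C * g powr (- a) * real n powr (- (a - 1))"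
      using eventually_gt_at_top[of 0]
    proof eventually_elim
      case (elim n)
      have "real n * prob {\<omega>\<in>space M. \<bar>Y 1 \<omega>\<bar> \<ge> g * real n} \<le> real n * (C * (g * real n) powr (- a))"
        by (intro mult_left_mono C(2) elim) auto
      also have "\<dots> = C * g powr (- a) * (real n * real n powr (- a))"
        using g by (simp add: powr_mult mult_ac)
      also have "real n * real n powr (- a) = real n powr (- (a - 1))"
        using elim by (simp add: powr_mult_base)
      finally show ?case .
    qed
  qed simp
qed

text \<open>Two failures are possible, a large increment and a large truncated partial sum. Each
  eventually has probability at most 1/4, uniformly in the deleted set.\<close>

lemma quiet_event_likely:
  assumes d: "d > 0"
  obtains \<gamma>0 where "\<gamma>0 > 0" "\<And>\<gamma>. 0 < \<gamma> \<Longrightarrow> \<gamma> \<le> \<gamma>0 \<Longrightarrow>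
    \<forall>\<^sub>F n in sequentially. \<forall>S\<subseteq>{1..n}. prob (quiet_event n (\<gamma> * real n) (d * real n) S) \<ge> 1 / 2"
proof -
  obtain \<gamma>0 where \<gamma>0: "\<gamma>0 > 0" "\<And>\<gamma>. 0 < \<gamma> \<Longrightarrow> \<gamma> \<le> \<gamma>0 \<Longrightarrow> \<forall>\<^sub>F n in sequentially. \<forall>S.
       prob {\<omega>\<in>space M. \<exists>k\<le>n. d * real n \<le> \<bar>\<Sum>j\<in>{1..k} - S. truncate (\<gamma> * real n) (Y j \<omega>)\<bar>} \<le> real n powr (- 1)"
    using truncated_walk_concentration[OF d, of 1] by auto
  show ?thesis
  proof (rule that[OF \<gamma>0(1)])
    fix \<gamma> assume \<gamma>: "0 < \<gamma>" "\<gamma> \<le> \<gamma>0"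
    have "\<forall>\<^sub>F n in sequentially. real n * prob {\<omega>\<in>space M. \<bar>Y 1 \<omega>\<bar> \<ge> \<gamma> * real n} < 1 / 4"
      using prob_exceed_tendsto_0[OF \<gamma>(1)] by (rule order_tendstoD) simp
    with \<gamma>0(2)[OF \<gamma>] eventually_ge_at_top[of 4]
    show "\<forall>\<^sub>F n in sequentially. \<forall>S\<subseteq>{1..n}. prob (quiet_event n (\<gamma> * real n) (d * real n) S) \<ge> 1 / 2"
    proof eventually_elim
      case (elim n)
      show ?case
      proof (intro allI impI)
        fix S assume S: "S \<subseteq> {1..n}"
        let ?c = "\<gamma> * real n" and ?d = "d * real n"
        let ?E1 = "\<lambda>j. {\<omega>\<in>space M. Y j \<omega> \<in> {y. \<bar>y\<bar> \<ge> ?c}}"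
        let ?E2 = "{\<omega>\<in>space M. \<exists>k\<le>n. ?d \<le> \<bar>\<Sum>j\<in>{1..k} - S. truncate ?c (Y j \<omega>)\<bar>}"
        have [measurable]: "(\<lambda>\<omega>. \<Sum>j\<in>{1..k} - S. truncate ?c (Y j \<omega>)) \<in> borel_measurable M" for k
          by (rule measurable_truncated_sum) auto
        have E2: "?E2 \<in> events" by measurable
        have E1: "?E1 j \<in> events" if "j \<in> {1..n}" for j
        proof -
          have [measurable]: "Y j \<in> borel_measurable M" using that by (intro measurable_Y) auto
          show ?thesis by measurable
        qed
        have "space M - quiet_event n ?c ?d S \<subseteq> (\<Union>j\<in>{1..n}. ?E1 j) \<union> ?E2"
        proof
          fix \<omega> assume "\<omega> \<in> space M - quiet_event n ?c ?d S"
          hence "\<omega> \<in> space M" "(\<exists>j\<in>{1..n} - S. \<bar>Y j \<omega>\<bar> > ?c)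
              \<or> (\<exists>m\<le>n. ?d \<le> \<bar>\<Sum>j\<in>{1..m} - S. truncate ?c (Y j \<omega>)\<bar>)"
            unfolding quiet_event_def by (auto simp: not_le not_less)
          thus "\<omega> \<in> (\<Union>j\<in>{1..n}. ?E1 j) \<union> ?E2" by (force intro: less_imp_le)
        qed
        hence "prob (space M - quiet_event n ?c ?d S) \<le> prob ((\<Union>j\<in>{1..n}. ?E1 j) \<union> ?E2)"
          using E1 E2 by (intro finite_measure_mono sets.Un sets.finite_UN) auto
        also have "\<dots> \<le> prob (\<Union>j\<in>{1..n}. ?E1 j) + prob ?E2"
          using E1 E2 by (intro measure_Un_le sets.finite_UN) auto
        also have "prob (\<Union>j\<in>{1..n}. ?E1 j) \<le> (\<Sum>j\<in>{1..n}. prob (?E1 j))"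
          using E1 by (intro measure_UNION_le) auto
        also have "\<dots> = (\<Sum>j\<in>{1..n}. prob {\<omega>\<in>space M. Y 1 \<omega> \<in> {y. \<bar>y\<bar> \<ge> ?c}})"
          by (intro sum.cong refl prob_Y) auto
        also have "\<dots> = real n * prob {\<omega>\<in>space M. \<bar>Y 1 \<omega>\<bar> \<ge> ?c}" by simp
        also have "\<dots> \<le> 1 / 4" using elim(3) by simp
        also have "prob ?E2 \<le> real n powr (- 1)" using elim(1) by blast
        also have "\<dots> \<le> 1 / 4" using elim(2) by (simp add: powr_minus field_simps)
        finally have "prob (space M - quiet_event n ?c ?d S) \<le> 1 / 2" by simp
        moreover have "prob (space M - quiet_event n ?c ?d S) = 1 - prob (quiet_event n ?c ?d S)"
          by (rule prob_compl) (rule prob_box_quiet(3)[OF S, of "\<lambda>_. UNIV"], simp)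
        ultimately show "prob (quiet_event n ?c ?d S) \<ge> 1 / 2" by linarith
      qed
    qed
  qed
qed


text \<open>The events indexed by the positions \<open>\<kappa>\<close> of the big increments are disjoint, and each of
  them forces the walk to be near the step path.\<close>

lemma prob_near_step_path:
  fixes T z :: "'i \<Rightarrow> real"
  assumes I: "finite I" "inj_on T I" and T: "\<And>i. i \<in> I \<Longrightarrow> 0 < T i \<and> T i < 1"
    and z: "\<And>i. i \<in> I \<Longrightarrow> z i \<noteq> 0" and r: "r > 0"
  obtains c where "c > 0" "\<forall>\<^sub>F n in sequentially.
    c * rate n (card {i\<in>I. z i < 0}, card {i\<in>I. z i > 0}) \<le> prob (walk_event M Y n (ball (step_path I T z) r))"
proof -
  have r4: "r / 4 > 0" using r by simp
  obtain \<rho> where \<rho>: "\<rho> > 0"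
    "\<And>i j. i \<in> I \<Longrightarrow> j \<in> I \<Longrightarrow> i \<noteq> j \<Longrightarrow> 2 * \<rho> < \<bar>T i - T j\<bar>"
    "\<And>i. i \<in> I \<Longrightarrow> \<rho> < T i \<and> T i < 1 - \<rho>"
    "\<And>s. (\<And>i. i \<in> I \<Longrightarrow> \<bar>s i - T i\<bar> \<le> \<rho>) \<Longrightarrow>
       \<exists>\<tau>\<in>time_changes. (\<forall>t. \<bar>\<tau> t - t\<bar> \<le> r / 4) \<and> (\<forall>i\<in>I. \<tau> (T i) = s i)"
    using exists_time_change[OF I T r4] by blast
  define L where "L = real (card I) + 1"
  \<comment> \<open>The first entry bounds the total error in the jump sizes by
    \<open>r / 4\<close>. The others are half the jump sizes, so an increment within \<zeta> of
    \<open>z i\<close> after scaling still has scaled size at least \<zeta>.\<close>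
  define \<zeta> where "\<zeta> = Min (insert (r / (4 * L)) ((\<lambda>i. \<bar>z i\<bar> / 2) ` I))"
  have L: "L \<ge> 1" by (simp add: L_def)
  have \<zeta>0: "\<zeta> > 0" unfolding \<zeta>_def using I z r L by (subst Min_gr_iff) auto
  have \<zeta>z: "\<zeta> \<le> \<bar>z i\<bar> / 2" if "i \<in> I" for i unfolding \<zeta>_def using that I by (intro Min_le) auto
  have "\<zeta> \<le> r / (4 * L)" unfolding \<zeta>_def using I by (intro Min_le) auto
  hence "real (card I) * \<zeta> \<le> L * (r / (4 * L))" using \<zeta>0 L by (intro mult_mono) (auto simp: L_def)
  hence \<zeta>L: "real (card I) * \<zeta> \<le> r / 4" using L by simp
  obtain \<gamma>0 where \<gamma>0: "\<gamma>0 > 0" "\<And>\<gamma>. 0 < \<gamma> \<Longrightarrow> \<gamma> \<le> \<gamma>0 \<Longrightarrow>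
    \<forall>\<^sub>F n in sequentially. \<forall>S\<subseteq>{1..n}. prob (quiet_event n (\<gamma> * real n) (r / 4 * real n) S) \<ge> 1 / 2"
    using quiet_event_likely[OF r4] by blast
  \<comment> \<open>Strictly below \<zeta>, so that prescribed increments exceed the level
    \<open>\<gamma> * n\<close> and all remaining ones do not.\<close>
  define \<gamma> where "\<gamma> = min \<gamma>0 (\<zeta> / 2)"
  have \<gamma>: "0 < \<gamma>" "\<gamma> \<le> \<gamma>0" "\<gamma> < \<zeta>" using \<gamma>0(1) \<zeta>0 by (auto simp: \<gamma>_def)
  define G where "G = (\<lambda>n i. if z i < 0 then tail_down (real n) else tail_up (real n))"
  define q where "q = (\<lambda>n i. prob {\<omega>\<in>space M. Y 1 \<omega> \<in> near_interval n \<zeta> (z i)})"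
  have "\<exists>c>0. \<forall>\<^sub>F n in sequentially. c * G n i \<le> q n i" if i: "i \<in> I" for i
  proof -
    have "\<zeta> < \<bar>z i\<bar>" using \<zeta>z[OF i] \<zeta>0 by linarith
    then obtain c where "c > 0" "\<forall>\<^sub>F n in sequentially. c * (if z i < 0 then tail_down (real n) else tail_up (real n))
        \<le> prob {\<omega>\<in>space M. Y 1 \<omega> \<in> near_interval n \<zeta> (z i)}"
      using prob_near_interval_ge[OF \<zeta>0, of "z i"] by blast
    thus ?thesis unfolding G_def q_def by blast
  qed
  then obtain c where c: "\<And>i. i \<in> I \<Longrightarrow> c i > 0"
    "\<And>i. i \<in> I \<Longrightarrow> \<forall>\<^sub>F n in sequentially. c i * G n i \<le> q n i"
    by metis
  have ev_q: "\<forall>\<^sub>F n in sequentially. \<forall>i\<in>I. c i * G n i \<le> q n i"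
    using c(2) by (simp add: eventually_ball_finite_distrib[OF I(1)])
  have "filterlim (\<lambda>n. \<rho> * real n) at_top sequentially"
    using \<rho>(1) by (intro filterlim_tendsto_pos_mult_at_top[OF tendsto_const _ filterlim_real_sequentially])
  hence ev_n: "\<forall>\<^sub>F n in sequentially. \<rho> * real n \<ge> 2" by (auto simp: filterlim_at_top)
  show ?thesis
  \<comment> \<open>Jump \<open>i\<close> contributes \<rho> from the number of its positions and
    \<open>c i\<close> from its size; the factor 1/2 is the probability of quiet.\<close>
  proof (rule that[of "(\<Prod>i\<in>I. \<rho> * c i) / 2"])
    show "(\<Prod>i\<in>I. \<rho> * c i) / 2 > 0" using c(1) \<rho>(1) by (auto intro!: prod_pos)
    show "\<forall>\<^sub>F n in sequentially. (\<Prod>i\<in>I. \<rho> * c i) / 2 * rate n (card {i\<in>I. z i < 0}, card {i\<in>I. z i > 0})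
        \<le> prob (walk_event M Y n (ball (step_path I T z) r))"
      using ev_q ev_n \<gamma>0(2)[OF \<gamma>(1,2)]
    proof eventually_elim
      case (elim n)
      have n0: "n > 0" using elim(2) by (cases "n = 0") auto
      define W where "W = (\<lambda>i. {k\<in>{1..n}. \<bar>real k / real n - T i\<bar> \<le> \<rho>})"
      define P where "P = Pi\<^sub>E I W"
      \<comment> \<open>The inverse of \<kappa> recovers which jump the position \<open>k\<close> is
        meant for.\<close>
      define A where "A = (\<lambda>(\<kappa> :: 'i \<Rightarrow> nat) k. near_interval n \<zeta> (z (inv_into I \<kappa> k)))"
      define Q where "Q = (\<lambda>\<kappa> :: 'i \<Rightarrow> nat. quiet_event n (\<gamma> * real n) (r / 4 * real n) (\<kappa> ` I))"
      define E where "E = (\<lambda>\<kappa>. {\<omega>\<in>space M. \<forall>k\<in>\<kappa> ` I. Y k \<omega> \<in> A \<kappa> k} \<inter> Q \<kappa>)"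
      have window_inj: "i = j" if "i \<in> I" "j \<in> I" "k \<in> W i" "k \<in> W j" for i j k
      proof (rule ccontr)
        assume "i \<noteq> j"
        hence "2 * \<rho> < \<bar>T i - T j\<bar>" using \<rho>(2) that by blast
        moreover have "\<bar>real k / real n - T i\<bar> \<le> \<rho>" "\<bar>real k / real n - T j\<bar> \<le> \<rho>"
          using that by (auto simp: W_def)
        ultimately show False by linarith
      qed
      have PW: "\<kappa> i \<in> W i" if "\<kappa> \<in> P" "i \<in> I" for \<kappa> i using that by (auto simp: P_def)
      have inj: "inj_on \<kappa> I" if \<kappa>: "\<kappa> \<in> P" for \<kappa>
      proof (rule inj_onI)
        fix i j assume ij: "i \<in> I" "j \<in> I" "\<kappa> i = \<kappa> j"
        show "i = j" using window_inj[OF ij(1,2) PW[OF \<kappa> ij(1)]] PW[OF \<kappa> ij(2)] ij(3) by simp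
      qed
      have range: "\<kappa> ` I \<subseteq> {1..n}" if "\<kappa> \<in> P" for \<kappa> using PW[OF that] by (auto simp: W_def)
      have near: "\<bar>Y (\<kappa> i) \<omega> / real n - z i\<bar> \<le> \<zeta>" if "\<kappa> \<in> P" "\<omega> \<in> E \<kappa>" "i \<in> I" for \<kappa> \<omega> i
      proof -
        have "Y (\<kappa> i) \<omega> \<in> A \<kappa> (\<kappa> i)" using that by (auto simp: E_def)
        thus ?thesis using inv_into_f_f[OF inj[OF that(1)] that(3)] by (simp add: A_def near_interval_def)
      qed
      have big: "\<bar>Y (\<kappa> i) \<omega>\<bar> > \<gamma> * real n" if "\<kappa> \<in> P" "\<omega> \<in> E \<kappa>" "i \<in> I" for \<kappa> \<omega> i
      proof -
        have "\<bar>Y (\<kappa> i) \<omega> / real n\<bar> \<ge> \<zeta>" using near[OF that] \<zeta>z[OF that(3)] by linarith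
        hence "\<bar>Y (\<kappa> i) \<omega>\<bar> \<ge> \<zeta> * real n" using n0 by (simp add: field_simps)
        moreover have "\<zeta> * real n > \<gamma> * real n" using \<gamma>(3) n0 by simp
        ultimately show ?thesis by linarith
      qed
      have quiet: "\<bar>Y j \<omega>\<bar> \<le> \<gamma> * real n" if "\<omega> \<in> E \<kappa>" "j \<in> {1..n} - \<kappa> ` I" for \<kappa> \<omega> j
      proof -
        have "\<forall>j\<in>{1..n} - \<kappa> ` I. \<bar>Y j \<omega>\<bar> \<le> \<gamma> * real n"
          using that(1) unfolding E_def Q_def quiet_event_def by blast
        thus ?thesis using that(2) by blast
      qed
      \<comment> \<open>A position used by \<kappa>' carries a big increment, so under \<kappa> it
        cannot be among the quiet ones and is used by \<kappa> as well. The windows are disjoint, so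
        it belongs to the same jump, and the two assignments agree.\<close>
      have disj: "disjoint_family_on E P"
        unfolding disjoint_family_on_def
      proof (intro ballI impI)
        fix \<kappa> \<kappa>' assume \<kappa>: "\<kappa> \<in> P" "\<kappa>' \<in> P" "\<kappa> \<noteq> \<kappa>'"
        show "E \<kappa> \<inter> E \<kappa>' = {}"
        proof (rule ccontr)
          assume "E \<kappa> \<inter> E \<kappa>' \<noteq> {}"
          then obtain \<omega> where \<omega>: "\<omega> \<in> E \<kappa>" "\<omega> \<in> E \<kappa>'" by blast
          have "\<kappa> i = \<kappa>' i" if i: "i \<in> I" for i
          proof -
            have "\<kappa>' i \<in> \<kappa> ` I"
            proof (rule ccontr)
              assume "\<kappa>' i \<notin> \<kappa> ` I"
              hence "\<kappa>' i \<in> {1..n} - \<kappa> ` I" using range[OF \<kappa>(2)] i by blast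
              from quiet[OF \<omega>(1) this] big[OF \<kappa>(2) \<omega>(2) i] show False by linarith
            qed
            then obtain j where j: "j \<in> I" "\<kappa>' i = \<kappa> j" by blast
            have "\<kappa>' i \<in> W i" "\<kappa>' i \<in> W j" using PW[OF \<kappa>(2) i] PW[OF \<kappa>(1) j(1)] j(2) by auto
            hence "i = j" using window_inj i j(1) by blast
            thus ?thesis using j(2) by simp
          qed
          hence "\<kappa> = \<kappa>'" using \<kappa>(1,2) unfolding P_def by (intro PiE_ext) auto
          thus False using \<kappa>(3) by simp
        qed
      qed
      have sub: "E \<kappa> \<subseteq> walk_event M Y n (ball (step_path I T z) r)" if \<kappa>: "\<kappa> \<in> P" for \<kappa>
      proof
        fix \<omega> assume \<omega>: "\<omega> \<in> E \<kappa>"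
        have "\<bar>real (\<kappa> i) / real n - T i\<bar> \<le> \<rho>" if "i \<in> I" for i
          using PW[OF \<kappa> that] by (auto simp: W_def)
        from \<rho>(4)[of "\<lambda>i. real (\<kappa> i) / real n", OF this] obtain \<tau> where \<tau>: "\<tau> \<in> time_changes"
          "\<And>t. \<bar>\<tau> t - t\<bar> \<le> r / 4" "\<And>i. i \<in> I \<Longrightarrow> \<tau> (T i) = real (\<kappa> i) / real n"
          by blast
        have "dist (scaled_walk Y n \<omega>) (step_path I T z) < r"
        proof (rule dist_scaled_walk_step_path_less[where T = T and \<tau> = \<tau> and z = z and Y = Y and \<omega> = \<omega>,
            OF n0 I(1) range[OF \<kappa>] inj[OF \<kappa>] T \<tau> near[OF \<kappa> \<omega>] \<zeta>L _ r])
          fix m assume m: "m \<le> n"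
          have "(\<Sum>j\<in>{1..m} - \<kappa> ` I. Y j \<omega>) = (\<Sum>j\<in>{1..m} - \<kappa> ` I. truncate (\<gamma> * real n) (Y j \<omega>))"
          proof (rule sum.cong[OF refl])
            fix j assume "j \<in> {1..m} - \<kappa> ` I"
            hence "j \<in> {1..n} - \<kappa> ` I" using m by auto
            from quiet[OF \<omega> this] show "Y j \<omega> = truncate (\<gamma> * real n) (Y j \<omega>)" by (simp add: truncate_def)
          qed
          moreover have "\<forall>m\<le>n. \<bar>\<Sum>j\<in>{1..m} - \<kappa> ` I. truncate (\<gamma> * real n) (Y j \<omega>)\<bar> < r / 4 * real n"
            using \<omega> unfolding E_def Q_def quiet_event_def by blast
          ultimately show "\<bar>\<Sum>j\<in>{1..m} - \<kappa> ` I. Y j \<omega>\<bar> < r / 4 * real n" using m by simp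
        qed
        moreover have "\<omega> \<in> space M" using \<omega> by (auto simp: E_def)
        ultimately show "\<omega> \<in> walk_event M Y n (ball (step_path I T z) r)"
          by (simp add: walk_event_def dist_commute)
      qed
      have measA: "A \<kappa> k \<in> sets borel" for \<kappa> k by (simp add: A_def sets_near_interval)
      have E_sets: "E \<kappa> \<in> events" if "\<kappa> \<in> P" for \<kappa>
        unfolding E_def Q_def by (rule prob_box_quiet(1)[OF range[OF that] measA])
      have E_prob: "(\<Prod>i\<in>I. c i * G n i) / 2 \<le> prob (E \<kappa>)" if \<kappa>: "\<kappa> \<in> P" for \<kappa>
      proof -
        have "prob (E \<kappa>) = (\<Prod>k\<in>\<kappa> ` I. prob {\<omega>\<in>space M. Y 1 \<omega> \<in> A \<kappa> k}) * prob (Q \<kappa>)"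
          unfolding E_def Q_def by (rule prob_box_quiet(2)[OF range[OF \<kappa>] measA])
        also have "(\<Prod>k\<in>\<kappa> ` I. prob {\<omega>\<in>space M. Y 1 \<omega> \<in> A \<kappa> k}) = (\<Prod>i\<in>I. q n i)"
          unfolding prod.reindex[OF inj[OF \<kappa>]] o_def q_def A_def
          using inv_into_f_f[OF inj[OF \<kappa>]] by (intro prod.cong) auto
        finally have eq: "prob (E \<kappa>) = (\<Prod>i\<in>I. q n i) * prob (Q \<kappa>)" .
        have "(\<Prod>i\<in>I. c i * G n i) * (1 / 2) \<le> (\<Prod>i\<in>I. q n i) * prob (Q \<kappa>)"
        proof (rule mult_mono)
          show "(\<Prod>i\<in>I. c i * G n i) \<le> (\<Prod>i\<in>I. q n i)"
            using elim(1) c(1) by (intro prod_mono) (auto simp: G_def tail_nonneg less_imp_le)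
          show "1 / 2 \<le> prob (Q \<kappa>)" unfolding Q_def using elim(3) range[OF \<kappa>] by blast
        qed (auto simp: q_def intro!: prod_nonneg)
        thus ?thesis using eq by simp
      qed
      have finP: "finite P" unfolding P_def using I(1) by (intro finite_PiE) (auto simp: W_def)
      have cardP: "(\<Prod>i\<in>I. \<rho> * real n) \<le> real (card P)"
      proof -
        have "(\<Prod>i\<in>I. \<rho> * real n) \<le> (\<Prod>i\<in>I. real (card (W i)))"
        proof (intro prod_mono conjI)
          fix i assume i: "i \<in> I"
          show "\<rho> * real n \<le> real (card (W i))"
            unfolding W_def using \<rho>(1) \<rho>(3)[OF i] elim(2) by (intro card_window_ge) (auto simp: mult.commute)
        qed (use \<rho> in auto)
        also have "\<dots> = real (card P)" unfolding P_def using I(1) by (simp add: card_PiE)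
        finally show ?thesis .
      qed
      have rate: "rate n (card {i\<in>I. z i < 0}, card {i\<in>I. z i > 0}) = (\<Prod>i\<in>I. real n * G n i)"
      proof -
        have "(\<Prod>i\<in>I. real n * G n i) = (\<Prod>i\<in>I. if z i < 0 then real n * tail_down (real n) else real n * tail_up (real n))"
          by (rule prod.cong) (auto simp: G_def)
        also have "\<dots> = (real n * tail_down (real n)) ^ card (I \<inter> {i. z i < 0})
            * (real n * tail_up (real n)) ^ card (I \<inter> - {i. z i < 0})"
          using I(1) by (simp add: prod.If_cases)
        also have "I \<inter> {i. z i < 0} = {i\<in>I. z i < 0}" by auto
        also have "I \<inter> - {i. z i < 0} = {i\<in>I. z i > 0}" using z by force
        finally show ?thesis by (simp add: rate_def)
      qed
      \<comment> \<open>The number of assignments supplies one factor of order \<open>n\<close> per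
        jump, and the box probabilities supply the tails.\<close>
      have "(\<Prod>i\<in>I. \<rho> * c i) / 2 * rate n (card {i\<in>I. z i < 0}, card {i\<in>I. z i > 0})
          = (\<Prod>i\<in>I. \<rho> * real n) * ((\<Prod>i\<in>I. c i * G n i) / 2)"
        unfolding rate by (simp add: prod.distrib power_mult_distrib mult_ac)
      also have "\<dots> \<le> real (card P) * ((\<Prod>i\<in>I. c i * G n i) / 2)"
        using cardP c(1) by (intro mult_right_mono divide_nonneg_nonneg prod_nonneg) (auto simp: G_def tail_nonneg less_imp_le)
      also have "\<dots> = (\<Sum>\<kappa>\<in>P. (\<Prod>i\<in>I. c i * G n i) / 2)" by simp
      also have "\<dots> \<le> (\<Sum>\<kappa>\<in>P. prob (E \<kappa>))" by (intro sum_mono E_prob)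
      also have "\<dots> = prob (\<Union>\<kappa>\<in>P. E \<kappa>)"
        using E_sets by (intro finite_measure_finite_Union[symmetric] finP disj) auto
      also have "\<dots> \<le> prob (walk_event M Y n (ball (step_path I T z) r))"
        using sub by (intro finite_measure_mono sets_walk_event) auto
      finally show ?case .
    qed
  qed
qed

end

section \<open>Typical jump sizes and times under the limit measure\<close>

lemma AE_PiM_all:
  assumes N: "sigma_finite_measure N" and I: "finite I"
    and ae: "AE y in N. P y" and P: "{y\<in>space N. P y} \<in> sets N"
  shows "AE x in PiM I (\<lambda>_. N). \<forall>i\<in>I. P (x i)" "{x\<in>space (PiM I (\<lambda>_. N)). \<forall>i\<in>I. P (x i)} \<in> sets (PiM I (\<lambda>_. N))"
proof -
  interpret product_sigma_finite "\<lambda>_. N" by (rule product_sigma_finite.intro) (rule N)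
  have coord: "{x\<in>space (PiM I (\<lambda>_. N)). P (x i)} \<in> sets (PiM I (\<lambda>_. N))" if "i \<in> I" for i
  proof -
    have "(\<lambda>x. x i) -` {y\<in>space N. P y} \<inter> space (PiM I (\<lambda>_. N)) \<in> sets (PiM I (\<lambda>_. N))"
      by (rule measurable_sets[OF measurable_component_singleton[OF that] P])
    moreover have "(\<lambda>x. x i) -` {y\<in>space N. P y} \<inter> space (PiM I (\<lambda>_. N)) = {x\<in>space (PiM I (\<lambda>_. N)). P (x i)}"
      using measurable_space[OF measurable_component_singleton[OF that, of "\<lambda>_. N"]] by auto
    ultimately show ?thesis by simp
  qed
  show "{x\<in>space (PiM I (\<lambda>_. N)). \<forall>i\<in>I. P (x i)} \<in> sets (PiM I (\<lambda>_. N))"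
    by (rule sets.sets_Collect_finite_All[OF coord I])
  show "AE x in PiM I (\<lambda>_. N). \<forall>i\<in>I. P (x i)"
  proof (rule AE_finite_allI[OF I])
    fix i assume i: "i \<in> I"
    \<comment> \<open>The exceptional set of coordinate \<open>i\<close> lies in a box with one null
      side. Its product measure is 0 even if other sides have infinite measure, as happens for
      \<open>nu\<close>, whose mass is infinite near 0 for positive index.\<close>
    define B where "B = (\<lambda>j. if j = i then {y\<in>space N. \<not> P y} else space N)"
    have nP: "{y\<in>space N. \<not> P y} \<in> sets N" using P by (rule sets.sets_Collect_neg)
    have "emeasure N {y\<in>space N. \<not> P y} = 0" by (rule emeasure_eq_0_AE) (use ae in simp)
    hence "emeasure N (B i) = 0" by (simp add: B_def)
    hence "(\<Prod>j\<in>I. emeasure N (B j)) = 0" using i I by (intro prod_zero) auto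
    moreover have "emeasure (PiM I (\<lambda>_. N)) (Pi\<^sub>E I B) = (\<Prod>j\<in>I. emeasure N (B j))"
      using nP by (intro emeasure_PiM I) (auto simp: B_def)
    moreover have "Pi\<^sub>E I B \<in> sets (PiM I (\<lambda>_. N))" using nP by (intro sets_PiM_I_finite I) (auto simp: B_def)
    ultimately have "Pi\<^sub>E I B \<in> null_sets (PiM I (\<lambda>_. N))" by (simp add: null_sets_def)
    moreover have "{x\<in>space (PiM I (\<lambda>_. N)). \<not> P (x i)} \<subseteq> Pi\<^sub>E I B"
      by (auto simp: B_def space_PiM PiE_def Pi_def)
    ultimately show "AE x in PiM I (\<lambda>_. N). P (x i)" by (rule AE_I')
  qed
qed

lemma AE_pair_conj:
  assumes M: "sigma_finite_measure M" "sigma_finite_measure N"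
    and ae: "AE x in M. P x" "AE y in N. Q y"
    and s: "{x\<in>space M. P x} \<in> sets M" "{y\<in>space N. Q y} \<in> sets N"
  shows "AE p in M \<Otimes>\<^sub>M N. P (fst p) \<and> Q (snd p)"
proof -
  interpret pair_sigma_finite M N using M by (rule pair_sigma_finite.intro)
  show ?thesis
  proof (rule AE_pair_measure)
    have "{x\<in>space M. P x} \<times> {y\<in>space N. Q y} \<in> sets (M \<Otimes>\<^sub>M N)" using s by auto
    moreover have "{x\<in>space M. P x} \<times> {y\<in>space N. Q y} = {p\<in>space (M \<Otimes>\<^sub>M N). P (fst p) \<and> Q (snd p)}"
      by (auto simp: space_pair_measure)
    ultimately show "{p\<in>space (M \<Otimes>\<^sub>M N). P (fst p) \<and> Q (snd p)} \<in> sets (M \<Otimes>\<^sub>M N)" by simp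
    show "AE x in M. AE y in N. P (fst (x, y)) \<and> Q (snd (x, y))"
      using ae(1) by eventually_elim (use ae(2) in auto)
  qed
qed

text \<open>The endpoints are discarded because a jump at time 0 would move the starting value away
  from 0, and time changes fix both 0 and 1.\<close>

lemma uniform_vec_AE:
  "sigma_finite_measure (uniform_vec m)"
  "AE u in uniform_vec m. \<forall>i\<in>{..<m}. 0 < u i \<and> u i < 1"
  "{u\<in>space (uniform_vec m). \<forall>i\<in>{..<m}. 0 < u i \<and> u i < 1} \<in> sets (uniform_vec m)"
proof -
  let ?U = "uniform_measure lborel {0..1::real}"
  have U: "sigma_finite_measure ?U"
    by (intro prob_space_imp_sigma_finite prob_space_uniform_measure) auto
  interpret product_sigma_finite "\<lambda>_::nat. ?U" by (rule product_sigma_finite.intro) (rule U)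
  show "sigma_finite_measure (uniform_vec m)" unfolding uniform_vec_def by (rule sigma_finite) simp
  have "AE y in lborel. y \<in> {0..1::real} \<longrightarrow> 0 < y \<and> y < 1"
    using AE_lborel_singleton[of "0::real"] AE_lborel_singleton[of "1::real"] by eventually_elim auto
  hence ae: "AE y in ?U. 0 < y \<and> y < 1" by (intro AE_uniform_measureI) auto
  have s: "{y\<in>space ?U. 0 < y \<and> y < 1} \<in> sets ?U" by simp
  show "AE u in uniform_vec m. \<forall>i\<in>{..<m}. 0 < u i \<and> u i < 1"
    "{u\<in>space (uniform_vec m). \<forall>i\<in>{..<m}. 0 < u i \<and> u i < 1} \<in> sets (uniform_vec m)"
    unfolding uniform_vec_def using AE_PiM_all[OF U finite_lessThan ae s] by auto
qed

lemma nu_vec_AE: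
  "sigma_finite_measure (nu_vec a m)"
  "AE x in nu_vec a m. \<forall>i\<in>{..<m}. 0 < x i"
  "{x\<in>space (nu_vec a m). \<forall>i\<in>{..<m}. 0 < x i} \<in> sets (nu_vec a m)"
proof -
  have N: "sigma_finite_measure (nu a)" unfolding nu_def
    by (subst sigma_finite_measure.sigma_finite_iff_density_finite'[OF sigma_finite_lborel])
       (auto simp: ennreal_mult_eq_top_iff split: split_indicator)
  interpret product_sigma_finite "\<lambda>_::nat. nu a" by (rule product_sigma_finite.intro) (rule N)
  have ae: "AE y in nu a. 0 < y"
    unfolding nu_def by (subst AE_density) (auto split: split_indicator)
  have s: "{y\<in>space (nu a). 0 < y} \<in> sets (nu a)" by (simp add: nu_def)
  let ?P = "PiM {..<m} (\<lambda>_. nu a)" and ?D = "{x. \<forall>i j. i \<le> j \<longrightarrow> j < m \<longrightarrow> x j \<le> (x i :: real)}"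
  have comp: "(\<lambda>x. x i) \<in> borel_measurable ?P" if "i < m" for i
  proof -
    have "(\<lambda>x. x i) \<in> measurable ?P (nu a)" using that by (intro measurable_component_singleton) auto
    thus ?thesis by (simp add: nu_def cong: measurable_cong_sets)
  qed
  \<comment> \<open>Monotonicity of the vector is a finite conjunction of comparisons of coordinates
    below \<open>m\<close>, which makes the indicator in \<open>nu_vec\<close> measurable.\<close>
  have "{x\<in>space ?P. \<forall>p\<in>{p. fst p \<le> snd p \<and> snd p < m}. x (snd p) \<le> x (fst p)} \<in> sets ?P"
  proof (rule sets.sets_Collect_finite_All)
    show "finite {p. fst p \<le> snd p \<and> snd p < m}"
      by (rule finite_subset[of _ "{..<m} \<times> {..<m}"]) auto
    fix p assume "p \<in> {p. fst p \<le> snd p \<and> snd p < m}"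
    hence "fst p < m" "snd p < m" by auto
    thus "{x\<in>space ?P. x (snd p) \<le> x (fst p)} \<in> sets ?P"
      by (intro borel_measurable_le comp)
  qed
  also have "{x\<in>space ?P. \<forall>p\<in>{p. fst p \<le> snd p \<and> snd p < m}. x (snd p) \<le> x (fst p)} = ?D \<inter> space ?P"
    by auto
  finally have "?D \<inter> space ?P \<in> sets ?P" .
  hence D: "(indicator ?D :: _ \<Rightarrow> ennreal) \<in> borel_measurable ?P" by (rule iffD2[OF borel_measurable_indicator_iff])
  have sig: "sigma_finite_measure ?P" by (rule sigma_finite) simp
  show "sigma_finite_measure (nu_vec a m)"
    unfolding nu_vec_def
    by (rule iffD2[OF sigma_finite_measure.sigma_finite_iff_density_finite'[OF sig D]])
       (rule always_eventually, simp add: indicator_def)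
  have "AE x in ?P. \<forall>i\<in>{..<m}. 0 < x i" by (rule AE_PiM_all(1)[OF N _ ae s]) simp
  thus "AE x in nu_vec a m. \<forall>i\<in>{..<m}. 0 < x i"
    unfolding nu_vec_def AE_density[OF D] by eventually_elim simp
  show "{x\<in>space (nu_vec a m). \<forall>i\<in>{..<m}. 0 < x i} \<in> sets (nu_vec a m)"
    using AE_PiM_all(2)[OF N finite_lessThan ae s] by (simp add: nu_vec_def)
qed

text \<open>If no path with positive sizes and interior times reached \<open>U\<close>, the
  integrand would vanish for almost all times and the integral would be 0. Only null sets are
  handled, so the sets in the integrand raise no question of measurability. The pair (0,0) is
  separate, since the measure is a Dirac mass there.\<close>

lemma C_measure_pos_imp_jump_path:
  assumes pos: "C_measure \<alpha> \<beta> (lm, lp) U > 0"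
  obtains x y u v where "jump_path lm lp x y u v \<in> U"
    "\<And>i. i < lm \<Longrightarrow> 0 < x i \<and> 0 < u i \<and> u i < 1" "\<And>i. i < lp \<Longrightarrow> 0 < y i \<and> 0 < v i \<and> v i < 1"
proof (cases "(lm, lp) = (0, 0)")
  case True
  hence "to_cadlag (\<lambda>_. 0) \<in> U" using pos by (auto simp: C_measure_def split: split_indicator_asm)
  thus ?thesis using True by (intro that[of "\<lambda>_. 0" "\<lambda>_. 0" "\<lambda>_. 0" "\<lambda>_. 0"]) (auto simp: jump_path_def)
next
  case False
  let ?N = "nu_vec \<alpha> lm \<Otimes>\<^sub>M nu_vec \<beta> lp" and ?V = "uniform_vec lm \<Otimes>\<^sub>M uniform_vec lp"
  let ?S = "\<lambda>u v. {(x, y) \<in> space ?N. jump_path lm lp x y u v \<in> U}"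
  note witness = that
  show ?thesis
  proof (rule ccontr)
    assume no: "\<not> thesis"
    have null: "emeasure ?N (?S u v) = 0"
      if uv: "\<forall>i\<in>{..<lm}. 0 < u i \<and> u i < 1" "\<forall>i\<in>{..<lp}. 0 < v i \<and> v i < 1" for u v
    proof -
      have "AE p in ?N. (\<forall>i\<in>{..<lm}. 0 < fst p i) \<and> (\<forall>i\<in>{..<lp}. 0 < snd p i)"
        by (rule AE_pair_conj) (rule nu_vec_AE)+
      hence "AE p in ?N. jump_path lm lp (fst p) (snd p) u v \<notin> U"
      proof eventually_elim
        case (elim p)
        show ?case
        proof
          assume "jump_path lm lp (fst p) (snd p) u v \<in> U"
          hence thesis by (rule witness) (use elim uv in simp_all)
          thus False using no by contradiction
        qed
      qed
      hence "emeasure ?N {p\<in>space ?N. jump_path lm lp (fst p) (snd p) u v \<in> U} = 0"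
        by (intro emeasure_eq_0_AE) auto
      moreover have "{p\<in>space ?N. jump_path lm lp (fst p) (snd p) u v \<in> U} = ?S u v" by auto
      ultimately show ?thesis by simp
    qed
    have "AE p in ?V. (\<forall>i\<in>{..<lm}. 0 < fst p i \<and> fst p i < 1) \<and> (\<forall>i\<in>{..<lp}. 0 < snd p i \<and> snd p i < 1)"
      by (rule AE_pair_conj) (rule uniform_vec_AE)+
    hence "AE p in ?V. (case p of (u, v) \<Rightarrow> emeasure ?N (?S u v)) = 0"
    proof eventually_elim
      case (elim p)
      thus ?case using null[of "fst p" "snd p"] by (simp add: case_prod_beta)
    qed
    hence "(\<integral>\<^sup>+ (u, v). emeasure ?N (?S u v) \<partial>?V) = (\<integral>\<^sup>+ p. 0 \<partial>?V)"
      by (rule nn_integral_cong_AE)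
    hence "C_measure \<alpha> \<beta> (lm, lp) U = 0"
      using False unfolding C_measure_def prod.case by (subst if_not_P) simp_all
    thus False using pos by simp
  qed
qed


section \<open>Strong efficiency\<close>

context heavy_walk
begin

text \<open>If two jump times coincided, the path would have fewer jumps and hence lie in
  \<open>D_less\<close>, from which \<open>A\<close> is bounded away.\<close>

lemma prob_walk_event_ge_rate:
  assumes A: "A \<in> sets borel" and away: "bounded_away A (D_less \<alpha> \<beta> ls)"
    and pos: "C_measure \<alpha> \<beta> ls (interior A) > 0"
  obtains c where "c > 0" "\<forall>\<^sub>F n in sequentially. c * rate n ls \<le> prob (walk_event M Y n A)"
proof -
  obtain lm lp where ls: "ls = (lm, lp)" by (cases ls)
  obtain x y u v where xi: "jump_path lm lp x y u v \<in> interior A"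
    and x: "\<And>i. i < lm \<Longrightarrow> 0 < x i \<and> 0 < u i \<and> u i < 1" and y: "\<And>i. i < lp \<Longrightarrow> 0 < y i \<and> 0 < v i \<and> v i < 1"
    using C_measure_pos_imp_jump_path[OF pos[unfolded ls]] by blast
  define I :: "(nat + nat) set" where "I = {..<lm} <+> {..<lp}"
  let ?T = "jump_time u v" and ?z = "jump_size x y"
  let ?xi = "step_path I ?T ?z"
  have xi: "?xi \<in> interior A" using xi by (simp add: jump_path_eq_step_path I_def)
  have fin: "finite I" by (simp add: I_def)
  have T: "0 < ?T i \<and> ?T i < 1" if "i \<in> I" for i using that x y by (auto simp: I_def jump_time_def)
  have neg: "{i\<in>I. ?z i < 0} = Inl ` {..<lm}" and pos: "{i\<in>I. ?z i > 0} = Inr ` {..<lp}"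
    using x y by (force simp: I_def jump_size_def)+
  have z: "?z i \<noteq> 0" if "i \<in> I" for i using that x y by (fastforce simp: I_def jump_size_def)
  have card: "card {i\<in>I. ?z i < 0} = lm" "card {i\<in>I. ?z i > 0} = lp"
    unfolding neg pos by (simp_all add: card_image)
  have T1: "0 < ?T i \<and> ?T i \<le> 1" if "i \<in> I" for i using T[OF that] by auto
  obtain lm' lp' where l': "?xi \<in> D_jumps lm' lp'" "lm' \<le> lm" "lp' \<le> lp"
    "lm' = lm \<Longrightarrow> lp' = lp \<Longrightarrow> inj_on ?T I"
    using step_path_merged_jumps[where I = I and t = ?T and z = ?z, OF fin T1 z] unfolding card by blast
  have "(lm', lp') = ls"
  proof (rule ccontr)
    assume ne: "(lm', lp') \<noteq> ls"
    \<comment> \<open>The weights \<open>\<alpha> - 1\<close> and \<open>\<beta> - 1\<close> are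
      positive, so losing jumps never raises the cost.\<close>
    have "jump_cost \<alpha> \<beta> (lm', lp') \<le> jump_cost \<alpha> \<beta> ls"
      using l'(2,3) alpha beta by (auto simp: jump_cost_def ls intro!: add_mono mult_left_mono)
    hence "?xi \<in> D_less \<alpha> \<beta> ls" using l'(1) ne by (auto simp: D_less_def I_less_def)
    moreover have "?xi \<in> A" using xi interior_subset by blast
    moreover obtain \<delta> where "\<delta> > 0" "\<And>x y. x \<in> A \<Longrightarrow> y \<in> D_less \<alpha> \<beta> ls \<Longrightarrow> \<delta> \<le> dist x y"
      using bounded_away_dist[OF away] by blast
    ultimately have "\<delta> \<le> dist ?xi ?xi" by blast
    thus False using \<open>\<delta> > 0\<close> by simp
  qed
  hence inj: "inj_on ?T I" using l'(4) by (simp add: ls)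
  obtain r where r: "r > 0" "ball ?xi r \<subseteq> A" using xi by (auto simp: mem_interior)
  obtain c where c: "c > 0" "\<forall>\<^sub>F n in sequentially. c * rate n ls \<le> prob (walk_event M Y n (ball ?xi r))"
    using prob_near_step_path[where I = I and T = ?T and z = ?z, OF fin inj T z r(1)] unfolding card ls by blast
  show ?thesis
  proof (rule that[OF c(1)])
    show "\<forall>\<^sub>F n in sequentially. c * rate n ls \<le> prob (walk_event M Y n A)"
      using c(2)
    proof eventually_elim
      case (elim n)
      also have "prob (walk_event M Y n (ball ?xi r)) \<le> prob (walk_event M Y n A)"
        using r(2) by (intro finite_measure_mono sets_walk_event A) (auto simp: walk_event_def)
      finally show ?case .
    qed
  qed
qed

lemma strongly_efficient:
  assumes A: "A \<in> sets borel" and away: "bounded_away A (D_less \<alpha> \<beta> ls)"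
    and pos: "C_measure \<alpha> \<beta> ls (interior A) > 0" and w: "0 < w" "w < 1"
  obtains g where "g > 0"
    "(\<lambda>n. let An = walk_event M Y n A; Bn = walk_event M Y n (B_set \<alpha> \<beta> ls g g)
          in \<integral>\<omega>. (IS_estimator M An Bn w \<omega>)\<^sup>2 \<partial>Q_measure M Bn w)
      \<in> O(\<lambda>n. (prob (walk_event M Y n A))\<^sup>2)"
proof -
  \<comment> \<open>Exponent of the lower power bound for the rate with the loss \<eta> = 1 per
    jump; any positive loss would serve.\<close>
  define K where "K = jump_cost \<alpha> \<beta> ls + 1 * real (fst ls + snd ls)"
  obtain c where c: "c > 0" "\<forall>\<^sub>F n in sequentially. c * rate n ls \<le> prob (walk_event M Y n A)"
    using prob_walk_event_ge_rate[OF A away pos] by blast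
  obtain d where d: "d > 0" "\<forall>\<^sub>F n in sequentially. d * real n powr (- K) \<le> rate n ls"
    using rate_lower[of 1 ls] unfolding K_def by auto
  \<comment> \<open>The exponent \<open>2 * K\<close> matches the square of the lower bound for the
    rate. This choice fixes the threshold, and the bound on \<open>P(B)\<close> below is then
    applied to it.\<close>
  obtain g where g: "g > 0" "\<forall>\<^sub>F n in sequentially.
      prob (walk_event M Y n A - walk_event M Y n (B_set \<alpha> \<beta> ls g g)) \<le> real n powr (- (2 * K))"
    using prob_few_big_jumps[OF A away] by blast
  obtain C where C: "C > 0"
    "\<forall>\<^sub>F n in sequentially. prob (walk_event M Y n (B_set \<alpha> \<beta> ls g g)) \<le> C * rate n ls"
    using prob_walk_event_B_set_rate[OF g(1)] by blast
  \<comment> \<open>The first term belongs to \<open>A \<inter> B\<close>, where \<open>P(B)\<close>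
    is traded for \<open>P(A)\<close> at cost \<open>C / c\<close>; the second to
    \<open>A - B\<close>, where a power of \<open>n\<close> is traded for the square of
    \<open>P(A)\<close>.\<close>
  define D where "D = C / (c * (1 - w)) + 1 / ((d * c)\<^sup>2 * w)"
  show ?thesis
  proof (rule that[OF g(1)], rule bigoI[of _ D])
    show "\<forall>\<^sub>F n in sequentially.
      norm (let An = walk_event M Y n A; Bn = walk_event M Y n (B_set \<alpha> \<beta> ls g g)
          in \<integral>\<omega>. (IS_estimator M An Bn w \<omega>)\<^sup>2 \<partial>Q_measure M Bn w)
      \<le> D * norm ((prob (walk_event M Y n A))\<^sup>2)"
      using c(2) d(2) g(2) C(2) eventually_gt_at_top[of 0]
    proof eventually_elim
      case (elim n)
      let ?A = "walk_event M Y n A" and ?B = "walk_event M Y n (B_set \<alpha> \<beta> ls g g)"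
      let ?a = "prob ?A"
      have ev: "?A \<in> events" "?B \<in> events"
        using sets_walk_event[OF A] sets_walk_event_B_set[OF elim(5) g(1)] by auto
      have rate: "rate n ls \<le> ?a / c" using elim(1) c(1) by (simp add: field_simps)
      have "prob ?B \<le> C * (?a / c)"
        using elim(4) mult_left_mono[OF rate, of C] C(1) by linarith
      hence "prob ?B * prob (?A \<inter> ?B) \<le> (C * (?a / c)) * ?a"
        using ev by (intro mult_mono finite_measure_mono) (auto intro: order_trans[OF measure_nonneg])
      hence "prob ?B * prob (?A \<inter> ?B) / (1 - w) \<le> (C * (?a / c)) * ?a / (1 - w)"
        using w by (intro divide_right_mono) auto
      also have "\<dots> = C / (c * (1 - w)) * ?a\<^sup>2" by (simp add: power2_eq_square)
      finally have 1: "prob ?B * prob (?A \<inter> ?B) / (1 - w) \<le> C / (c * (1 - w)) * ?a\<^sup>2" .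
      have "d * real n powr (- K) \<le> ?a / c" using elim(2) rate by linarith
      hence "real n powr (- K) \<le> ?a / (d * c)" using d(1) c(1) by (simp add: field_simps)
      hence "(real n powr (- K))\<^sup>2 \<le> (?a / (d * c))\<^sup>2" by (intro power_mono) auto
      moreover have "(real n powr (- K))\<^sup>2 = real n powr (- (2 * K))"
        by (simp add: power2_eq_square powr_add[symmetric])
      ultimately have "prob (?A - ?B) \<le> (?a / (d * c))\<^sup>2" using elim(3) by linarith
      hence 2: "prob (?A - ?B) / w \<le> 1 / ((d * c)\<^sup>2 * w) * ?a\<^sup>2"
        using w by (simp add: divide_right_mono power_divide field_simps)
      have "(\<integral>\<omega>. (IS_estimator M ?A ?B w \<omega>)\<^sup>2 \<partial>Q_measure M ?B w)
          \<le> prob ?B * prob (?A \<inter> ?B) / (1 - w) + prob (?A - ?B) / w"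
        by (rule IS_second_moment_le[OF prob_space_axioms ev w])
      also have "\<dots> \<le> D * ?a\<^sup>2" using 1 2 by (simp add: D_def distrib_right)
      finally show ?case by (simp add: Let_def)
    qed
  qed
qed

end

theorem theorem3p9:
  fixes M :: "'a measure" and Y :: "nat \<Rightarrow> 'a \<Rightarrow> real" and \<alpha> \<beta> w :: real
    and A :: "cadlag set" and ls :: "nat \<times> nat"
  assumes "prob_space M"
    and "prob_space.indep_vars M (\<lambda>_. borel) Y {1..}"
    and "\<And>k. k \<ge> 1 \<Longrightarrow> distr M borel (Y k) = distr M borel (Y 1)"
    and "integrable M (Y 1)" and "(\<integral>\<omega>. Y 1 \<omega> \<partial>M) = 0"
    and "\<alpha> > 1" and "\<beta> > 1"
    and "regularly_varying (\<lambda>x. measure M {\<omega>\<in>space M. Y 1 \<omega> \<le> - x}) (- \<alpha>)"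
    and "regularly_varying (\<lambda>x. measure M {\<omega>\<in>space M. Y 1 \<omega> \<ge> x}) (- \<beta>)"
    and "A \<in> sets borel"
    and "{l. is_arg_min (jump_cost \<alpha> \<beta>) (\<lambda>(lm, lp). D_jumps lm lp \<inter> A \<noteq> {}) l} = {ls}"
    and "bounded_away A (D_less \<alpha> \<beta> ls)"
    and "C_measure \<alpha> \<beta> ls (interior A) > 0"
    and "0 < w" and "w < 1"
  shows "\<exists>gm>0. \<exists>gp>0.
    (\<lambda>n. let An = walk_event M Y n A; Bn = walk_event M Y n (B_set \<alpha> \<beta> ls gm gp)
          in \<integral>\<omega>. (IS_estimator M An Bn w \<omega>)\<^sup>2 \<partial>Q_measure M Bn w)
      \<in> O(\<lambda>n. (measure M (walk_event M Y n A))\<^sup>2)"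
proof -
  interpret heavy_walk M Y \<alpha> \<beta>
    by (intro heavy_walk.intro heavy_walk_axioms.intro) (fact assms)+
  show ?thesis
  proof (rule strongly_efficient[OF assms(10,12,13,14,15)])
    fix g :: real
    assume "g > 0" "(\<lambda>n. let An = walk_event M Y n A; Bn = walk_event M Y n (B_set \<alpha> \<beta> ls g g)
          in \<integral>\<omega>. (IS_estimator M An Bn w \<omega>)\<^sup>2 \<partial>Q_measure M Bn w)
      \<in> O(\<lambda>n. (measure M (walk_event M Y n A))\<^sup>2)"
    thus ?thesis by (intro exI[of _ g] conjI)
  qed
qed

end
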